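(* Let $p\in(1,\infty)$, let $\Omega\subsetneq\mathbb R^d$ be an open set admitting the Hardy inequality with constant $\mathrm C_0(\Omega)$, let $\phi$ be a positive superharmonic function on $\Omega$, and let $-p+1<c<1$. Suppose $u\in C(\Omega)$ satisfies: $\mathrm{supp}(u)$ is a compact subset of $\Omega$; $u$ is twice continuously differentiable on $\{x\in\Omega:u(x)\ne0\}$; $\int_{\{u\ne0\}}|u|^{p-1}|D^2u|\,dx<\infty$; and $(\Delta u)1_{\{u\ne0\}}$ is bounded. Then for any $\lambda\ge0$, $$\int_\Omega|u|^p\phi^c\rho^{-2}\,dx\le N\int_{\Omega\cap\{u\neq 0\}}|\Delta u-\lambda u|^p\phi^c\rho^{2p-2}\,dx,$$ where $N=N(p,c,\mathrm C_0(\Omega))$.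
   Context: $\rho(x)=d(x,\partial\Omega)$. Hardy inequality: there is a constant $\mathrm C_0(\Omega)>0$ with $\int_\Omega|f/\rho|^2dx\le\mathrm C_0(\Omega)\int_\Omega|\nabla f|^2dx$ for all $f\in C_c^\infty(\Omega)$. A function $\phi\in L^1_{loc}(\Omega)$ is superharmonic if $\int_\Omega\phi\,\Delta\zeta\,dx\le0$ for all $\zeta\in C_c^\infty(\Omega)$ with $\zeta\ge0$. *)

theory Defs
  imports "HOL-Analysis.Analysis"
begin

text \<open>
  The constant in the theorem must not depend on the dimension, so the dimension \<open>d\<close> is
  quantified inside the statement and cannot be a type. A point of \<open>d\<close>-dimensional space is
  an extensional function on the index set \<open>{..<d}\<close>; the library's product topology and
  product measure over this index set have the same carrier.
\<close>

abbreviation Rd :: "nat \<Rightarrow> (nat \<Rightarrow> real) topology" where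
  "Rd d \<equiv> powertop_real {..<d}"

definition leb :: "nat \<Rightarrow> (nat \<Rightarrow> real) measure" where
  "leb d = completion (\<Pi>\<^sub>M i\<in>{..<d}. lborel)"

lemma space_leb: "space (leb d) = topspace (Rd d)"
  by (simp add: leb_def space_PiM)

definition bdry_dist :: "nat \<Rightarrow> (nat \<Rightarrow> real) set \<Rightarrow> (nat \<Rightarrow> real) \<Rightarrow> real" where
  "bdry_dist d \<Omega> x = (INF y\<in>Rd d frontier_of \<Omega>. L2_set (\<lambda>i. x i - y i) {..<d})"

definition partial :: "nat \<Rightarrow> ((nat \<Rightarrow> real) \<Rightarrow> real) \<Rightarrow> (nat \<Rightarrow> real) \<Rightarrow> real" where
  "partial i f x = deriv (\<lambda>t. f (x(i := t))) (x i)"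

definition laplacian :: "nat \<Rightarrow> ((nat \<Rightarrow> real) \<Rightarrow> real) \<Rightarrow> (nat \<Rightarrow> real) \<Rightarrow> real" where
  "laplacian d f x = (\<Sum>i<d. partial i (partial i f) x)"

definition grad_norm :: "nat \<Rightarrow> ((nat \<Rightarrow> real) \<Rightarrow> real) \<Rightarrow> (nat \<Rightarrow> real) \<Rightarrow> real" where
  "grad_norm d f x = L2_set (\<lambda>i. partial i f x) {..<d}"

definition hessian_norm :: "nat \<Rightarrow> ((nat \<Rightarrow> real) \<Rightarrow> real) \<Rightarrow> (nat \<Rightarrow> real) \<Rightarrow> real" where
  "hessian_norm d f x = L2_set (\<lambda>(i, j). partial i (partial j f) x) ({..<d} \<times> {..<d})"

text \<open>
  \<open>C_on d k U f\<close>: \<open>f\<close> is \<open>k\<close> times continuously differentiable on \<open>U\<close>. It is meant for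
  \<open>U\<close> open in \<open>Rd d\<close>, and then only the values of \<open>f\<close> on \<open>U\<close> matter.
\<close>

primrec C_on :: "nat \<Rightarrow> nat \<Rightarrow> (nat \<Rightarrow> real) set \<Rightarrow> ((nat \<Rightarrow> real) \<Rightarrow> real) \<Rightarrow> bool" where
  "C_on d 0 U f \<longleftrightarrow> continuous_map (subtopology (Rd d) U) euclideanreal f"
| "C_on d (Suc k) U f \<longleftrightarrow>
     continuous_map (subtopology (Rd d) U) euclideanreal f \<and>
     (\<forall>i<d. (\<forall>x\<in>U. (\<lambda>t. f (x(i := t))) differentiable (at (x i))) \<and> C_on d k U (partial i f))"

definition compactly_supported_in ::
    "nat \<Rightarrow> (nat \<Rightarrow> real) set \<Rightarrow> ((nat \<Rightarrow> real) \<Rightarrow> real) \<Rightarrow> bool" where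
  "compactly_supported_in d \<Omega> f \<longleftrightarrow>
     compactin (Rd d) (Rd d closure_of {x \<in> \<Omega>. f x \<noteq> 0}) \<and>
     Rd d closure_of {x \<in> \<Omega>. f x \<noteq> 0} \<subseteq> \<Omega>"

definition test_functions :: "nat \<Rightarrow> (nat \<Rightarrow> real) set \<Rightarrow> ((nat \<Rightarrow> real) \<Rightarrow> real) set" where
  "test_functions d \<Omega> = {f. (\<forall>k. C_on d k \<Omega> f) \<and> compactly_supported_in d \<Omega> f}"

definition hardy_inequality :: "nat \<Rightarrow> (nat \<Rightarrow> real) set \<Rightarrow> real \<Rightarrow> bool" where
  "hardy_inequality d \<Omega> C0 \<longleftrightarrow>
     0 < C0 \<and>
     (\<forall>f \<in> test_functions d \<Omega>.
        (\<integral>\<^sup>+x\<in>\<Omega>. ennreal (\<bar>f x / bdry_dist d \<Omega> x\<bar>\<^sup>2) \<partial>leb d)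
          \<le> ennreal C0 * (\<integral>\<^sup>+x\<in>\<Omega>. ennreal ((grad_norm d f x)\<^sup>2) \<partial>leb d))"

definition locally_integrable :: "nat \<Rightarrow> (nat \<Rightarrow> real) set \<Rightarrow> ((nat \<Rightarrow> real) \<Rightarrow> real) \<Rightarrow> bool" where
  "locally_integrable d \<Omega> \<phi> \<longleftrightarrow>
     (\<forall>K. compactin (Rd d) K \<longrightarrow> K \<subseteq> \<Omega> \<longrightarrow> set_integrable (leb d) K \<phi>)"

definition superharmonic :: "nat \<Rightarrow> (nat \<Rightarrow> real) set \<Rightarrow> ((nat \<Rightarrow> real) \<Rightarrow> real) \<Rightarrow> bool" where
  "superharmonic d \<Omega> \<phi> \<longleftrightarrow>
     locally_integrable d \<Omega> \<phi> \<and>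
     (\<forall>\<zeta> \<in> test_functions d \<Omega>. (\<forall>x\<in>\<Omega>. 0 \<le> \<zeta> x) \<longrightarrow>
        (LINT x:\<Omega>|leb d. \<phi> x * laplacian d \<zeta> x) \<le> 0)"

end

theory Submission
  imports Defs
begin

text \<open>
  After replacing \<open>u\<close> by \<open>v = \<bar>u\<bar>\<close>, suppose first that \<open>\<phi>\<close> is a smooth positive superharmonic weight
  \<open>\<psi>\<close>. With \<open>H v\<close> a truncation of \<open>v powr p / p\<close> that vanishes near \<open>v = 0\<close> and \<open>h = H'\<close>, put
  \<open>A = \<integral> h' |\<nabla>v|\<^sup>2 \<psi>\<^sup>c\<close>, \<open>B = \<integral> H |\<nabla>\<psi>|\<^sup>2 \<psi>\<^sup>c\<^sup>-\<^sup>2\<close> and \<open>D = \<integral> h (\<nabla>v \<cdot> \<nabla>\<psi>) \<psi>\<^sup>c\<^sup>-\<^sup>1\<close>.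
  Integration by parts gives \<open>- \<integral> h \<Delta>v \<psi>\<^sup>c = A + c D\<close> and, by superharmonicity, \<open>(1 - c) B \<le> D\<close>;
  since \<open>(p - 1) h\<^sup>2 \<le> p H h'\<close>, Young's inequality yields \<open>D \<le> p / ((p - 1) (1 - c)) A\<close>. Hence
  \<open>A + B\<close> is bounded by \<open>- \<integral> h \<Delta>v \<psi>\<^sup>c\<close> if \<open>- p + 1 < c < 1\<close>, and the Hardy inequality for
  \<open>v powr (p / 2) * \<psi> powr (c / 2)\<close> (truncated) bounds the left-hand side. The term \<open>\<lambda> u\<close> has a good
  sign, and another application of Young's inequality finishes the smooth case.

  A general \<open>\<phi>\<close> is replaced by \<open>\<psi> = \<phi> * \<eta> + \<delta>\<close> for a mollifier \<open>\<eta>\<close>, which is superharmonic near the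
  support of \<open>u\<close>. Because \<open>t powr c\<close> is Lipschitz on \<open>[\<delta>, \<infinity>)\<close>, convergence of the mollifications
  in \<open>L\<^sup>1\<close> suffices for removing \<open>\<eta>\<close>; afterwards \<open>\<delta> \<rightarrow> 0\<close> by Fatou on the left and by monotonicity
  (\<open>c \<le> 0\<close>) or subadditivity (\<open>0 < c\<close>) of \<open>t powr c\<close> on the right.
\<close>

section \<open>Functions of finitely many real coordinates\<close>

text \<open>The derivatives of \<open>v\<close> exist only where \<open>v\<close> is positive, and
  the first ones are not assumed bounded up to the edge of that set. This shapes the truncation: as
  it vanishes for \<open>v\<close> below a positive level, every integrand is continuous with
  compact support, and integration by parts reduces to Fubini and the fundamental theorem of
  calculus. The two identities come from the fields \<open>h(v) * \<psi> powr c * grad v\<close> and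
  \<open>H(v) * \<psi> powr (c - 1) * grad \<psi>\<close>; the divergence of the second also
  contains the Laplacian of \<open>\<psi>\<close>, which has a sign. The range of \<open>c\<close>
  becomes visible: \<open>c < 1\<close> makes the coefficient of \<open>B\<close> positive, and for
  negative \<open>c\<close> the bound on \<open>D\<close> leaves
  \<open>(p - 1 + c) / ((p - 1) * (1 - c))\<close> times \<open>A\<close>, positive just for
  \<open>c > 1 - p\<close>. Constants do not see the dimension because Young's inequality is applied
  coordinate by coordinate. Absorbing half of the left-hand side is legitimate only if that side is
  finite, which the bounded Laplacian ensures. The shift \<delta> is removed last, since \<phi> may
  have no positive lower bound near the support and \<open>t powr c\<close> is in general not
  Lipschitz near \<open>0\<close>.\<close>

text \<open>
  Points of \<open>Rd d\<close> are particular elements of the type \<open>nat \<Rightarrow> real\<close>, whose own (product) topology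
  induces that of \<open>Rd d\<close>. Continuity and compactness are therefore treated in this type; a function
  given on \<open>Rd d\<close> only is extended by \<open>\<lambda>x. f (restrict x {..<d})\<close>.
\<close>

abbreviation lebm :: "nat \<Rightarrow> (nat \<Rightarrow> real) measure" where
  "lebm d \<equiv> \<Pi>\<^sub>M i\<in>{..<d}. lborel"

text \<open>\<open>deriv\<close> has a value even where no derivative exists, so
  \<open>partial\<close> alone says nothing about differentiability. This relation records existence
  together with the value.\<close>

definition has_partial :: "nat \<Rightarrow> ((nat \<Rightarrow> real) \<Rightarrow> real) \<Rightarrow> (nat \<Rightarrow> real) \<Rightarrow> real \<Rightarrow> bool" where
  "has_partial i f x D \<longleftrightarrow> ((\<lambda>t. f (x(i := t))) has_real_derivative D) (at (x i))"

lemma product_sigma_finite_lborel: "product_sigma_finite (\<lambda>_. lborel :: real measure)"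
  by (simp add: product_sigma_finite_def sigma_finite_lborel)

lemma space_lebm: "space (lebm d) = topspace (Rd d)"
  by (simp add: space_PiM)

text \<open>Extensional functions take the constant value \<open>undefined\<close> at every index
  from \<open>d\<close> on, so these coordinates are trivially continuous and only the projections
  below \<open>d\<close> remain.\<close>

lemma continuous_map_Rd_euclidean: "continuous_map (Rd d) euclidean (\<lambda>x. x)"
proof -
  have "continuous_map (Rd d) euclideanreal (\<lambda>x. x i)" for i
  proof (cases "i < d")
    case True then show ?thesis by (intro continuous_map_product_projection) auto
  next
    case False
    have "continuous_map (Rd d) euclideanreal (\<lambda>x. undefined)" by simp
    then show ?thesis
      by (rule continuous_map_eq) (use False in \<open>auto simp: PiE_def extensional_def\<close>)
  qed
  then show ?thesis
    by (simp add: continuous_map_componentwise_UNIV flip: euclidean_product_topology)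
qed

lemma continuous_map_euclidean_Rd: "continuous_map euclidean (Rd d) (\<lambda>x. restrict x {..<d})"
  unfolding continuous_map_componentwise
  by (auto intro!: continuous_on_product_coordinates)

text \<open>Inclusion and \<open>restrict\<close> are continuous in opposite directions and
  \<open>restrict\<close> fixes the points of \<open>Rd d\<close>, so compact images carry
  compactness both ways.\<close>

lemma compactin_Rd_iff: "compactin (Rd d) K \<longleftrightarrow> compact K \<and> K \<subseteq> topspace (Rd d)"
proof (intro iffI conjI)
  assume K: "compactin (Rd d) K"
  show "K \<subseteq> topspace (Rd d)" using K by (rule compactin_subset_topspace)
  show "compact K"
    using image_compactin[OF K continuous_map_Rd_euclidean] by simp
next
  assume K: "compact K \<and> K \<subseteq> topspace (Rd d)"
  have "(\<lambda>x. restrict x {..<d}) ` K = K"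
    using K by (force simp: PiE_def extensional_restrict image_iff)
  then show "compactin (Rd d) K"
    using image_compactin[OF _ continuous_map_euclidean_Rd, of K d] K by simp
qed

lemma continuous_map_Rd_if_continuous_on:
  assumes "continuous_on UNIV (f :: (nat \<Rightarrow> real) \<Rightarrow> real)"
  shows "continuous_map (subtopology (Rd d) U) euclideanreal f"
  using continuous_map_compose[OF continuous_map_Rd_euclidean, of euclideanreal f d] assms
  by (auto intro: continuous_map_from_subtopology simp: comp_def)

text \<open>The index type is countable, so the Borel sets of the function type are generated by the
  coordinates. Continuity in the type therefore yields measurability for the product
  measure.\<close>

lemma measurable_lebm_borel: "(\<lambda>x. x) \<in> lebm d \<rightarrow>\<^sub>M borel"
proof -
  have "(\<lambda>x. x) \<in> lebm d \<rightarrow>\<^sub>M (\<Pi>\<^sub>M i\<in>UNIV. borel)"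
  proof (rule measurable_PiM_single')
    show "(\<lambda>x. x i) \<in> lebm d \<rightarrow>\<^sub>M borel" for i
    proof (cases "i < d")
      case True
      then show ?thesis
        using measurable_component_singleton[of i "{..<d}" "\<lambda>_. lborel"] by simp
    next
      case False
      have "(\<lambda>x. undefined) \<in> lebm d \<rightarrow>\<^sub>M borel" by simp
      then show ?thesis
        by (rule measurable_cong[THEN iffD2, rotated])
           (use False in \<open>auto simp: space_PiM PiE_def extensional_def\<close>)
    qed
  qed auto
  then show ?thesis by (simp add: sets_PiM_equal_borel cong: measurable_cong_sets)
qed

lemma borel_measurable_lebm: "f \<in> borel_measurable borel \<Longrightarrow> f \<in> borel_measurable (lebm d)"
  using measurable_compose[OF measurable_lebm_borel] by blast

lemma borel_measurable_lebm_continuous: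
  "continuous_on UNIV (f :: (nat \<Rightarrow> real) \<Rightarrow> real) \<Longrightarrow> f \<in> borel_measurable (lebm d)"
  by (intro borel_measurable_lebm borel_measurable_continuous_onI)

section \<open>Cubes, compact sets and integrability\<close>

definition cube :: "nat \<Rightarrow> real \<Rightarrow> (nat \<Rightarrow> real) set" where
  "cube d R = PiE {..<d} (\<lambda>_. {- R..R})"

lemma cube_subset: "cube d R \<subseteq> topspace (Rd d)" by (auto simp: cube_def)

lemma compact_cube: "compact (cube d R)"
proof -
  have "compactin (Rd d) (cube d R)"
    unfolding cube_def by (subst compactin_PiE) auto
  then show ?thesis by (simp add: compactin_Rd_iff)
qed

lemma cube_sets: "cube d R \<in> sets (lebm d)"
  unfolding cube_def by (intro sets_PiM_I_finite) auto

lemma emeasure_cube: "emeasure (lebm d) (cube d R) < \<infinity>"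
proof -
  interpret product_sigma_finite "\<lambda>_. lborel :: real measure" by (rule product_sigma_finite_lborel)
  show ?thesis unfolding cube_def
    by (subst emeasure_PiM) (auto simp: ennreal_prod_eq_top less_top[symmetric] emeasure_lborel_Icc_eq power_eq_top_ennreal)
qed

lemma cube_eq: "cube d R = {x \<in> topspace (Rd d). \<forall>i<d. \<bar>x i\<bar> \<le> R}"
proof -
  have "t \<in> {- R..R} \<longleftrightarrow> \<bar>t\<bar> \<le> R" for t :: real by auto
  then show ?thesis by (auto simp: cube_def PiE_iff extensional_def)
qed

lemma compact_in_cube:
  assumes "compact K" "K \<subseteq> topspace (Rd d)"
  obtains R where "R > 0" "K \<subseteq> cube d R"
proof -
  have "\<exists>B. \<forall>x\<in>K. \<bar>x i\<bar> \<le> B" for i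
  proof -
    have "compact ((\<lambda>x. x i) ` K)"
      by (rule compact_continuous_image[OF continuous_on_subset[OF continuous_on_product_coordinates] assms(1)]) auto
    then show ?thesis by (auto dest!: compact_imp_bounded simp: bounded_iff)
  qed
  then obtain B where B: "\<And>i x. x \<in> K \<Longrightarrow> \<bar>x i\<bar> \<le> B i" by metis
  define R where "R = 1 + (\<Sum>i<d. \<bar>B i\<bar>)"
  have "\<bar>x i\<bar> \<le> R" if "x \<in> K" "i < d" for x i
  proof -
    have "\<bar>B i\<bar> \<le> (\<Sum>i<d. \<bar>B i\<bar>)" using that by (intro member_le_sum) auto
    then show ?thesis using B[OF that(1), of i] by (simp add: R_def)
  qed
  moreover have "R > 0" by (simp add: R_def add_pos_nonneg sum_nonneg)
  ultimately show ?thesis using that[of R] assms(2) by (auto simp: cube_eq)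
qed

lemma compact_bounded_fun:
  assumes "continuous_on UNIV (f :: (nat \<Rightarrow> real) \<Rightarrow> real)" "compact K"
  obtains B where "B > 0" "\<And>x. x \<in> K \<Longrightarrow> \<bar>f x\<bar> \<le> B"
proof -
  have "compact (f ` K)"
    by (rule compact_continuous_image[OF continuous_on_subset[OF assms(1)] assms(2)]) auto
  then obtain B where "\<forall>y\<in>f ` K. norm y \<le> B" by (auto dest!: compact_imp_bounded simp: bounded_iff)
  then show ?thesis using that[of "max B 1"] by force
qed

lemma compact_sets_lebm:
  assumes "compact K" "K \<subseteq> topspace (Rd d)"
  shows "K \<in> sets (lebm d)"
proof -
  have "(\<lambda>x. x) -` K \<inter> space (lebm d) \<in> sets (lebm d)"
    by (rule measurable_sets[OF measurable_lebm_borel])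
       (use assms in \<open>auto intro: borel_closed compact_imp_closed\<close>)
  moreover have "(\<lambda>x. x) -` K \<inter> space (lebm d) = K" using assms by (auto simp: space_PiM)
  ultimately show ?thesis by simp
qed

lemma emeasure_compact:
  assumes "compact K" "K \<subseteq> topspace (Rd d)"
  shows "emeasure (lebm d) K < \<infinity>"
proof -
  obtain R where "K \<subseteq> cube d R" using compact_in_cube[OF assms] by blast
  then have "emeasure (lebm d) K \<le> emeasure (lebm d) (cube d R)"
    by (intro emeasure_mono cube_sets)
  then show ?thesis using emeasure_cube[of d R] by (rule le_less_trans)
qed

lemma integrable_bounded_support:
  assumes "f \<in> borel_measurable (lebm d)" "K \<in> sets (lebm d)" "emeasure (lebm d) K < \<infinity>"
    and "\<And>x. x \<in> K \<Longrightarrow> \<bar>f x\<bar> \<le> B"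
    and "\<And>x. x \<in> topspace (Rd d) \<Longrightarrow> x \<notin> K \<Longrightarrow> f x = (0::real)"
  shows "integrable (lebm d) f"
proof (rule Bochner_Integration.integrable_bound)
  show "integrable (lebm d) (\<lambda>x. B * indicator K x)"
    using assms by (auto simp: integrable_indicator_iff less_top)
  have "norm (f x) \<le> norm (B * indicator K x)" if "x \<in> space (lebm d)" for x
    using that assms(4)[of x] assms(5)[of x] by (cases "x \<in> K") (auto simp: space_PiM)
  then show "AE x in lebm d. norm (f x) \<le> norm (B * indicator K x)" by auto
qed (use assms in auto)

lemma integrable_continuous_compact_support:
  assumes "continuous_on UNIV f" "compact K" "K \<subseteq> topspace (Rd d)"
    and "\<And>x. x \<in> topspace (Rd d) \<Longrightarrow> x \<notin> K \<Longrightarrow> f x = (0::real)"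
  shows "integrable (lebm d) f"
proof -
  obtain B where "\<And>x. x \<in> K \<Longrightarrow> \<bar>f x\<bar> \<le> B" using compact_bounded_fun[OF assms(1,2)] by blast
  then show ?thesis
    by (rule integrable_bounded_support[OF borel_measurable_lebm_continuous[OF assms(1)]
          compact_sets_lebm[OF assms(2,3)] emeasure_compact[OF assms(2,3)] _ assms(4)])
qed

section \<open>Partial derivatives along coordinate lines and integration by parts\<close>

lemma continuous_on_fun_upd: "continuous_on UNIV (\<lambda>t. (x :: nat \<Rightarrow> real)(i := t))"
proof (rule continuous_on_coordinatewise_then_product)
  show "continuous_on UNIV (\<lambda>t. (x(i := t)) j)" for j
    by (cases "j = i") auto
qed

lemma eventually_fun_upd:
  assumes "open U" "(x :: nat \<Rightarrow> real) \<in> U"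
  shows "\<forall>\<^sub>F t in nhds (x i). x(i := t) \<in> U"
proof -
  have "open ((\<lambda>t. x(i := t)) -` U)"
    using assms(1) continuous_on_fun_upd by (simp add: continuous_on_open_vimage)
  moreover have "x i \<in> (\<lambda>t. x(i := t)) -` U" using assms(2) by simp
  ultimately show ?thesis unfolding eventually_nhds by auto
qed

lemma has_partial_cong:
  assumes "open U" "x \<in> U" "\<And>y. y \<in> U \<Longrightarrow> f y = g y"
  shows "has_partial i f x D \<longleftrightarrow> has_partial i g x D"
  unfolding has_partial_def
  by (rule DERIV_cong_ev) (use eventually_mono[OF eventually_fun_upd[OF assms(1,2)] assms(3)] in auto)

lemma has_partial_imp_partial: "has_partial i f x D \<Longrightarrow> partial i f x = D"
  by (simp add: has_partial_def partial_def DERIV_imp_deriv)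

text \<open>Fubini isolates coordinate \<open>i\<close>; on each line the fundamental theorem of
  calculus leaves the difference of two boundary values beyond the support. Every later integration
  by parts applies this to a product.\<close>

lemma integral_partial_eq_0:
  assumes i: "i < d" and cont: "continuous_on UNIV f'"
    and der: "\<And>x. x \<in> topspace (Rd d) \<Longrightarrow> has_partial i f x (f' x)"
    and K: "compact K" "K \<subseteq> topspace (Rd d)"
    and supp: "\<And>x. x \<in> topspace (Rd d) \<Longrightarrow> x \<notin> K \<Longrightarrow> f x = 0"
  shows "integrable (lebm d) f' \<and> integral\<^sup>L (lebm d) f' = 0"
proof -
  interpret product_sigma_finite "\<lambda>_. lborel :: real measure" by (rule product_sigma_finite_lborel)
  \<comment> \<open>The complement of \<open>K\<close> is open, so \<open>f\<close> is zero on a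
    piece of the coordinate line through \<open>x\<close>, and uniqueness of the derivative forces
    zero.\<close>
  have supp': "f' x = 0" if x: "x \<in> topspace (Rd d)" "x \<notin> K" for x
  proof -
    have "open (- K)" using K by (auto intro: compact_imp_closed)
    then have "\<forall>\<^sub>F t in nhds (x i). x(i := t) \<in> - K" using x by (intro eventually_fun_upd) auto
    then have "\<forall>\<^sub>F t in nhds (x i). f (x(i := t)) = 0"
      by eventually_elim (use x i in \<open>auto intro!: supp simp: PiE_iff extensional_def\<close>)
    moreover have "((\<lambda>t. f (x(i := t))) has_real_derivative f' x) (at (x i))"
      using der[OF x(1)] by (simp add: has_partial_def)
    ultimately have "((\<lambda>t. 0) has_real_derivative f' x) (at (x i))"
      by (subst (asm) DERIV_cong_ev[of "x i" _ _ "\<lambda>_. 0" "f' x"]) auto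
    then show ?thesis using DERIV_unique DERIV_const by blast
  qed
  have int: "integrable (lebm d) f'"
    by (rule integrable_continuous_compact_support[OF cont K supp'])
  obtain R where R: "R > 0" "K \<subseteq> cube d R" using compact_in_cube[OF K] by blast
  define J where "J = {..<d} - {i}"
  have J: "{..<d} = insert i J" "i \<notin> J" "finite J" using i by (auto simp: J_def)
  have "integral\<^sup>L (lebm d) f' = (\<integral>x. (\<integral>t. f' (x(i := t)) \<partial>lborel) \<partial>(\<Pi>\<^sub>M i\<in>J. lborel))"
    using int unfolding J(1) by (rule product_integral_insert[OF J(3,2)])
  also have "\<dots> = (\<integral>x. 0 \<partial>(\<Pi>\<^sub>M i\<in>J. (lborel :: real measure)))"
  proof (rule Bochner_Integration.integral_cong[OF refl])
    fix x assume "x \<in> space (\<Pi>\<^sub>M i\<in>J. lborel :: real measure)"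
    then have x: "x(i := t) \<in> topspace (Rd d)" for t
      using J by (auto simp: space_PiM PiE_iff extensional_def)
    have z: "f (x(i := t)) = 0" "f' (x(i := t)) = 0" if "\<bar>t\<bar> > R" for t
    proof -
      have "x(i := t) \<notin> cube d R" using that i by (auto simp: cube_eq intro!: exI[of _ i])
      then have "x(i := t) \<notin> K" using R(2) by blast
      then show "f (x(i := t)) = 0" "f' (x(i := t)) = 0" using supp supp' x by auto
    qed
    have d: "((\<lambda>t. f (x(i := t))) has_real_derivative f' (x(i := t))) (at t)" for t
      using der[OF x[of t]] by (simp add: has_partial_def)
    have c: "continuous_on UNIV (\<lambda>t. f' (x(i := t)))"
      using continuous_on_compose2[OF cont continuous_on_fun_upd] by auto
    \<comment> \<open>The endpoints lie one unit beyond the cube, because vanishing is known only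
      for \<open>\<bar>t\<bar>\<close> strictly larger than \<open>R\<close>.\<close>
    have "has_bochner_integral lborel (\<lambda>t. f' (x(i := t)) * indicator {-(R+1)..R+1} t)
        (f (x(i := R+1)) - f (x(i := -(R+1))))"
      using R(1) d c
      by (intro has_bochner_integral_FTC_Icc_real[where F = "\<lambda>t. f (x(i := t))"])
        (auto simp: continuous_on_eq_continuous_at simp del: fun_upd_apply)
    moreover have "(\<lambda>t. f' (x(i := t)) * indicator {-(R+1)..R+1} t) = (\<lambda>t. f' (x(i := t)))"
      using z(2) by (force simp: indicator_def fun_eq_iff)
    ultimately show "(\<integral>t. f' (x(i := t)) \<partial>lborel) = 0"
      using z(1)[of "R+1"] z(1)[of "-(R+1)"] R(1)
      by (simp add: has_bochner_integral_integral_eq)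
  qed
  finally show ?thesis using int by simp
qed

section \<open>A smooth bump function\<close>

text \<open>The difference quotient is at most \<open>C * \<bar>s - t\<bar> powr (a - 1)\<close>.
  This serves where two defining formulas meet: at \<open>\<bar>t\<bar> = 1\<close> for the bump and
  at \<open>s = e\<close> for truncated powers.\<close>

lemma has_derivative_zero_if_superlinear:
  fixes f :: "real \<Rightarrow> real"
  assumes "1 < a" "f t = 0" "\<And>s. \<bar>f s\<bar> \<le> C * \<bar>s - t\<bar> powr a"
  shows "(f has_real_derivative 0) (at t)"
proof -
  have "((\<lambda>s. C * \<bar>s - t\<bar> powr (a - 1)) \<longlongrightarrow> C * \<bar>t - t\<bar> powr (a - 1)) (at t)"
    using assms(1) by (intro tendsto_intros) auto
  then have lim: "((\<lambda>s. C * \<bar>s - t\<bar> powr (a - 1)) \<longlongrightarrow> 0) (at t)" using assms(1) by simp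
  have "((\<lambda>s. (f s - f t) / (s - t)) \<longlongrightarrow> 0) (at t)"
  proof (rule Lim_null_comparison[OF _ lim])
    have "norm ((f s - f t) / (s - t)) \<le> C * \<bar>s - t\<bar> powr (a - 1)" if "s \<noteq> t" for s
      using assms(3)[of s] that assms(2) by (simp add: powr_diff field_simps)
    then show "\<forall>\<^sub>F s in at t. norm ((f s - f t) / (s - t)) \<le> C * \<bar>s - t\<bar> powr (a - 1)"
      by (auto simp: eventually_at intro!: exI[of _ 1])
  qed
  then show ?thesis by (simp add: has_field_derivative_iff)
qed

lemma power_le_fact_exp:
  fixes w :: real assumes "0 \<le> w" shows "w ^ n \<le> fact n * exp w"
proof -
  have "(\<Sum>k\<in>{n}. w ^ k /\<^sub>R fact k) \<le> exp w"
    using assms unfolding exp_def by (intro sum_le_suminf summable_exp_generic) auto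
  then show ?thesis by (simp add: field_simps)
qed

text \<open>The standard bump is \<open>exp (- 1 / (1 - t ^ 2))\<close>. Its derivatives stay in the
  class polynomial times power of \<open>1 / (1 - t ^ 2)\<close> times the exponential, so each of
  them is explicit, also across \<open>\<bar>t\<bar> = 1\<close>.\<close>

definition bump_fun :: "real poly \<Rightarrow> nat \<Rightarrow> real \<Rightarrow> real" where
  "bump_fun p m t =
     (if \<bar>t\<bar> < 1 then poly p t * (1 / (1 - t\<^sup>2)) ^ m * exp (- (1 / (1 - t\<^sup>2))) else 0)"

text \<open>\<open>[:1, 0, -1:]\<close> is \<open>1 - t ^ 2\<close>. The three summands come from
  differentiating the polynomial, the power and the exponential, all brought to the power
  \<open>m + 2\<close> of \<open>1 / (1 - t ^ 2)\<close>.\<close>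

definition bump_next :: "real poly \<Rightarrow> nat \<Rightarrow> real poly" where
  "bump_next p m = pderiv p * [:1, 0, -1:]\<^sup>2 + [:0, 2 * of_nat m:] * p * [:1, 0, -1:] - [:0, 2:] * p"

lemma has_derivative_bump_fun: "(bump_fun p m has_real_derivative bump_fun (bump_next p m) (m + 2) t) (at t)"
proof -
  consider "\<bar>t\<bar> < 1" | "\<bar>t\<bar> = 1" | "\<bar>t\<bar> > 1" by linarith
  then show ?thesis
  proof cases
    case 1
    then have w: "1 - t\<^sup>2 > 0" by (simp add: abs_square_less_1)
    define E where "E = exp (- (1 / (1 - t\<^sup>2)))"
    define v where "v = 1 / (1 - t\<^sup>2)"
    have v: "(1 - t\<^sup>2) * v = 1" using w by (simp add: v_def)
    have dv: "((\<lambda>t. 1 / (1 - t\<^sup>2)) has_real_derivative 2 * t * v\<^sup>2) (at t)"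
      using w by (auto intro!: derivative_eq_intros simp: v_def power2_eq_square field_simps)
    have dvm: "((\<lambda>t. (1 / (1 - t\<^sup>2)) ^ m) has_real_derivative of_nat m * 2 * t * v ^ (m + 1)) (at t)"
    proof (cases m)
      case (Suc n)
      show ?thesis unfolding Suc
        by (rule DERIV_cong[OF DERIV_power_Suc[OF dv]]) (simp add: v_def power2_eq_square)
    qed simp
    have dE: "((\<lambda>t. exp (- (1 / (1 - t\<^sup>2)))) has_real_derivative - (2 * t * v\<^sup>2) * exp (- v)) (at t)"
      by (rule DERIV_cong[OF DERIV_fun_exp[OF DERIV_minus[OF dv]]]) (simp add: v_def)
    have "((\<lambda>t. poly p t * (1 / (1 - t\<^sup>2)) ^ m * exp (- (1 / (1 - t\<^sup>2)))) has_real_derivative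
        (poly (pderiv p) t * v ^ m + of_nat m * 2 * t * v ^ (m + 1) * poly p t) * exp (- v)
          + - (2 * t * v\<^sup>2) * exp (- v) * (poly p t * v ^ m)) (at t)"
      using DERIV_mult[OF DERIV_mult[OF poly_DERIV[of p t] dvm] dE] by (simp add: v_def)
    also have "(poly (pderiv p) t * v ^ m + of_nat m * 2 * t * v ^ (m + 1) * poly p t) * exp (- v)
          + - (2 * t * v\<^sup>2) * exp (- v) * (poly p t * v ^ m)
        = (poly (pderiv p) t * ((1 - t\<^sup>2) * v)\<^sup>2 + of_nat m * 2 * t * v * ((1 - t\<^sup>2) * v) * poly p t
            - 2 * t * v\<^sup>2 * poly p t) * v ^ m * exp (- v)"
      unfolding v by (simp add: algebra_simps)
    also have "\<dots> = bump_fun (bump_next p m) (m + 2) t"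
    proof -
      have "bump_fun q (m + 2) t = poly q t * v ^ (m + 2) * exp (- v)" for q
        using 1 by (simp add: bump_fun_def v_def)
      then show ?thesis by (simp add: bump_next_def algebra_simps power2_eq_square)
    qed
    finally have "((\<lambda>t. poly p t * (1 / (1 - t\<^sup>2)) ^ m * exp (- (1 / (1 - t\<^sup>2)))) has_real_derivative
        bump_fun (bump_next p m) (m + 2) t) (at t)" .
    moreover have "\<forall>\<^sub>F s in nhds t. bump_fun p m s = poly p s * (1 / (1 - s\<^sup>2)) ^ m * exp (- (1 / (1 - s\<^sup>2)))"
    proof -
      have "\<forall>\<^sub>F s in nhds t. s \<in> {-1<..<1}" using 1 by (intro eventually_nhds_in_open) auto
      then show ?thesis by eventually_elim (auto simp: bump_fun_def)
    qed
    ultimately show ?thesis by (subst DERIV_cong_ev) auto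
  next
    case 2
    have "compact (poly p ` {-1..1})" by (intro compact_continuous_image continuous_intros) auto
    then obtain C where "\<forall>y\<in>poly p ` {-1..1}. norm y \<le> C" by (auto dest!: compact_imp_bounded simp: bounded_iff)
    then have C: "\<bar>poly p s\<bar> \<le> C" if "\<bar>s\<bar> \<le> 1" for s using that by (force simp: abs_le_iff)
    have bd: "\<bar>bump_fun p m s\<bar> \<le> (C * fact (m + 2) * 4) * \<bar>s - t\<bar> powr 2" for s
    proof (cases "\<bar>s\<bar> < 1")
      case True
      then have w: "1 - s\<^sup>2 > 0" by (simp add: abs_square_less_1)
      define v where "v = 1 / (1 - s\<^sup>2)"
      have v: "v > 0" using w by (simp add: v_def)
      \<comment> \<open>The exponential beats any power. Spending two extra powers of
        \<open>v\<close> gains the factor \<open>(1 - s ^ 2) ^ 2\<close>, which is quadratic in the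
        distance to \<open>t\<close>, so the derivative at the seam is \<open>0\<close>.\<close>
      have "v ^ (m + 2) * exp (- v) \<le> fact (m + 2)"
        using power_le_fact_exp[of v "m + 2"] v by (simp add: exp_minus field_simps)
      then have "v ^ m * exp (- v) * v\<^sup>2 \<le> fact (m + 2)" by (simp add: algebra_simps power2_eq_square)
      then have *: "v ^ m * exp (- v) \<le> fact (m + 2) * (1 - s\<^sup>2)\<^sup>2"
        using w by (simp add: v_def field_simps power_divide)
      have "(1 - \<bar>s\<bar>) \<le> \<bar>s - t\<bar>" using 2 by linarith
      then have "(1 - \<bar>s\<bar>) * (1 + \<bar>s\<bar>) \<le> \<bar>s - t\<bar> * 2" using True by (intro mult_mono) auto
      then have "1 - s\<^sup>2 \<le> \<bar>s - t\<bar> * 2" by (simp add: algebra_simps power2_eq_square)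
      then have "(1 - s\<^sup>2)\<^sup>2 \<le> (\<bar>s - t\<bar> * 2)\<^sup>2" using w by (intro power_mono) auto
      then have **: "v ^ m * exp (- v) \<le> fact (m + 2) * (4 * \<bar>s - t\<bar> powr 2)"
        using * by (auto simp: power_mult_distrib intro: order_trans mult_left_mono)
      have "\<bar>bump_fun p m s\<bar> = \<bar>poly p s\<bar> * (v ^ m * exp (- v))"
        using True v by (simp add: bump_fun_def abs_mult v_def)
      also have "\<dots> \<le> C * (fact (m + 2) * (4 * \<bar>s - t\<bar> powr 2))"
        using True v C[of s] by (intro mult_mono[OF _ **]) auto
      finally show ?thesis by (simp add: algebra_simps)
    next
      case False
      have "0 \<le> C" using C[of 0] by simp
      then show ?thesis using False by (simp add: bump_fun_def)
    qed
    have "(bump_fun p m has_real_derivative 0) (at t)"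
      by (rule has_derivative_zero_if_superlinear[OF _ _ bd]) (use 2 in \<open>auto simp: bump_fun_def\<close>)
    then show ?thesis using 2 by (simp add: bump_fun_def)
  next
    case 3
    have "\<forall>\<^sub>F s in nhds t. s \<in> - {-1..1}" using 3 by (intro eventually_nhds_in_open) auto
    then have "\<forall>\<^sub>F s in nhds t. bump_fun p m s = 0" by eventually_elim (auto simp: bump_fun_def)
    then have "(bump_fun p m has_real_derivative 0) (at t)" by (subst DERIV_cong_ev) auto
    then show ?thesis using 3 by (simp add: bump_fun_def)
  qed
qed

fun bump_poly :: "nat \<Rightarrow> real poly" where
  "bump_poly 0 = 1"
| "bump_poly (Suc k) = bump_next (bump_poly k) (2 * k)"

text \<open>\<open>B k\<close> is the \<open>k\<close>-th derivative of the kernel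
  \<open>B 0\<close>. Carrying the whole sequence turns each differentiation of a product kernel
  into an increment of an index.\<close>

definition mollifier_family :: "real \<Rightarrow> (nat \<Rightarrow> real \<Rightarrow> real) \<Rightarrow> bool" where
  "mollifier_family r B \<longleftrightarrow>
     (\<forall>k t. (B k has_real_derivative B (Suc k) t) (at t)) \<and> (\<forall>k t. r \<le> \<bar>t\<bar> \<longrightarrow> B k t = 0) \<and>
     (\<forall>t. 0 \<le> B 0 t) \<and> integral\<^sup>L lborel (B 0) = 1"

lemma mollifier_familyD:
  assumes "mollifier_family r B"
  shows "(B k has_real_derivative B (Suc k) t) (at t)" "r \<le> \<bar>t\<bar> \<Longrightarrow> B k t = 0" "0 \<le> B 0 t"
    "integral\<^sup>L lborel (B 0) = 1"
    "continuous_on A (B k)" "(B k) \<in> borel_measurable borel"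
proof -
  show c: "continuous_on A (B k)" for A
    using assms unfolding mollifier_family_def
    by (intro DERIV_continuous_on[where D = "B (Suc k)"]) (auto intro: DERIV_subset)
  show "(B k) \<in> borel_measurable borel" by (intro borel_measurable_continuous_onI c)
qed (use assms in \<open>auto simp: mollifier_family_def\<close>)

lemma mollifier_family_bounded:
  assumes "mollifier_family r B"
  obtains M where "\<And>t. \<bar>B k t\<bar> \<le> M"
proof -
  have "compact (B k ` {- r..r})"
    by (intro compact_continuous_image mollifier_familyD[OF assms]) auto
  then obtain C where C: "\<forall>y\<in>B k ` {- r..r}. norm y \<le> C"
    by (auto dest!: compact_imp_bounded simp: bounded_iff)
  have "\<bar>B k t\<bar> \<le> max C 0" for t
    using C mollifier_familyD(2)[OF assms, of t k] by (cases "\<bar>t\<bar> < r") (auto simp: le_max_iff_disj abs_less_iff)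
  then show ?thesis by (rule that)
qed

lemma mollifier_family_integrable:
  assumes "mollifier_family r B"
  shows "integrable lborel (B 0)"
  using mollifier_familyD(4)[OF assms] not_integrable_integral_eq by fastforce

lemma bump_family_exists: "\<exists>B. mollifier_family 1 B"
proof -
  define B0 where "B0 = (\<lambda>k. bump_fun (bump_poly k) (2 * k))"
  have d: "(B0 k has_real_derivative B0 (Suc k) t) (at t)" for k t
    using has_derivative_bump_fun[of "bump_poly k" "2 * k" t] by (simp add: B0_def)
  have z: "B0 k t = 0" if "1 \<le> \<bar>t\<bar>" for k t using that by (simp add: B0_def bump_fun_def)
  have nn: "0 \<le> B0 0 t" for t by (simp add: B0_def bump_fun_def)
  have c: "continuous_on A (B0 0)" for A
    by (intro DERIV_continuous_on[where D = "B0 1"]) (use d[of 0] in \<open>auto intro: DERIV_subset\<close>)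
  have "integrable lborel (\<lambda>t. indicator {-1..1} t *\<^sub>R B0 0 t)"
    using borel_integrable_atLeastAtMost'[OF c, of "-1" 1] by (simp add: set_integrable_def)
  also have "(\<lambda>t. indicator {-1..1} t *\<^sub>R B0 0 t) = B0 0"
    using z by (force simp: indicator_def fun_eq_iff)
  finally have int: "integrable lborel (B0 0)" .
  have "integral\<^sup>L lborel (B0 0) \<noteq> 0"
  proof
    assume "integral\<^sup>L lborel (B0 0) = 0"
    then have "AE t in lborel. B0 0 t = 0" using integral_nonneg_eq_0_iff_AE[OF int] nn by simp
    then have "AE t in lborel. t \<notin> {-1<..<1::real}"
      by eventually_elim (auto simp: B0_def bump_fun_def split: if_splits)
    then have "emeasure lborel {-1<..<1::real} = 0"
      by (subst (asm) AE_iff_measurable[of "{-1<..<1}"]) auto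
    then show False by simp
  qed
  moreover have "0 \<le> integral\<^sup>L lborel (B0 0)" using nn by simp
  ultimately have I: "integral\<^sup>L lborel (B0 0) > 0" by linarith
  define I where "I = integral\<^sup>L lborel (B0 0)"
  have "mollifier_family 1 (\<lambda>k t. B0 k t / I)"
    unfolding mollifier_family_def using d z nn I int
    by (auto simp: I_def intro!: DERIV_cdivide)
  then show ?thesis by blast
qed

lemma mollifier_family_exists:
  assumes r: "0 < r"
  obtains B where "mollifier_family r B"
proof -
  obtain B where B: "mollifier_family 1 B" using bump_family_exists by blast
  \<comment> \<open>Each derivative of the dilated kernel contributes a factor \<open>1 / r\<close>;
    the one further factor keeps the integral equal to \<open>1\<close>.\<close>
  define B' where "B' = (\<lambda>k t. (1 / r) ^ (k + 1) * B k (1 / r * t))"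
  have "(B' k has_real_derivative B' (Suc k) t) (at t)" for k t
  proof -
    have "((\<lambda>t. B k (1 / r * t)) has_real_derivative B (Suc k) (1 / r * t) * (1 / r)) (at t)"
      by (rule DERIV_chain2[OF mollifier_familyD(1)[OF B]], rule DERIV_cong[OF DERIV_cmult[OF DERIV_ident]]) simp
    from DERIV_cmult[OF this, of "(1 / r) ^ (k + 1)"] show ?thesis
      unfolding B'_def by (simp add: mult_ac)
  qed
  moreover have "B' k t = 0" if "r \<le> \<bar>t\<bar>" for k t
    using mollifier_familyD(2)[OF B, of "1 / r * t" k] that r by (simp add: B'_def abs_mult)
  moreover have "0 \<le> B' 0 t" for t using r mollifier_familyD(3)[OF B] by (simp add: B'_def)
  moreover have "integral\<^sup>L lborel (B' 0) = 1"
  proof -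
    have "1 / r \<noteq> 0" using r by simp
    from lborel_integral_real_affine[OF this, of "B 0" 0] show ?thesis
      using r mollifier_familyD(4)[OF B] by (simp add: B'_def)
  qed
  ultimately show ?thesis using that[of B'] by (simp add: mollifier_family_def)
qed

section \<open>Mollification\<close>

text \<open>By the mean value theorem the difference quotients of \<open>K\<close> are bounded by
  \<open>C'\<close>, so \<open>C' * \<bar>f y\<bar>\<close> is a dominating function.\<close>

lemma has_derivative_integral:
  fixes K K' :: "real \<Rightarrow> 'a \<Rightarrow> real"
  assumes f: "integrable M f"
    and K: "\<And>t. K t \<in> borel_measurable M" "\<And>t y. \<bar>K t y\<bar> \<le> C"
    and K': "K' t0 \<in> borel_measurable M" "\<And>t y. \<bar>K' t y\<bar> \<le> C'"
    and der: "\<And>t y. ((\<lambda>t. K t y) has_real_derivative K' t y) (at t)"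
  shows "((\<lambda>t. \<integral>y. f y * K t y \<partial>M) has_real_derivative (\<integral>y. f y * K' t0 y \<partial>M)) (at t0)"
proof -
  note [measurable] = K(1) K'(1) borel_measurable_integrable[OF f]
  have int: "integrable M (\<lambda>y. f y * K t y)" for t
    by (rule Bochner_Integration.integrable_bound[where f = "\<lambda>y. C * f y"])
      (use f in \<open>auto simp: abs_mult mult.commute[of "\<bar>C\<bar>"] intro!: mult_left_mono order_trans[OF K(2) abs_ge_self]\<close>)
  have lip: "\<bar>K s y - K t0 y\<bar> \<le> C' * \<bar>s - t0\<bar>" for s y
  proof -
    have "norm (K s y - K t0 y) \<le> C' * norm (s - t0)"
      by (rule field_differentiable_bound[where S = UNIV and f' = "\<lambda>t. K' t y"])
        (use der K'(2) in auto)
    then show ?thesis by simp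
  qed
  show ?thesis
    unfolding has_field_derivative_iff tendsto_at_iff_sequentially comp_def
  proof (intro allI impI)
    fix X :: "nat \<Rightarrow> real"
    assume X: "\<forall>n. X n \<in> UNIV - {t0}" "X \<longlonglongrightarrow> t0"
    have "(\<lambda>n. \<integral>y. f y * ((K (X n) y - K t0 y) / (X n - t0)) \<partial>M) \<longlonglongrightarrow> (\<integral>y. f y * K' t0 y \<partial>M)"
    proof (rule integral_dominated_convergence[where w = "\<lambda>y. \<bar>f y\<bar> * C'"])
      have "(\<lambda>n. (K (X n) y - K t0 y) / (X n - t0)) \<longlonglongrightarrow> K' t0 y" for y
        using der[where t = t0 and y = y] X
        unfolding has_field_derivative_iff tendsto_at_iff_sequentially comp_def by blast
      then show "AE y in M. (\<lambda>n. f y * ((K (X n) y - K t0 y) / (X n - t0))) \<longlonglongrightarrow> f y * K' t0 y"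
        by (intro AE_I2 tendsto_intros)
      have "\<bar>(K (X n) y - K t0 y) / (X n - t0)\<bar> \<le> C'" for n y
        using lip[of "X n" y] X(1) by (auto simp: abs_divide divide_le_eq)
      then show "AE y in M. norm (f y * ((K (X n) y - K t0 y) / (X n - t0))) \<le> \<bar>f y\<bar> * C'" for n
        unfolding real_norm_def abs_mult by (intro AE_I2 mult_left_mono) auto
    qed (use f in auto)
    moreover have "(\<integral>y. f y * ((K (X n) y - K t0 y) / (X n - t0)) \<partial>M)
        = ((\<integral>y. f y * K (X n) y \<partial>M) - (\<integral>y. f y * K t0 y \<partial>M)) / (X n - t0)" for n
      using int by (simp add: diff_divide_distrib right_diff_distrib)
    ultimately show "(\<lambda>n. ((\<integral>y. f y * K (X n) y \<partial>M) - (\<integral>y. f y * K t0 y \<partial>M)) / (X n - t0))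
        \<longlonglongrightarrow> (\<integral>y. f y * K' t0 y \<partial>M)"
      by (simp only:)
  qed
qed

lemma has_partial_prod:
  assumes der: "\<And>j k t. ((F j k) has_real_derivative F j (Suc k) t) (at t)" and i: "i < d"
  shows "has_partial i (\<lambda>y. \<Prod>j<d. F j (ks j) (y j)) x (\<Prod>j<d. F j ((ks(i := Suc (ks i))) j) (x j))"
proof -
  have *: "(\<Prod>j<d. F j (ks j) (z j)) = F i (ks i) (z i) * (\<Prod>j\<in>{..<d} - {i}. F j (ks j) (z j))" for ks z
    using i by (subst prod.remove[of _ i]) auto
  show ?thesis
    unfolding has_partial_def * by (auto intro!: derivative_eq_intros der)
qed

lemma continuous_on_prod_coordinates:
  assumes "\<And>j. continuous_on UNIV (F j :: real \<Rightarrow> real)"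
  shows "continuous_on UNIV (\<lambda>y :: nat \<Rightarrow> real. \<Prod>j<d. F j (y j))"
  by (intro continuous_on_prod continuous_on_compose2[OF assms continuous_on_product_coordinates]) auto

text \<open>A class of continuous functions closed under partial derivatives consists of smooth
  functions. Kernels and mollifications form such classes, parametrized by a multi-index.\<close>

lemma C_on_family:
  assumes cont: "\<And>f. f \<in> P \<Longrightarrow> continuous_on UNIV f"
    and der: "\<And>f i. f \<in> P \<Longrightarrow> i < d \<Longrightarrow> \<exists>g\<in>P. \<forall>x. has_partial i f x (g x)"
    and "f \<in> P"
  shows "C_on d k U f"
  using \<open>f \<in> P\<close>
proof (induction k arbitrary: f)
  case 0
  then show ?case by (simp add: continuous_map_Rd_if_continuous_on cont)
next
  case (Suc k)
  have "(\<lambda>t. f (x(i := t))) differentiable (at (x i)) \<and> C_on d k U (partial i f)" if i: "i < d" for i x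
  proof -
    obtain g where g: "g \<in> P" "\<And>x. has_partial i f x (g x)" using der[OF Suc.prems i] by blast
    then have "partial i f = g" by (auto simp: has_partial_imp_partial)
    then show ?thesis
      using Suc.IH[OF g(1)] g(2)[of x] by (auto simp: has_partial_def real_differentiable_def)
  qed
  then show ?case using Suc.prems by (simp add: continuous_map_Rd_if_continuous_on cont)
qed

text \<open>Convolution of \<open>f\<close> with a tensor product of one-dimensional kernels;
  \<open>ks j\<close> counts the derivatives on factor \<open>j\<close>. Only the coordinates of
  \<open>x\<close> below \<open>d\<close> matter, so the result is defined on the whole function
  type.\<close>

definition mollify ::
    "nat \<Rightarrow> (nat \<Rightarrow> real \<Rightarrow> real) \<Rightarrow> ((nat \<Rightarrow> real) \<Rightarrow> real) \<Rightarrow> (nat \<Rightarrow> nat) \<Rightarrow> (nat \<Rightarrow> real) \<Rightarrow> real" where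
  "mollify d B f ks x = (\<integral>y. f y * (\<Prod>j<d. B (ks j) (x j - y j)) \<partial>lebm d)"

lemma kernel_bounded:
  assumes B: "mollifier_family r B"
  obtains C where "C \<ge> 0" "\<And>z. \<bar>\<Prod>j<d. B (ks j) (z j)\<bar> \<le> C"
proof -
  have "\<forall>k. \<exists>M. \<forall>t. \<bar>B k t\<bar> \<le> M" using mollifier_family_bounded[OF B] by metis
  then obtain M where M: "\<And>k t. \<bar>B k t\<bar> \<le> M k" by metis
  have "0 \<le> M k" for k using M[of k 0] by linarith
  then show ?thesis
    using M by (intro that[of "\<Prod>j<d. M (ks j)"]) (auto simp: abs_prod intro!: prod_mono prod_nonneg)
qed

lemma continuous_kernel:
  assumes B: "mollifier_family r B"
  shows "continuous_on UNIV (\<lambda>y. \<Prod>j<d. B (ks j) (x j - y j))"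
    "continuous_on UNIV (\<lambda>x. \<Prod>j<d. B (ks j) (x j - y j))"
  by (intro continuous_on_prod_coordinates continuous_on_compose2[OF mollifier_familyD(5)[OF B, of UNIV]]
      continuous_intros; simp)+

lemma kernel_measurable:
  assumes B: "mollifier_family r B"
  shows "(\<lambda>y. \<Prod>j<d. B (ks j) (x j - y j)) \<in> borel_measurable (lebm d)"
    "(\<lambda>x. \<Prod>j<d. B (ks j) (x j - y j)) \<in> borel_measurable (lebm d)"
  by (rule borel_measurable_lebm_continuous, rule continuous_kernel[OF B])+

lemma integrable_kernel:
  assumes B: "mollifier_family r B" and f: "integrable (lebm d) f"
  shows "integrable (lebm d) (\<lambda>y. f y * (\<Prod>j<d. B (ks j) (x j - y j)))"
proof -
  obtain C where C: "C \<ge> 0" "\<And>z. \<bar>\<Prod>j<d. B (ks j) (z j)\<bar> \<le> C" using kernel_bounded[OF B, where d = d and ks = ks] by blast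
  note [measurable] = kernel_measurable(1)[OF B] borel_measurable_integrable[OF f]
  show ?thesis
    by (rule Bochner_Integration.integrable_bound[where f = "\<lambda>y. C * f y"])
      (use f C(1) C(2)[of "\<lambda>j. x j - y j" for y] in \<open>auto simp: abs_mult mult.commute[of C] intro!: mult_left_mono\<close>)
qed

lemma has_partial_mollify:
  assumes B: "mollifier_family r B" and f: "integrable (lebm d) f" and i: "i < d"
  shows "has_partial i (mollify d B f ks) x (mollify d B f (ks(i := Suc (ks i))) x)"
proof -
  obtain C where C: "C \<ge> 0" "\<And>z. \<bar>\<Prod>j<d. B (ks j) (z j)\<bar> \<le> C" using kernel_bounded[OF B, where d = d and ks = ks] by blast
  obtain C' where C': "C' \<ge> 0" "\<And>z. \<bar>\<Prod>j<d. B ((ks(i := Suc (ks i))) j) (z j)\<bar> \<le> C'"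
    using kernel_bounded[OF B, where d = d and ks = "ks(i := Suc (ks i))"] by blast
  have "((\<lambda>t. \<integral>y. f y * (\<Prod>j<d. B (ks j) ((x(i := t)) j - y j)) \<partial>lebm d) has_real_derivative
     (\<integral>y. f y * (\<Prod>j<d. B ((ks(i := Suc (ks i))) j) ((x(i := x i)) j - y j)) \<partial>lebm d)) (at (x i))"
  proof (rule has_derivative_integral[where C = C and C' = C', OF f])
    fix t y
    have "has_partial i (\<lambda>x. \<Prod>j<d. (\<lambda>j k s. B k (s - y j)) j (ks j) (x j)) (x(i := t))
        (\<Prod>j<d. (\<lambda>j k s. B k (s - y j)) j ((ks(i := Suc (ks i))) j) ((x(i := t)) j))"
    proof (rule has_partial_prod[OF _ i])
      show "((\<lambda>s. B k (s - y j)) has_real_derivative B (Suc k) (s - y j)) (at s)" for k j s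
      proof -
        have "((\<lambda>s. s - y j) has_real_derivative 1) (at s)" by (auto intro!: derivative_eq_intros)
        from DERIV_chain2[OF mollifier_familyD(1)[OF B] this] show ?thesis by simp
      qed
    qed
    then show "((\<lambda>t. \<Prod>j<d. B (ks j) ((x(i := t)) j - y j)) has_real_derivative
        (\<Prod>j<d. B ((ks(i := Suc (ks i))) j) ((x(i := t)) j - y j))) (at t)"
      by (simp add: has_partial_def)
  qed (use C(2)[of "\<lambda>j. z j - y j" for z y] C'(2)[of "\<lambda>j. z j - y j" for z y]
      kernel_measurable(1)[OF B] in auto)
  then show ?thesis by (simp add: has_partial_def mollify_def)
qed

lemma continuous_mollify:
  assumes B: "mollifier_family r B" and f: "integrable (lebm d) f"
  shows "continuous_on UNIV (mollify d B f ks)"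
proof -
  obtain C where C: "C \<ge> 0" "\<And>z. \<bar>\<Prod>j<d. B (ks j) (z j)\<bar> \<le> C" using kernel_bounded[OF B, where d = d and ks = ks] by blast
  note [measurable] = kernel_measurable(1)[OF B] borel_measurable_integrable[OF f]
  show ?thesis
  proof (rule continuous_on_sequentiallyI)
    fix X and x :: "nat \<Rightarrow> real" assume X: "X \<longlonglongrightarrow> x"
    show "(\<lambda>n. mollify d B f ks (X n)) \<longlonglongrightarrow> mollify d B f ks x"
      unfolding mollify_def
    proof (rule integral_dominated_convergence[where w = "\<lambda>y. \<bar>f y\<bar> * C"])
      have "(\<lambda>n. \<Prod>j<d. B (ks j) (X n j - y j)) \<longlonglongrightarrow> (\<Prod>j<d. B (ks j) (x j - y j))" for y
        using continuous_on_tendsto_compose[OF continuous_kernel(2)[OF B] X] by simp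
      then show "AE y in lebm d. (\<lambda>n. f y * (\<Prod>j<d. B (ks j) (X n j - y j))) \<longlonglongrightarrow>
          f y * (\<Prod>j<d. B (ks j) (x j - y j))"
        by (intro AE_I2 tendsto_mult tendsto_const)
      show "AE y in lebm d. norm (f y * (\<Prod>j<d. B (ks j) (X n j - y j))) \<le> \<bar>f y\<bar> * C" for n
        using C(2)[of "\<lambda>j. X n j - y j" for y]
        by (intro AE_I2) (auto simp: abs_mult intro!: mult_left_mono)
    qed (use f in auto)
  qed
qed

lemma kernel_nonneg: "mollifier_family r B \<Longrightarrow> 0 \<le> (\<Prod>j<d. B 0 (z j))"
  by (intro prod_nonneg) (auto dest: mollifier_familyD)

text \<open>Unit mass in \<open>y\<close> makes mollification an average; unit mass in
  \<open>x\<close> is what Tonelli's theorem uses for the contraction in \<open>L1\<close>.\<close>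

lemma integral_kernel:
  assumes B: "mollifier_family r B"
  shows "(\<integral>y. (\<Prod>j<d. B 0 (x j - y j)) \<partial>lebm d) = 1" "(\<integral>x. (\<Prod>j<d. B 0 (x j - y j)) \<partial>lebm d) = 1"
    "integrable (lebm d) (\<lambda>y. \<Prod>j<d. B 0 (x j - y j))" "integrable (lebm d) (\<lambda>x. \<Prod>j<d. B 0 (x j - y j))"
proof -
  interpret product_sigma_finite "\<lambda>_. lborel :: real measure" by (rule product_sigma_finite_lborel)
  have i: "integrable lborel (B 0)" by (rule mollifier_family_integrable[OF B])
  have i1: "integrable lborel (\<lambda>t. B 0 (a - t))" for a
    using lborel_integrable_real_affine[OF i, of "-1" a] by simp
  have i2: "integrable lborel (\<lambda>t. B 0 (t - a))" for a
    using lborel_integrable_real_affine[OF i, of "1" "-a"] by simp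
  have e1: "integral\<^sup>L lborel (\<lambda>t. B 0 (a - t)) = 1" for a
    using lborel_integral_real_affine[of "-1" "B 0" a] mollifier_familyD(4)[OF B] by simp
  have e2: "integral\<^sup>L lborel (\<lambda>t. B 0 (t - a)) = 1" for a
    using lborel_integral_real_affine[of "1" "B 0" "-a"] mollifier_familyD(4)[OF B] by simp
  show "(\<integral>y. (\<Prod>j<d. B 0 (x j - y j)) \<partial>lebm d) = 1"
    by (subst product_integral_prod[of _ "\<lambda>j t. B 0 (x j - t)"]) (auto simp: i1 e1)
  show "(\<integral>x. (\<Prod>j<d. B 0 (x j - y j)) \<partial>lebm d) = 1"
    by (subst product_integral_prod[of _ "\<lambda>j t. B 0 (t - y j)"]) (auto simp: i2 e2)
  show "integrable (lebm d) (\<lambda>y. \<Prod>j<d. B 0 (x j - y j))"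
    by (rule product_integrable_prod[of _ "\<lambda>j t. B 0 (x j - t)"]) (auto simp: i1)
  show "integrable (lebm d) (\<lambda>x. \<Prod>j<d. B 0 (x j - y j))"
    by (rule product_integrable_prod[of _ "\<lambda>j t. B 0 (t - y j)"]) (auto simp: i2)
qed

lemma kernel_eq_0:
  fixes d :: nat
  assumes "mollifier_family r B" "j < d" "r \<le> \<bar>x j - y j\<bar>"
  shows "(\<Prod>j<d. B (ks j) (x j - y j)) = 0"
  using assms by (intro prod_zero) (auto dest: mollifier_familyD intro!: bexI[of _ j])

lemma mollify_eq_0:
  assumes B: "mollifier_family r B"
    and "\<And>y. y \<in> topspace (Rd d) \<Longrightarrow> (\<forall>j<d. \<bar>x j - y j\<bar> < r) \<Longrightarrow> f y = 0"
  shows "mollify d B f ks x = 0"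
proof -
  have "f y * (\<Prod>j<d. B (ks j) (x j - y j)) = 0" if "y \<in> space (lebm d)" for y
    using that assms(2)[of y] kernel_eq_0[OF B, of _ d x y ks] by (force simp: space_lebm not_less)
  then have "mollify d B f ks x = (\<integral>y. 0 \<partial>lebm d)"
    unfolding mollify_def by (intro Bochner_Integration.integral_cong) auto
  then show ?thesis by simp
qed

text \<open>The kernel is a probability density on the box of radius \<open>r\<close> about
  \<open>x\<close>, so averaging cannot leave an interval that contains the values of
  \<open>f\<close> there. With \<open>a = 0\<close> this bounds mollifications, with
  \<open>a = f x\<close> it gives pointwise convergence.\<close>

lemma mollify_close:
  assumes B: "mollifier_family r B" and f: "integrable (lebm d) f"
    and close: "\<And>y. y \<in> topspace (Rd d) \<Longrightarrow> (\<forall>j<d. \<bar>x j - y j\<bar> < r) \<Longrightarrow> \<bar>f y - a\<bar> \<le> e"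
  shows "\<bar>mollify d B f (\<lambda>_. 0) x - a\<bar> \<le> e"
proof -
  define k where "k y = (\<Prod>j<d. B 0 (x j - y j))" for y
  have k: "integrable (lebm d) k" "integral\<^sup>L (lebm d) k = 1" "0 \<le> k y" for y
    unfolding k_def using integral_kernel[OF B] kernel_nonneg[OF B] by auto
  have fk: "integrable (lebm d) (\<lambda>y. f y * k y)"
    unfolding k_def using integrable_kernel[OF B f, of "\<lambda>_. 0" x] by simp
  have i: "integrable (lebm d) (\<lambda>y. (f y - a) * k y)"
    using fk k(1) by (simp add: left_diff_distrib)
  have "mollify d B f (\<lambda>_. 0) x - a = (\<integral>y. (f y - a) * k y \<partial>lebm d)"
    using fk k(1,2) by (simp add: mollify_def k_def[symmetric] left_diff_distrib)
  also have "\<bar>\<dots>\<bar> \<le> (\<integral>y. e * k y \<partial>lebm d)"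
  proof (rule integral_abs_bound[THEN order_trans], rule integral_mono)
    fix y assume "y \<in> space (lebm d)"
    then have y: "y \<in> topspace (Rd d)" by (simp add: space_lebm)
    show "\<bar>(f y - a) * k y\<bar> \<le> e * k y"
    proof (cases "\<forall>j<d. \<bar>x j - y j\<bar> < r")
      case True
      then show ?thesis
        using mult_right_mono[OF close[OF y True] k(3)[of y]] k(3)[of y] by (simp add: abs_mult)
    next
      case False
      then have "k y = 0" using kernel_eq_0[OF B, of _ d x y "\<lambda>_. 0"] by (auto simp: k_def not_less)
      then show ?thesis by simp
    qed
  qed (use i k(1) in auto)
  finally show ?thesis using k(2) by simp
qed

lemma mollify_bounded:
  assumes B: "mollifier_family r B" and f: "integrable (lebm d) f"
    and "\<And>y. y \<in> topspace (Rd d) \<Longrightarrow> \<bar>f y\<bar> \<le> C"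
  shows "\<bar>mollify d B f (\<lambda>_. 0) x\<bar> \<le> C"
  using mollify_close[OF B f, of x 0 C] assms(3) by simp

text \<open>A derivative on the kernel moves to \<open>f\<close> by parts. The kernel depends on
  \<open>x - y\<close>, so its derivative in \<open>y\<close> has the opposite sign, which cancels
  the sign from integrating by parts.\<close>

lemma mollify_partial:
  assumes B: "mollifier_family r B" and i: "i < d"
    and f: "continuous_on UNIV f" "continuous_on UNIV f'"
    and der: "\<And>x. x \<in> topspace (Rd d) \<Longrightarrow> has_partial i f x (f' x)"
    and K: "compact K" "K \<subseteq> topspace (Rd d)"
    and supp: "\<And>x. x \<in> topspace (Rd d) \<Longrightarrow> x \<notin> K \<Longrightarrow> f x = 0"
    and supp': "\<And>x. x \<in> topspace (Rd d) \<Longrightarrow> x \<notin> K \<Longrightarrow> f' x = 0"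
  shows "mollify d B f (ks(i := Suc (ks i))) x = mollify d B f' ks x"
proof -
  define k where "k ks y = (\<Prod>j<d. B (ks j) (x j - y j))" for ks y
  have kc: "continuous_on UNIV (k ks)" for ks
    unfolding k_def by (rule continuous_kernel(1)[OF B])
  have dk: "has_partial i (k ks) y (- k (ks(i := Suc (ks i))) y)" for y
  proof -
    have *: "k ks y = (\<Prod>j<d. B (ks j) (- (y j - x j)))" for ks y by (simp add: k_def)
    have d: "((\<lambda>s. (-1) ^ k * B k (x j - s)) has_real_derivative (-1) ^ Suc k * B (Suc k) (x j - s)) (at s)" for k j s
    proof -
      have "((\<lambda>s. B k (x j - s)) has_real_derivative B (Suc k) (x j - s) * (-1)) (at s)"
        by (rule DERIV_chain2[OF mollifier_familyD(1)[OF B]]) (auto intro!: derivative_eq_intros)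
      from DERIV_cmult[OF this, of "(-1) ^ k"] show ?thesis by simp
    qed
    \<comment> \<open>Each derivative in \<open>y\<close> produces a factor \<open>-1\<close>,
      absorbed above into the one-dimensional families so that \<open>has_partial_prod\<close>
      applies. Multiplying once more by the total sign \<open>c\<close> removes it, as
      \<open>c * c = 1\<close>.\<close>
    define c where "c = (\<Prod>j<d. (-1::real) ^ ks j)"
    have c: "c * c = 1" by (simp add: c_def flip: prod.distrib power_add mult_2)
    have "(\<Prod>j<d. (-1::real) ^ ((ks(i := Suc (ks i))) j)) = - c"
      using i unfolding c_def by (subst (1 2) prod.remove[of _ i]) auto
    then have "has_partial i (\<lambda>y. c * k ks y) y (- c * k (ks(i := Suc (ks i))) y)"
      using has_partial_prod[where F = "\<lambda>j k s. (-1) ^ k * B k (x j - s)", OF d i, of ks y]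
      unfolding k_def prod.distrib c_def[symmetric] by simp
    then have "has_partial i (\<lambda>y. c * (c * k ks y)) y (c * (- c * k (ks(i := Suc (ks i))) y))"
      unfolding has_partial_def by (rule DERIV_cmult)
    then show ?thesis using c by (simp add: mult.assoc[symmetric])
  qed
  have "integral\<^sup>L (lebm d) (\<lambda>y. f' y * k ks y + f y * - k (ks(i := Suc (ks i))) y) = 0"
  proof (rule integral_partial_eq_0[THEN conjunct2, OF i _ _ K])
    show "continuous_on UNIV (\<lambda>y. f' y * k ks y + f y * - k (ks(i := Suc (ks i))) y)"
      by (intro continuous_intros f kc)
    show "has_partial i (\<lambda>y. f y * k ks y) y (f' y * k ks y + f y * - k (ks(i := Suc (ks i))) y)"
      if "y \<in> topspace (Rd d)" for y
      using der[OF that] dk[of y] unfolding has_partial_def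
      by (auto intro!: derivative_eq_intros)
  qed (use supp in auto)
  moreover have "integrable (lebm d) (\<lambda>y. f' y * k ks y)" "integrable (lebm d) (\<lambda>y. f y * k ks y)" for ks
    by (rule integrable_continuous_compact_support[OF _ K];
        use supp supp' in \<open>auto intro!: continuous_intros f kc\<close>)+
  ultimately show ?thesis
    unfolding mollify_def k_def[symmetric] by (simp del: fun_upd_apply)
qed

lemma compactly_supported_inI:
  assumes "compact K" "K \<subseteq> \<Omega>" "K \<subseteq> topspace (Rd d)" "\<Omega> \<subseteq> topspace (Rd d)"
    and "\<And>x. x \<in> \<Omega> \<Longrightarrow> x \<notin> K \<Longrightarrow> f x = 0"
  shows "compactly_supported_in d \<Omega> f"
proof -
  have c: "compactin (Rd d) K" using assms by (simp add: compactin_Rd_iff)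
  have "Hausdorff_space (Rd d)" by (simp add: Hausdorff_space_product_topology)
  then have "closedin (Rd d) K" using c by (simp add: compactin_imp_closedin)
  moreover have "{x \<in> \<Omega>. f x \<noteq> 0} \<subseteq> K" using assms(5) by auto
  ultimately have "Rd d closure_of {x \<in> \<Omega>. f x \<noteq> 0} \<subseteq> K" by (simp add: closure_of_minimal)
  then show ?thesis
    unfolding compactly_supported_in_def
    using c assms(2) closed_compactin[OF c] closedin_closure_of by blast
qed

lemma mollify_test_function:
  assumes B: "mollifier_family r B" and f: "integrable (lebm d) f"
    and K: "compact K" "K \<subseteq> \<Omega>" "\<Omega> \<subseteq> topspace (Rd d)"
    and supp: "\<And>x. x \<in> topspace (Rd d) \<Longrightarrow> x \<notin> K \<Longrightarrow> mollify d B f ks x = 0"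
  shows "mollify d B f ks \<in> test_functions d \<Omega>"
proof -
  have "C_on d k \<Omega> (mollify d B f ks)" for k
    by (rule C_on_family[where P = "range (mollify d B f)"])
       (use continuous_mollify[OF B f] has_partial_mollify[OF B f] in \<open>blast+\<close>)
  moreover have "compactly_supported_in d \<Omega> (mollify d B f ks)"
    using K supp by (intro compactly_supported_inI[of K]) auto
  ultimately show ?thesis by (simp add: test_functions_def)
qed

text \<open>A basic open set of the product constrains every coordinate, but points of
  \<open>Rd d\<close> agree from index \<open>d\<close> on. Only \<open>d\<close> radii remain, and
  their minimum is positive; the inserted \<open>1\<close> covers \<open>d = 0\<close>.\<close>

lemma box_in_open:
  assumes "open U" "x \<in> U" "x \<in> topspace (Rd d)"
  obtains r where "r > 0"
    "\<And>y. y \<in> topspace (Rd d) \<Longrightarrow> (\<forall>j<d. \<bar>x j - y j\<bar> < r) \<Longrightarrow> y \<in> U"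
proof -
  have "openin (product_topology (\<lambda>_::nat. euclidean) UNIV) U"
    using assms(1) by (simp add: euclidean_product_topology)
  from product_topology_open_contains_basis[OF this assms(2)]
  obtain X where X: "x \<in> (\<Pi>\<^sub>E i\<in>UNIV. X i)" "\<And>i. open (X i)" "(\<Pi>\<^sub>E i\<in>UNIV. X i) \<subseteq> U" by auto
  have "\<exists>r>0. ball (x j) r \<subseteq> X j" for j
    using X(1) X(2)[of j] unfolding open_contains_ball by auto
  then obtain \<rho> where \<rho>: "\<And>j. \<rho> j > 0" "\<And>j. ball (x j) (\<rho> j) \<subseteq> X j" by metis
  define r where "r = Min (insert 1 (\<rho> ` {..<d}))"
  have r: "r > 0" "\<And>j. j < d \<Longrightarrow> r \<le> \<rho> j" using \<rho>(1) by (auto simp: r_def)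
  show ?thesis
  proof (rule that[OF r(1)])
    fix y assume y: "y \<in> topspace (Rd d)" "\<forall>j<d. \<bar>x j - y j\<bar> < r"
    have "y j \<in> X j" for j
    proof (cases "j < d")
      case True
      then have "y j \<in> ball (x j) (\<rho> j)" using y(2) r(2)[OF True] by (auto simp: dist_real_def)
      then show ?thesis using \<rho>(2) by blast
    next
      case False
      then have "y j = x j" using y(1) assms(3) by (auto simp: PiE_iff extensional_def)
      then show ?thesis using X(1) by auto
    qed
    then show "y \<in> U" using X(3) by auto
  qed
qed

section \<open>Convergence of mollifications in \<open>L1\<close>\<close>

lemma sigma_finite_lebm: "sigma_finite_measure (lebm d)"
  using product_sigma_finite.sigma_finite[OF product_sigma_finite_lborel] by blast

lemma mollify_diff:
  assumes "mollifier_family r B" "integrable (lebm d) f" "integrable (lebm d) g"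
  shows "mollify d B (\<lambda>x. f x - g x) ks x = mollify d B f ks x - mollify d B g ks x"
  unfolding mollify_def left_diff_distrib
  by (intro Bochner_Integration.integral_diff integrable_kernel[OF assms(1)] assms)

text \<open>Tonelli's theorem lets the kernel be integrated first in \<open>x\<close>, where its
  mass is \<open>1\<close>.\<close>

lemma mollify_L1_contraction:
  assumes B: "mollifier_family r B" and f: "integrable (lebm d) f"
  shows "integrable (lebm d) (mollify d B f (\<lambda>_. 0))"
    "(\<integral>x. \<bar>mollify d B f (\<lambda>_. 0) x\<bar> \<partial>lebm d) \<le> (\<integral>x. \<bar>f x\<bar> \<partial>lebm d)"
proof -
  interpret M: sigma_finite_measure "lebm d" by (rule sigma_finite_lebm)
  interpret P: pair_sigma_finite "lebm d" "lebm d" ..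
  have [measurable]: "f \<in> borel_measurable (lebm d)" "B 0 \<in> borel_measurable borel"
    using f mollifier_familyD[OF B] by auto
  have mm: "mollify d B f (\<lambda>_. 0) \<in> borel_measurable (lebm d)"
    by (intro borel_measurable_lebm_continuous continuous_mollify[OF B f])
  have km: "(\<lambda>(x, y). ennreal (\<bar>f y\<bar> * (\<Prod>j<d. B 0 (x j - y j)))) \<in> borel_measurable (lebm d \<Otimes>\<^sub>M lebm d)"
  proof -
    have [measurable]: "(\<lambda>p. fst p j - snd p j) \<in> borel_measurable (lebm d \<Otimes>\<^sub>M lebm d)" if "j < d" for j
    proof -
      have c: "(\<lambda>x. x j) \<in> borel_measurable (lebm d)"
        using measurable_component_singleton[of j "{..<d}" "\<lambda>_. lborel"] that by simp
      show ?thesis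
        by (intro borel_measurable_diff measurable_compose[OF measurable_fst c] measurable_compose[OF measurable_snd c])
    qed
    show ?thesis
      unfolding split_beta
      by (intro measurable_compose[OF _ measurable_ennreal] borel_measurable_times borel_measurable_prod
          borel_measurable_abs measurable_compose[OF measurable_snd]) measurable
  qed
  have "(\<integral>\<^sup>+x. ennreal \<bar>mollify d B f (\<lambda>_. 0) x\<bar> \<partial>lebm d)
      \<le> (\<integral>\<^sup>+x. (\<integral>\<^sup>+y. ennreal (\<bar>f y\<bar> * (\<Prod>j<d. B 0 (x j - y j))) \<partial>lebm d) \<partial>lebm d)"
  proof (rule nn_integral_mono)
    fix x
    have "ennreal \<bar>mollify d B f (\<lambda>_. 0) x\<bar> \<le> (\<integral>\<^sup>+y. norm (f y * (\<Prod>j<d. B 0 (x j - y j))) \<partial>lebm d)"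
      unfolding mollify_def
      using integral_norm_bound_ennreal[OF integrable_kernel[OF B f, of "\<lambda>_. 0" x]] by simp
    then show "ennreal \<bar>mollify d B f (\<lambda>_. 0) x\<bar> \<le> (\<integral>\<^sup>+y. ennreal (\<bar>f y\<bar> * (\<Prod>j<d. B 0 (x j - y j))) \<partial>lebm d)"
      by (simp add: abs_mult abs_of_nonneg[OF kernel_nonneg[OF B]])
  qed
  also have "\<dots> = (\<integral>\<^sup>+y. (\<integral>\<^sup>+x. ennreal (\<bar>f y\<bar> * (\<Prod>j<d. B 0 (x j - y j))) \<partial>lebm d) \<partial>lebm d)"
    by (rule P.Fubini'[OF km, symmetric])
  also have "\<dots> = (\<integral>\<^sup>+y. ennreal \<bar>f y\<bar> \<partial>lebm d)"
  proof (rule nn_integral_cong)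
    fix y
    have "(\<integral>\<^sup>+x. ennreal (\<bar>f y\<bar> * (\<Prod>j<d. B 0 (x j - y j))) \<partial>lebm d)
        = ennreal (\<integral>x. \<bar>f y\<bar> * (\<Prod>j<d. B 0 (x j - y j)) \<partial>lebm d)"
      by (intro nn_integral_eq_integral integrable_mult_right integral_kernel(4)[OF B] AE_I2 mult_nonneg_nonneg
          abs_ge_zero kernel_nonneg[OF B])
    then show "(\<integral>\<^sup>+x. ennreal (\<bar>f y\<bar> * (\<Prod>j<d. B 0 (x j - y j))) \<partial>lebm d) = ennreal \<bar>f y\<bar>"
      by (simp add: integral_kernel(2)[OF B])
  qed
  also have "\<dots> = ennreal (\<integral>x. \<bar>f x\<bar> \<partial>lebm d)"
    using f by (intro nn_integral_eq_integral) auto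
  finally have le: "(\<integral>\<^sup>+x. ennreal \<bar>mollify d B f (\<lambda>_. 0) x\<bar> \<partial>lebm d) \<le> ennreal (\<integral>x. \<bar>f x\<bar> \<partial>lebm d)" .
  show int: "integrable (lebm d) (mollify d B f (\<lambda>_. 0))"
    using le mm by (auto intro!: integrableI_bounded intro: le_less_trans)
  have "(\<integral>\<^sup>+x. ennreal \<bar>mollify d B f (\<lambda>_. 0) x\<bar> \<partial>lebm d) = ennreal (\<integral>x. \<bar>mollify d B f (\<lambda>_. 0) x\<bar> \<partial>lebm d)"
    using int by (intro nn_integral_eq_integral) auto
  then show "(\<integral>x. \<bar>mollify d B f (\<lambda>_. 0) x\<bar> \<partial>lebm d) \<le> (\<integral>x. \<bar>f x\<bar> \<partial>lebm d)"
    using le by (simp add: ennreal_le_iff)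
qed

lemma mollify_tendsto:
  assumes B: "\<And>n. mollifier_family (r n) (B n)" and r: "r \<longlonglongrightarrow> 0"
    and f: "integrable (lebm d) f" "continuous_on UNIV f" and x: "x \<in> topspace (Rd d)"
  shows "(\<lambda>n. mollify d (B n) f (\<lambda>_. 0) x) \<longlonglongrightarrow> f x"
  unfolding LIMSEQ_iff
proof (intro allI impI)
  fix e :: real assume e: "0 < e"
  have "open {y. \<bar>f y - f x\<bar> < e / 2}"
    by (intro open_Collect_less continuous_intros f)
  moreover have "x \<in> {y. \<bar>f y - f x\<bar> < e / 2}" using e by simp
  ultimately obtain s where s: "s > 0"
    "\<And>y. y \<in> topspace (Rd d) \<Longrightarrow> (\<forall>j<d. \<bar>x j - y j\<bar> < s) \<Longrightarrow> y \<in> {y. \<bar>f y - f x\<bar> < e / 2}"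
    using box_in_open[OF _ _ x] by blast
  from order_tendstoD(2)[OF r s(1)] obtain N where N: "\<And>n. n \<ge> N \<Longrightarrow> r n < s"
    by (auto simp: eventually_sequentially)
  have "\<bar>mollify d (B n) f (\<lambda>_. 0) x - f x\<bar> \<le> e / 2" if "n \<ge> N" for n
  proof (rule mollify_close[OF B f(1)])
    fix y assume y: "y \<in> topspace (Rd d)" "\<forall>j<d. \<bar>x j - y j\<bar> < r n"
    then have "\<forall>j<d. \<bar>x j - y j\<bar> < s" using N[OF that] by force
    then show "\<bar>f y - f x\<bar> \<le> e / 2" using s(2)[OF y(1)] by simp
  qed
  then show "\<exists>N. \<forall>n\<ge>N. norm (mollify d (B n) f (\<lambda>_. 0) x - f x) < e"
    using e by (force intro!: exI[of _ N])
qed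

lemma mollify_support:
  assumes B: "mollifier_family r B" and "r \<le> 1"
    and supp: "\<And>y. y \<in> topspace (Rd d) \<Longrightarrow> y \<notin> cube d R \<Longrightarrow> f y = 0"
    and x: "x \<in> topspace (Rd d)" "x \<notin> cube d (R + 1)"
  shows "mollify d B f ks x = 0"
proof (rule mollify_eq_0[OF B])
  fix y assume y: "y \<in> topspace (Rd d)" "\<forall>j<d. \<bar>x j - y j\<bar> < r"
  obtain j where j: "j < d" "\<bar>x j\<bar> > R + 1" using x by (auto simp: cube_eq not_le)
  have "\<bar>x j - y j\<bar> < r" using y(2) j by blast
  then have "\<bar>y j\<bar> > R" using j(2) assms(2) by linarith
  then show "f y = 0" using supp[OF y(1)] j(1) by (force simp: cube_eq)
qed

lemma mollify_L1_tendsto_continuous: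
  assumes B: "\<And>n. mollifier_family (r n) (B n)" and r: "r \<longlonglongrightarrow> 0" "\<And>n. r n \<le> 1"
    and f: "continuous_on UNIV f" and K: "compact K" "K \<subseteq> topspace (Rd d)"
    and supp: "\<And>x. x \<in> topspace (Rd d) \<Longrightarrow> x \<notin> K \<Longrightarrow> f x = 0"
  shows "(\<lambda>n. \<integral>x. \<bar>mollify d (B n) f (\<lambda>_. 0) x - f x\<bar> \<partial>lebm d) \<longlonglongrightarrow> 0"
proof -
  have fi: "integrable (lebm d) f" by (rule integrable_continuous_compact_support[OF f K supp])
  obtain C where C: "C > 0" "\<And>x. x \<in> K \<Longrightarrow> \<bar>f x\<bar> \<le> C" using compact_bounded_fun[OF f K(1)] by blast
  have fC: "\<bar>f x\<bar> \<le> C" if "x \<in> topspace (Rd d)" for x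
    using C supp[OF that] by (cases "x \<in> K") auto
  obtain R where R: "R > 0" "K \<subseteq> cube d R" using compact_in_cube[OF K] by blast
  have "(\<lambda>n. \<integral>x. \<bar>mollify d (B n) f (\<lambda>_. 0) x - f x\<bar> \<partial>lebm d) \<longlonglongrightarrow> (\<integral>x. 0 \<partial>lebm d)"
  proof (rule integral_dominated_convergence[where w = "\<lambda>x. 2 * C * indicator (cube d (R + 1)) x"])
    show "integrable (lebm d) (\<lambda>x. 2 * C * indicator (cube d (R + 1)) x)"
      using cube_sets emeasure_cube by (intro integrable_mult_right) (auto simp: integrable_indicator_iff)
    show "AE x in lebm d. (\<lambda>n. \<bar>mollify d (B n) f (\<lambda>_. 0) x - f x\<bar>) \<longlonglongrightarrow> 0"
      by (intro AE_I2 tendsto_rabs_zero LIM_zero mollify_tendsto[OF B r(1) fi f]) (simp add: space_lebm)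
    show "AE x in lebm d. norm \<bar>mollify d (B n) f (\<lambda>_. 0) x - f x\<bar> \<le> 2 * C * indicator (cube d (R + 1)) x" for n
    proof (rule AE_I2)
      fix x assume "x \<in> space (lebm d)"
      then have x: "x \<in> topspace (Rd d)" by (simp add: space_lebm)
      show "norm \<bar>mollify d (B n) f (\<lambda>_. 0) x - f x\<bar> \<le> 2 * C * indicator (cube d (R + 1)) x"
      proof (cases "x \<in> cube d (R + 1)")
        case True
        then show ?thesis using mollify_bounded[OF B fi fC, of n x] fC[OF x] by simp
      next
        case False
        have "x \<notin> cube d R" using False by (force simp: cube_eq)
        then have "f x = 0" using supp[OF x] R(2) by blast
        moreover have "mollify d (B n) f (\<lambda>_. 0) x = 0"
          using supp R(2) by (intro mollify_support[OF B r(2) _ x False]) blast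
        ultimately show ?thesis using C by simp
      qed
    qed
    have [measurable]: "mollify d (B n) f (\<lambda>_. 0) \<in> borel_measurable (lebm d)" for n
      by (intro borel_measurable_lebm_continuous continuous_mollify[OF B fi])
    have [measurable]: "f \<in> borel_measurable (lebm d)" using fi by auto
    show "(\<lambda>x. \<bar>mollify d (B n) f (\<lambda>_. 0) x - f x\<bar>) \<in> borel_measurable (lebm d)" for n by measurable
  qed simp
  then show ?thesis by simp
qed

text \<open>\<open>Rd d\<close> sits in the function type as the closed set where all coordinates
  from \<open>d\<close> on are \<open>undefined\<close>, and \<open>restrict\<close> is a measurable
  retraction onto it. This opens the way to regularity of Borel measures on the function
  type.\<close>

lemma sets_lebm_imp_borel:
  assumes "A \<in> sets (lebm d)" shows "A \<in> sets borel"
proof -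
  have m: "(\<lambda>x. restrict x {..<d}) \<in> borel \<rightarrow>\<^sub>M lebm d"
  proof (rule measurable_PiM_single')
    show "(\<lambda>x. restrict x {..<d} i) \<in> borel \<rightarrow>\<^sub>M lborel" if "i \<in> {..<d}" for i
      using that by (auto intro!: borel_measurable_continuous_onI continuous_on_product_coordinates)
  qed (auto split: if_splits)
  have "(\<lambda>x. restrict x {..<d}) -` A \<inter> space borel \<in> sets borel" by (rule measurable_sets[OF m assms])
  moreover have "topspace (Rd d) \<in> sets borel"
  proof -
    have "topspace (Rd d) = (\<Inter>i\<in>{d..}. (\<lambda>x. x i) -` {undefined})"
      by (auto simp: PiE_iff extensional_def)
    also have "closed \<dots>"
      by (intro closed_INT ballI closed_vimage continuous_on_product_coordinates) auto
    finally show ?thesis by auto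
  qed
  moreover have "A = ((\<lambda>x. restrict x {..<d}) -` A \<inter> space borel) \<inter> topspace (Rd d)"
    using sets.sets_into_space[OF assms] by (auto simp: space_PiM PiE_iff extensional_restrict)
  ultimately show ?thesis by (metis sets.Int)
qed

text \<open>\<open>inner_regular\<close> concerns finite Borel measures, whereas
  \<open>lebm d\<close> need not be finite and lives on another sigma-algebra. Restricting to
  \<open>A\<close> and pushing forward to the Borel sets repairs both.\<close>

lemma lebm_inner_regular:
  assumes A: "A \<in> sets (lebm d)" "emeasure (lebm d) A < \<infinity>" and e: "0 < e"
  obtains K where "compact K" "K \<subseteq> A" "measure (lebm d) A - e < measure (lebm d) K"
proof -
  define \<nu> where "\<nu> = distr (restrict_space (lebm d) A) borel (\<lambda>x. x)"
  have A': "A \<inter> space (lebm d) = A" using sets.sets_into_space[OF A(1)] by auto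
  have id: "(\<lambda>x. x) \<in> restrict_space (lebm d) A \<rightarrow>\<^sub>M borel"
    by (rule measurable_restrict_space1[OF measurable_lebm_borel])
  have em: "emeasure \<nu> C = emeasure (lebm d) C" if "C \<in> sets borel" "C \<subseteq> A" for C
  proof -
    have "(\<lambda>x. x) -` C \<inter> space (restrict_space (lebm d) A) = C"
      using that A' by (auto simp: space_restrict_space)
    then show ?thesis
      unfolding \<nu>_def using that A A' by (simp add: emeasure_distr[OF id] emeasure_restrict_space)
  qed
  have Ab: "A \<in> sets borel" by (rule sets_lebm_imp_borel[OF A(1)])
  have "emeasure \<nu> (space \<nu>) = emeasure (restrict_space (lebm d) A) (space (restrict_space (lebm d) A))"
    unfolding \<nu>_def by (subst emeasure_distr[OF id]) auto
  also have "\<dots> = emeasure (lebm d) A"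
    using A A' by (simp add: emeasure_restrict_space space_restrict_space Int_commute)
  finally have fin: "emeasure \<nu> (space \<nu>) \<noteq> \<infinity>" using A by simp
  have eq: "emeasure \<nu> A = (SUP K\<in>{K. K \<subseteq> A \<and> compact K}. emeasure \<nu> K)"
    by (rule inner_regular[OF _ fin Ab]) (simp add: \<nu>_def)
  show ?thesis
  proof (cases "measure (lebm d) A - e < 0")
    case True then show ?thesis using that[of "{}"] by simp
  next
    case False
    have mA: "emeasure (lebm d) A = ennreal (measure (lebm d) A)"
      using A by (simp add: emeasure_eq_ennreal_measure less_top)
    have "ennreal (measure (lebm d) A - e) < emeasure \<nu> A"
      using False e by (simp add: em[OF Ab] mA ennreal_less_iff)
    then obtain K where K: "K \<subseteq> A" "compact K" "ennreal (measure (lebm d) A - e) < emeasure \<nu> K"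
      unfolding eq less_SUP_iff by auto
    have "emeasure \<nu> K = emeasure (lebm d) K"
      using K by (intro em) (auto intro!: borel_closed compact_imp_closed)
    moreover have "emeasure (lebm d) K \<le> emeasure (lebm d) A" using K A by (intro emeasure_mono)
    then have "emeasure (lebm d) K = ennreal (measure (lebm d) K)"
      using A by (intro emeasure_eq_ennreal_measure) (auto simp: top_unique)
    ultimately have "measure (lebm d) A - e < measure (lebm d) K"
      using K(3) False by (simp add: ennreal_less_iff)
    then show ?thesis using that K by blast
  qed
qed

text \<open>Three-epsilon argument: mollification does not increase the \<open>L1\<close> norm, so
  closeness of \<open>f\<close> to \<open>g\<close> survives it uniformly in
  \<open>n\<close>.\<close>

lemma mollify_L1_tendsto_close:
  assumes B: "\<And>n. mollifier_family (r n) (B n)" and f: "integrable (lebm d) f"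
    and approx: "\<And>e. 0 < e \<Longrightarrow> \<exists>g. integrable (lebm d) g \<and> (\<integral>x. \<bar>f x - g x\<bar> \<partial>lebm d) < e \<and>
      (\<lambda>n. \<integral>x. \<bar>mollify d (B n) g (\<lambda>_. 0) x - g x\<bar> \<partial>lebm d) \<longlonglongrightarrow> 0"
  shows "(\<lambda>n. \<integral>x. \<bar>mollify d (B n) f (\<lambda>_. 0) x - f x\<bar> \<partial>lebm d) \<longlonglongrightarrow> 0"
  unfolding LIMSEQ_iff
proof (intro allI impI)
  fix e :: real assume e: "0 < e"
  then obtain g where g: "integrable (lebm d) g" "(\<integral>x. \<bar>f x - g x\<bar> \<partial>lebm d) < e / 3"
    "(\<lambda>n. \<integral>x. \<bar>mollify d (B n) g (\<lambda>_. 0) x - g x\<bar> \<partial>lebm d) \<longlonglongrightarrow> 0"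
    using approx[of "e / 3"] by auto
  from order_tendstoD(2)[OF g(3), of "e / 3"] e obtain N where
    N: "\<And>n. n \<ge> N \<Longrightarrow> (\<integral>x. \<bar>mollify d (B n) g (\<lambda>_. 0) x - g x\<bar> \<partial>lebm d) < e / 3"
    by (auto simp: eventually_sequentially)
  have "(\<integral>x. \<bar>mollify d (B n) f (\<lambda>_. 0) x - f x\<bar> \<partial>lebm d) < e" if "n \<ge> N" for n
  proof -
    note mi = mollify_L1_contraction(1)[OF B]
    have fg: "integrable (lebm d) (\<lambda>x. f x - g x)" using f g(1) by simp
    have "(\<integral>x. \<bar>mollify d (B n) f (\<lambda>_. 0) x - f x\<bar> \<partial>lebm d) \<le>
        (\<integral>x. \<bar>mollify d (B n) (\<lambda>x. f x - g x) (\<lambda>_. 0) x\<bar> + \<bar>mollify d (B n) g (\<lambda>_. 0) x - g x\<bar>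
            + \<bar>f x - g x\<bar> \<partial>lebm d)"
      by (intro integral_mono)
        (use f g(1) mi[OF f, of n] mi[OF g(1), of n] mi[OF fg, of n] in
          \<open>auto simp: mollify_diff[OF B f g(1)] intro!: integrable_abs\<close>)
    also have "\<dots> = (\<integral>x. \<bar>mollify d (B n) (\<lambda>x. f x - g x) (\<lambda>_. 0) x\<bar> \<partial>lebm d)
        + (\<integral>x. \<bar>mollify d (B n) g (\<lambda>_. 0) x - g x\<bar> \<partial>lebm d) + (\<integral>x. \<bar>f x - g x\<bar> \<partial>lebm d)"
      using f g(1) mi[OF g(1), of n] mi[OF fg, of n] by simp
    also have "\<dots> < e"
      using mollify_L1_contraction(2)[OF B fg, of n] g(2) N[OF that] by linarith
    finally show ?thesis .
  qed
  then show "\<exists>N. \<forall>n\<ge>N. norm ((\<integral>x. \<bar>mollify d (B n) f (\<lambda>_. 0) x - f x\<bar> \<partial>lebm d) - 0) < e"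
    by (intro exI[of _ N]) auto
qed

lemma indicator_approx_continuous:
  assumes K: "compact K" "K \<subseteq> topspace (Rd d)" and e: "0 < e"
  obtains g :: "(nat \<Rightarrow> real) \<Rightarrow> real" and L where "continuous_on UNIV g" "compact L" "L \<subseteq> topspace (Rd d)"
    "\<And>x. x \<in> topspace (Rd d) \<Longrightarrow> x \<notin> L \<Longrightarrow> g x = 0"
    "(\<integral>x. \<bar>indicator K x - g x\<bar> \<partial>lebm d) < e"
proof (cases "K = {}")
  case True
  then show ?thesis using e by (intro that[of "\<lambda>_. 0" "{}"]) auto
next
  case False
  obtain R where R: "R > 0" "K \<subseteq> cube d R" using compact_in_cube[OF K] by blast
  \<comment> \<open>The factor \<open>T\<close> confines all approximants to one fixed cube, which
    supplies both the compact support and the dominating function; the distance factor then shrinks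
    to the indicator.\<close>
  define T where "T x = (\<Prod>j<d. max 0 (min 1 (R + 1 - \<bar>x j\<bar>)))" for x :: "nat \<Rightarrow> real"
  have T: "continuous_on UNIV T" unfolding T_def
    by (intro continuous_on_prod_coordinates continuous_intros)
  have T01: "0 \<le> T x" "T x \<le> 1" for x
    unfolding T_def by (auto intro!: prod_nonneg prod_le_1)
  have T1: "T x = 1" if "x \<in> K" for x
    using that R(2) unfolding T_def by (intro prod.neutral) (force simp: cube_eq)
  have T0: "T x = 0" if x: "x \<in> topspace (Rd d)" "x \<notin> cube d (R + 1)" for x
  proof -
    obtain j where "j < d" "\<bar>x j\<bar> > R + 1" using x by (auto simp: cube_eq not_le)
    then show ?thesis unfolding T_def by (intro prod_zero bexI[of _ j]) auto
  qed
  define g where "g n x = T x * max 0 (1 - real n * infdist x K)" for n x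
  have gc: "continuous_on UNIV (g n)" for n
    unfolding g_def by (intro continuous_intros T)
  have g01: "0 \<le> g n x" "g n x \<le> 1" for n x
    using T01[of x] infdist_nonneg[of x K] by (auto simp: g_def intro!: mult_le_one)
  have lim: "(\<lambda>n. g n x) \<longlonglongrightarrow> indicator K x" for x
  proof (cases "x \<in> K")
    case True
    then show ?thesis by (simp add: g_def T1)
  next
    case F: False
    then have pos: "infdist x K > 0"
      using K False compact_imp_closed in_closed_iff_infdist_zero infdist_nonneg
      by (metis less_eq_real_def)
    obtain N where N: "real N * infdist x K > 1" using ex_less_of_nat_mult[OF pos, of 1] by auto
    have "g n x = 0" if "n \<ge> N" for n
    proof -
      have "real n * infdist x K \<ge> real N * infdist x K" using that pos by (intro mult_right_mono) auto
      then show ?thesis using N by (simp add: g_def)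
    qed
    then show ?thesis using F by (intro tendsto_eventually) (auto simp: eventually_sequentially)
  qed
  have "(\<lambda>n. \<integral>x. \<bar>indicator K x - g n x\<bar> \<partial>lebm d) \<longlonglongrightarrow> (\<integral>x. 0 \<partial>lebm d)"
  proof (rule integral_dominated_convergence[where w = "\<lambda>x. indicator (cube d (R + 1)) x"])
    show "integrable (lebm d) (\<lambda>x. indicator (cube d (R + 1)) x :: real)"
      using cube_sets emeasure_cube by (auto simp: integrable_indicator_iff)
    show "AE x in lebm d. (\<lambda>n. \<bar>indicator K x - g n x\<bar>) \<longlonglongrightarrow> 0"
    proof (rule AE_I2)
      show "(\<lambda>n. \<bar>indicator K x - g n x\<bar>) \<longlonglongrightarrow> 0" for x
        using tendsto_rabs[OF tendsto_diff[OF tendsto_const lim[of x], of "indicator K x"]] by simp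
    qed
    show "AE x in lebm d. norm \<bar>indicator K x - g n x\<bar> \<le> indicator (cube d (R + 1)) x" for n
    proof (rule AE_I2)
      fix x assume "x \<in> space (lebm d)"
      then have x: "x \<in> topspace (Rd d)" by (simp add: space_lebm)
      show "norm \<bar>indicator K x - g n x\<bar> \<le> indicator (cube d (R + 1)) x"
      proof (cases "x \<in> cube d (R + 1)")
        case True
        then show ?thesis using g01[of n x] by (auto simp: indicator_def)
      next
        case False
        then have "x \<notin> K" using R(2) by (force simp: cube_eq)
        then show ?thesis using T0[OF x False] False by (simp add: g_def)
      qed
    qed
    have [measurable]: "g n \<in> borel_measurable (lebm d)" for n
      by (rule borel_measurable_lebm_continuous[OF gc])
    have [measurable]: "K \<in> sets (lebm d)" by (rule compact_sets_lebm[OF K])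
    show "(\<lambda>x. \<bar>indicator K x - g n x\<bar>) \<in> borel_measurable (lebm d)" for n by measurable
  qed simp
  then have "(\<lambda>n. \<integral>x. \<bar>indicator K x - g n x\<bar> \<partial>lebm d) \<longlonglongrightarrow> 0" by simp
  from order_tendstoD(2)[OF this e] obtain n where "(\<integral>x. \<bar>indicator K x - g n x\<bar> \<partial>lebm d) < e"
    by (auto simp: eventually_sequentially)
  then show ?thesis
    using T0 by (intro that[of "g n" "cube d (R + 1)"] gc compact_cube cube_subset) (auto simp: g_def)
qed

lemma mollify_L1_tendsto:
  assumes B: "\<And>n. mollifier_family (r n) (B n)" and r: "r \<longlonglongrightarrow> 0" "\<And>n. r n \<le> 1"
    and f: "integrable (lebm d) f"
  shows "(\<lambda>n. \<integral>x. \<bar>mollify d (B n) f (\<lambda>_. 0) x - f x\<bar> \<partial>lebm d) \<longlonglongrightarrow> 0"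
  using f
proof (induction rule: integrable_induct)
  case (base A c)
  show ?case
  proof (rule mollify_L1_tendsto_close[OF B])
    show i: "integrable (lebm d) (\<lambda>x. indicator A x *\<^sub>R c)" using base by (simp add: integrable_indicator_iff)
    fix e :: real assume e: "0 < e"
    \<comment> \<open>One share \<open>e'\<close> pays for \<open>A - K\<close>, the other for the
      continuous approximation of \<open>indicator K\<close>; adding \<open>1\<close> to
      \<open>\<bar>c\<bar>\<close> avoids division by zero and makes the final inequality
      strict.\<close>
    define e' where "e' = e / (2 * (\<bar>c\<bar> + 1))"
    have e': "0 < e'" using e by (simp add: e'_def)
    obtain K where K: "compact K" "K \<subseteq> A" "measure (lebm d) A - e' < measure (lebm d) K"
      using lebm_inner_regular[OF base e'] by blast
    have Kt: "K \<subseteq> topspace (Rd d)" using K(2) sets.sets_into_space[OF base(1)] by (auto simp: space_lebm)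
    have Ks: "K \<in> sets (lebm d)" "emeasure (lebm d) K < \<infinity>"
      using compact_sets_lebm[OF K(1) Kt] emeasure_compact[OF K(1) Kt] by auto
    obtain g L where g: "continuous_on UNIV g" "compact L" "L \<subseteq> topspace (Rd d)"
      "\<And>x. x \<in> topspace (Rd d) \<Longrightarrow> x \<notin> L \<Longrightarrow> g x = 0"
      "(\<integral>x. \<bar>indicator K x - g x\<bar> \<partial>lebm d) < e'"
      using indicator_approx_continuous[OF K(1) Kt e'] by blast
    have gi: "integrable (lebm d) g" by (rule integrable_continuous_compact_support[OF g(1-4)])
    have AK: "integrable (lebm d) (indicator (A - K) :: _ \<Rightarrow> real)"
      using base Ks by (intro integrable_real_indicator) (auto intro: le_less_trans[OF emeasure_mono])
    have KI: "integrable (lebm d) (\<lambda>x. indicator K x - g x)" using Ks gi by (simp add: integrable_indicator_iff)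
    have "(\<integral>x. \<bar>indicator A x *\<^sub>R c - c * g x\<bar> \<partial>lebm d)
        \<le> (\<integral>x. \<bar>c\<bar> * (indicator (A - K) x + \<bar>indicator K x - g x\<bar>) \<partial>lebm d)"
    proof (rule integral_mono)
      show "integrable (lebm d) (\<lambda>x. \<bar>indicator A x *\<^sub>R c - c * g x\<bar>)" using i gi by auto
      show "integrable (lebm d) (\<lambda>x. \<bar>c\<bar> * (indicator (A - K) x + \<bar>indicator K x - g x\<bar>))"
        using AK KI by (intro integrable_mult_right Bochner_Integration.integrable_add integrable_abs)
      show "\<bar>indicator A x *\<^sub>R c - c * g x\<bar> \<le> \<bar>c\<bar> * (indicator (A - K) x + \<bar>indicator K x - g x\<bar>)" for x
      proof -
        have "\<bar>indicator A x *\<^sub>R c - c * g x\<bar> = \<bar>c\<bar> * \<bar>indicator A x - g x\<bar>"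
          by (simp add: abs_mult[symmetric] algebra_simps)
        also have "\<dots> \<le> \<bar>c\<bar> * (indicator (A - K) x + \<bar>indicator K x - g x\<bar>)"
          using K(2) by (intro mult_left_mono) (auto simp: indicator_def)
        finally show ?thesis .
      qed
    qed
    also have "\<dots> = \<bar>c\<bar> * (measure (lebm d) (A - K) + (\<integral>x. \<bar>indicator K x - g x\<bar> \<partial>lebm d))"
    proof -
      have "(A - K) \<inter> space (lebm d) = A - K" using sets.sets_into_space[OF base(1)] by blast
      then show ?thesis using AK KI by simp
    qed
    also have "measure (lebm d) (A - K) = measure (lebm d) A - measure (lebm d) K"
      using base Ks K(2) by (intro measure_Diff) auto
    also have "\<bar>c\<bar> * (measure (lebm d) A - measure (lebm d) K + (\<integral>x. \<bar>indicator K x - g x\<bar> \<partial>lebm d))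
        \<le> \<bar>c\<bar> * (2 * e')" using K(3) g(5) by (intro mult_left_mono) auto
    also have "\<dots> < (\<bar>c\<bar> + 1) * (2 * e')" using e' by (intro mult_strict_right_mono) auto
    also have "\<dots> = e" by (simp add: e'_def field_simps)
    finally have "(\<integral>x. \<bar>indicator A x *\<^sub>R c - c * g x\<bar> \<partial>lebm d) < e" .
    moreover have "(\<lambda>n. \<integral>x. \<bar>mollify d (B n) (\<lambda>x. c * g x) (\<lambda>_. 0) x - c * g x\<bar> \<partial>lebm d) \<longlonglongrightarrow> 0"
      using g by (intro mollify_L1_tendsto_continuous[OF B r _ g(2,3)] continuous_intros) auto
    ultimately show "\<exists>g. integrable (lebm d) g \<and> (\<integral>x. \<bar>indicator A x *\<^sub>R c - g x\<bar> \<partial>lebm d) < e \<and>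
      (\<lambda>n. \<integral>x. \<bar>mollify d (B n) g (\<lambda>_. 0) x - g x\<bar> \<partial>lebm d) \<longlonglongrightarrow> 0"
      using gi by (intro exI[of _ "\<lambda>x. c * g x"]) auto
  qed
next
  case (add f g)
  note mi = mollify_L1_contraction(1)[OF B]
  have fg: "integrable (lebm d) (\<lambda>x. f x + g x)" using add.hyps by simp
  have eq: "mollify d (B n) (\<lambda>x. f x + g x) (\<lambda>_. 0) x = mollify d (B n) f (\<lambda>_. 0) x + mollify d (B n) g (\<lambda>_. 0) x" for n x
    unfolding mollify_def distrib_right
    by (intro Bochner_Integration.integral_add integrable_kernel[OF B] add.hyps)
  have "(\<integral>x. \<bar>mollify d (B n) (\<lambda>x. f x + g x) (\<lambda>_. 0) x - (f x + g x)\<bar> \<partial>lebm d) \<le>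
      (\<integral>x. \<bar>mollify d (B n) f (\<lambda>_. 0) x - f x\<bar> \<partial>lebm d) + (\<integral>x. \<bar>mollify d (B n) g (\<lambda>_. 0) x - g x\<bar> \<partial>lebm d)" for n
  proof -
    have "(\<integral>x. \<bar>mollify d (B n) (\<lambda>x. f x + g x) (\<lambda>_. 0) x - (f x + g x)\<bar> \<partial>lebm d) \<le>
      (\<integral>x. \<bar>mollify d (B n) f (\<lambda>_. 0) x - f x\<bar> + \<bar>mollify d (B n) g (\<lambda>_. 0) x - g x\<bar> \<partial>lebm d)"
      by (intro integral_mono)
        (use add.hyps mi[OF add.hyps(1), of n] mi[OF add.hyps(2), of n] mi[OF fg, of n] in \<open>auto simp: eq intro!: integrable_abs\<close>)
    then show ?thesis using add.hyps mi[OF add.hyps(1), of n] mi[OF add.hyps(2), of n] by simp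
  qed
  then show ?case
    by (intro tendsto_sandwich[OF _ _ tendsto_const tendsto_add_zero[OF add.IH]]) auto
next
  case (lim f s)
  show ?case
  proof (rule mollify_L1_tendsto_close[OF B lim.hyps(4)])
    fix e :: real assume e: "0 < e"
    \<comment> \<open>The approximants of the induction satisfy
      \<open>\<bar>s i x\<bar> \<le> 2 * \<bar>f x\<bar>\<close>, which explains the factor
      \<open>3\<close> in the dominating function.\<close>
    have "(\<lambda>i. \<integral>x. \<bar>f x - s i x\<bar> \<partial>lebm d) \<longlonglongrightarrow> (\<integral>x. 0 \<partial>lebm d)"
    proof (rule integral_dominated_convergence[where w = "\<lambda>x. 3 * \<bar>f x\<bar>"])
      show "AE x in lebm d. (\<lambda>i. \<bar>f x - s i x\<bar>) \<longlonglongrightarrow> 0"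
      proof (rule AE_I2)
        fix x assume "x \<in> space (lebm d)"
        from tendsto_diff[OF tendsto_const lim.hyps(2)[OF this], of "f x"]
        show "(\<lambda>i. \<bar>f x - s i x\<bar>) \<longlonglongrightarrow> 0" by (intro tendsto_rabs_zero) simp
      qed
      show "AE x in lebm d. norm \<bar>f x - s i x\<bar> \<le> 3 * \<bar>f x\<bar>" for i
        using lim.hyps(3)[of _ i] by (intro AE_I2) fastforce
    qed (use lim.hyps in auto)
    then have "(\<lambda>i. \<integral>x. \<bar>f x - s i x\<bar> \<partial>lebm d) \<longlonglongrightarrow> 0" by simp
    from order_tendstoD(2)[OF this e] obtain i where "(\<integral>x. \<bar>f x - s i x\<bar> \<partial>lebm d) < e"
      by (auto simp: eventually_sequentially)
    then show "\<exists>g. integrable (lebm d) g \<and> (\<integral>x. \<bar>f x - g x\<bar> \<partial>lebm d) < e \<and>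
      (\<lambda>n. \<integral>x. \<bar>mollify d (B n) g (\<lambda>_. 0) x - g x\<bar> \<partial>lebm d) \<longlonglongrightarrow> 0"
      using lim.hyps(1) lim.IH by blast
  qed
qed

text \<open>The radii are split with a margin: open boxes of half size cover \<open>K\<close>, a
  quarter is left for \<open>r\<close>, and closed boxes of relative size \<open>3 / 4\<close> form
  \<open>K'\<close>. Then \<open>1 / 2 + 1 / 4 \<le> 3 / 4 < 1\<close> gives both
  inclusions.\<close>

lemma compact_neighborhood:
  assumes \<Omega>: "openin (Rd d) \<Omega>" and K: "compact K" "K \<subseteq> \<Omega>"
  obtains r K' where "r > 0" "compact K'" "K \<subseteq> K'" "K' \<subseteq> \<Omega>"
    "\<And>x y. x \<in> K \<Longrightarrow> y \<in> topspace (Rd d) \<Longrightarrow> (\<forall>j<d. \<bar>x j - y j\<bar> < r) \<Longrightarrow> y \<in> K'"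
proof -
  have \<Omega>t: "\<Omega> \<subseteq> topspace (Rd d)" by (rule openin_subset[OF \<Omega>])
  define V where "V = {x. restrict x {..<d} \<in> \<Omega>}"
  have V: "open V"
    using openin_continuous_map_preimage[OF continuous_map_euclidean_Rd \<Omega>] by (simp add: V_def)
  have rs: "restrict x {..<d} = x" if "x \<in> topspace (Rd d)" for x
    using that by (simp add: PiE_iff extensional_restrict)
  have "\<exists>r>0. \<forall>y\<in>topspace (Rd d). (\<forall>j<d. \<bar>x j - y j\<bar> < r) \<longrightarrow> y \<in> \<Omega>" if "x \<in> K" for x
  proof -
    have x: "x \<in> topspace (Rd d)" using that K \<Omega>t by auto
    then have "x \<in> V" using that K(2) rs[OF x] by (auto simp: V_def)
    then obtain r where "r > 0" "\<And>y. y \<in> topspace (Rd d) \<Longrightarrow> (\<forall>j<d. \<bar>x j - y j\<bar> < r) \<Longrightarrow> y \<in> V"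
      using box_in_open[OF V _ x] by blast
    then show ?thesis using rs by (auto simp: V_def intro!: exI[of _ r])
  qed
  then obtain \<rho> where \<rho>: "\<And>x. x \<in> K \<Longrightarrow> \<rho> x > 0"
    "\<And>x y. x \<in> K \<Longrightarrow> y \<in> topspace (Rd d) \<Longrightarrow> (\<forall>j<d. \<bar>x j - y j\<bar> < \<rho> x) \<Longrightarrow> y \<in> \<Omega>"
    by metis
  define O' where "O' x = (\<Inter>j<d. {y::nat \<Rightarrow> real. \<bar>x j - y j\<bar> < \<rho> x / 2})" for x
  have "open (O' x)" for x
    unfolding O'_def
    by (intro open_INT ballI open_Collect_less continuous_intros continuous_on_product_coordinates) auto
  moreover have "K \<subseteq> (\<Union>x\<in>K. O' x)" using \<rho>(1) by (auto simp: O'_def)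
  ultimately obtain D where D: "D \<subseteq> K" "finite D" "K \<subseteq> (\<Union>x\<in>D. O' x)"
    using compactE_image[OF K(1), of K O'] by metis
  define P where "P x = PiE {..<d} (\<lambda>j. {x j - \<rho> x * 3 / 4..x j + \<rho> x * 3 / 4})" for x
  have P: "compact (P x)" "P x \<subseteq> topspace (Rd d)" for x
  proof -
    have "compactin (Rd d) (P x)" unfolding P_def by (subst compactin_PiE) auto
    then show "compact (P x)" "P x \<subseteq> topspace (Rd d)" by (simp_all only: compactin_Rd_iff)
  qed
  have Pi: "y \<in> P x \<longleftrightarrow> y \<in> topspace (Rd d) \<and> (\<forall>j<d. \<bar>x j - y j\<bar> \<le> \<rho> x * 3 / 4)" for x y
  proof -
    have "s \<in> {t - \<rho> x * 3 / 4..t + \<rho> x * 3 / 4} \<longleftrightarrow> \<bar>t - s\<bar> \<le> \<rho> x * 3 / 4" for s t :: real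
      unfolding atLeastAtMost_iff by linarith
    then show ?thesis unfolding P_def PiE_iff by (auto simp: extensional_def)
  qed
  define r where "r = Min (insert 1 ((\<lambda>x. \<rho> x / 4) ` D))"
  have r: "r > 0" using \<rho>(1) D by (auto simp: r_def)
  have r': "r \<le> \<rho> x / 4" if "x \<in> D" for x
    unfolding r_def using D(2) that by (intro Min_le) auto
  have nb: "y \<in> (\<Union>x\<in>D. P x)"
    if x: "x \<in> K" and y: "y \<in> topspace (Rd d)" "\<forall>j<d. \<bar>x j - y j\<bar> < r" for x y
  proof -
    obtain c where c: "c \<in> D" "x \<in> O' c" using D(3) x by auto
    have "\<bar>c j - y j\<bar> \<le> \<rho> c * 3 / 4" if "j < d" for j
    proof -
      have "\<bar>c j - x j\<bar> < \<rho> c / 2" using c(2) that by (auto simp: O'_def)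
      moreover have "\<bar>x j - y j\<bar> < \<rho> c / 4" using y(2) that r'[OF c(1)] by (metis less_le_trans)
      ultimately show ?thesis by linarith
    qed
    then show ?thesis using c(1) y(1) by (auto simp: Pi)
  qed
  show ?thesis
  proof (rule that[of r "\<Union>x\<in>D. P x", OF r])
    show "compact (\<Union>x\<in>D. P x)" using D(2) P(1) by (intro compact_UN) auto
    show "K \<subseteq> (\<Union>x\<in>D. P x)" 
    proof
      fix x assume "x \<in> K"
      then show "x \<in> (\<Union>x\<in>D. P x)" using K(2) \<Omega>t r by (intro nb[of x x]) auto
    qed
    show "(\<Union>x\<in>D. P x) \<subseteq> \<Omega>"
    proof safe
      fix c y assume "c \<in> D" "y \<in> P c"
      moreover from \<open>c \<in> D\<close> have "c \<in> K" "\<rho> c > 0" using D(1) \<rho>(1) by auto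
      moreover have "\<forall>j<d. \<bar>c j - y j\<bar> < \<rho> c" using \<open>y \<in> P c\<close> \<open>\<rho> c > 0\<close> by (force simp: Pi)
      ultimately show "y \<in> \<Omega>" using \<rho>(2)[of c y] by (auto simp: Pi)
    qed
  qed (rule nb)
qed

section \<open>The boundary distance and the Hardy inequality for continuously differentiable functions\<close>

text \<open>\<open>Rd d\<close> is connected, so a proper nonempty open set cannot also be closed.
  Without a frontier point the infimum in \<open>bdry_dist\<close> would range over the empty set
  and have no geometric meaning.\<close>

lemma frontier_nonempty:
  assumes "openin (Rd d) \<Omega>" "\<Omega> \<noteq> {}" "\<Omega> \<noteq> topspace (Rd d)"
  shows "Rd d frontier_of \<Omega> \<noteq> {}"
proof
  assume "Rd d frontier_of \<Omega> = {}"
  then have "closedin (Rd d) \<Omega>"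
    using assms(1) openin_subset[OF assms(1)] by (simp add: frontier_of_eq_empty)
  moreover have "connected_space euclideanreal"
    using connectedin_topspace[of euclideanreal] connected_UNIV
    by (metis connectedin_iff_connected topspace_euclidean)
  then have "connected_space (Rd d)" by (simp add: connected_space_product_topology)
  ultimately show False using assms by (auto simp: connected_space_clopen_in)
qed

lemma bdry_dist_le:
  assumes "Rd d frontier_of \<Omega> \<noteq> {}"
  shows "bdry_dist d \<Omega> x \<le> bdry_dist d \<Omega> x' + L2_set (\<lambda>i. x i - x' i) {..<d}"
proof -
  have "bdry_dist d \<Omega> x - L2_set (\<lambda>i. x i - x' i) {..<d} \<le> bdry_dist d \<Omega> x'"
    unfolding bdry_dist_def[of d \<Omega> x']
  proof (rule cINF_greatest[OF assms])
    fix y assume y: "y \<in> Rd d frontier_of \<Omega>"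
    have "bdry_dist d \<Omega> x \<le> L2_set (\<lambda>i. x i - y i) {..<d}"
      unfolding bdry_dist_def
      by (rule cINF_lower[OF _ y]) (auto intro!: bdd_belowI[of _ 0] L2_set_nonneg)
    also have "\<dots> \<le> L2_set (\<lambda>i. x i - x' i) {..<d} + L2_set (\<lambda>i. x' i - y i) {..<d}"
      using L2_set_triangle_ineq[of "\<lambda>i. x i - x' i" "\<lambda>i. x' i - y i" "{..<d}"] by simp
    finally show "bdry_dist d \<Omega> x - L2_set (\<lambda>i. x i - x' i) {..<d} \<le> L2_set (\<lambda>i. x' i - y i) {..<d}"
      by simp
  qed
  then show ?thesis by simp
qed

lemma continuous_bdry_dist:
  assumes "Rd d frontier_of \<Omega> \<noteq> {}"
  shows "continuous_on UNIV (bdry_dist d \<Omega>)"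
proof (rule continuous_on_sequentiallyI)
  fix X and x :: "nat \<Rightarrow> real" assume X: "X \<longlonglongrightarrow> x"
  have "(\<lambda>n. X n i) \<longlonglongrightarrow> x i" for i
    using continuous_on_tendsto_compose[OF continuous_on_product_coordinates X] by simp
  then have "(\<lambda>n. L2_set (\<lambda>i. X n i - x i) {..<d}) \<longlonglongrightarrow> L2_set (\<lambda>i. x i - x i) {..<d}"
    unfolding L2_set_def by (intro tendsto_intros)
  then have lim: "(\<lambda>n. L2_set (\<lambda>i. X n i - x i) {..<d}) \<longlonglongrightarrow> 0" by (simp add: L2_set_def)
  have "\<bar>bdry_dist d \<Omega> (X n) - bdry_dist d \<Omega> x\<bar> \<le> L2_set (\<lambda>i. X n i - x i) {..<d}" for n
  proof -
    have "L2_set (\<lambda>i. x i - X n i) {..<d} = L2_set (\<lambda>i. X n i - x i) {..<d}"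
      by (simp add: L2_set_def power2_commute)
    then show ?thesis
      using bdry_dist_le[OF assms, of x "X n"] bdry_dist_le[OF assms, of "X n" x] by linarith
  qed
  then have "(\<lambda>n. bdry_dist d \<Omega> (X n) - bdry_dist d \<Omega> x) \<longlonglongrightarrow> 0"
    by (intro Lim_null_comparison[OF _ lim]) auto
  then show "(\<lambda>n. bdry_dist d \<Omega> (X n)) \<longlonglongrightarrow> bdry_dist d \<Omega> x" by (simp add: LIM_zero_iff)
qed

text \<open>A whole box about \<open>x\<close> lies in the open set, so each frontier point differs
  from \<open>x\<close> by at least \<open>r\<close> in some coordinate, and the Euclidean norm
  dominates every coordinate.\<close>

lemma bdry_dist_pos:
  assumes fr: "Rd d frontier_of \<Omega> \<noteq> {}" and \<Omega>: "openin (Rd d) \<Omega>" and x: "x \<in> \<Omega>"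
  shows "0 < bdry_dist d \<Omega> x"
proof (rule compact_neighborhood[OF \<Omega> compact_sing[of x]])
  show "{x} \<subseteq> \<Omega>" using x by simp
  fix r K' assume r: "0 < r" "K' \<subseteq> \<Omega>"
    and nb: "\<And>z y. z \<in> {x} \<Longrightarrow> y \<in> topspace (Rd d) \<Longrightarrow> (\<forall>j<d. \<bar>z j - y j\<bar> < r) \<Longrightarrow> y \<in> K'"
  have "r \<le> bdry_dist d \<Omega> x"
    unfolding bdry_dist_def
  proof (rule cINF_greatest[OF fr])
    fix y assume y: "y \<in> Rd d frontier_of \<Omega>"
    then have "y \<notin> \<Omega>" using \<Omega> by (simp add: frontier_of_def interior_of_openin)
    moreover have "y \<in> topspace (Rd d)" using y frontier_of_subset_topspace[of "Rd d" \<Omega>] by blast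
    ultimately obtain j where j: "j < d" "r \<le> \<bar>x j - y j\<bar>" using r(2) nb[of x y] by (force simp: not_less)
    note j(2)
    also have "\<bar>x j - y j\<bar> \<le> L2_set (\<lambda>i. \<bar>x i - y i\<bar>) {..<d}"
      using j(1) by (intro member_le_L2_set) auto
    finally show "r \<le> L2_set (\<lambda>i. x i - y i) {..<d}" by (simp add: L2_set_def)
  qed
  then show ?thesis using r(1) by linarith
qed

lemma bdry_dist_nonneg:
  assumes fr: "Rd d frontier_of \<Omega> \<noteq> {}"
  shows "0 \<le> bdry_dist d \<Omega> x"
  unfolding bdry_dist_def by (rule cINF_greatest[OF fr]) (rule L2_set_nonneg)

text \<open>Radii at most \<open>1\<close> keep supports in one cube; radii at most
  \<open>r0\<close> keep them in a prescribed neighborhood.\<close>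

lemma mollifier_sequence:
  assumes r0: "0 < (r0 :: real)"
  obtains r B where "\<And>n :: nat. mollifier_family (r n) (B n)" "r \<longlonglongrightarrow> 0" "\<And>n. 0 < r n" "\<And>n. r n \<le> 1" "\<And>n. r n \<le> r0"
proof -
  define r where "r n = min 1 r0 / (real n + 1)" for n
  have r: "0 < r n" for n using r0 by (auto simp: r_def)
  have le: "r n \<le> min 1 r0" for n 
  proof -
    have "min 1 r0 * 1 \<le> min 1 r0 * (real n + 1)" using r0 by (intro mult_left_mono) auto
    then show ?thesis unfolding r_def by (subst divide_le_eq) auto
  qed
  have "r \<longlonglongrightarrow> 0"
    unfolding r_def using tendsto_mult[OF tendsto_const LIMSEQ_inverse_real_of_nat, of "min 1 r0"]
    by (simp add: divide_inverse add.commute)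
  moreover have "\<forall>n. \<exists>B. mollifier_family (r n) B" using mollifier_family_exists[OF r] by metis
  then obtain B where "\<And>n. mollifier_family (r n) (B n)" by metis
  ultimately show ?thesis using that[of r B] r le by force
qed

text \<open>The hypothesis speaks of test functions, but a truncated power of \<open>v\<close> times
  a weight is merely continuously differentiable. Its mollifications are test functions: the
  gradient side passes to the limit by dominated convergence, the other side by Fatou.\<close>

lemma hardy_inequality_C1:
  assumes hardy: "hardy_inequality d \<Omega> C0" and \<Omega>: "openin (Rd d) \<Omega>"
    and \<rho>: "continuous_on UNIV (bdry_dist d \<Omega>)"
    and K: "compact K" "K \<subseteq> \<Omega>"
    and f: "continuous_on UNIV f" "\<And>i. i < d \<Longrightarrow> continuous_on UNIV (f' i)"
    and der: "\<And>i x. i < d \<Longrightarrow> x \<in> topspace (Rd d) \<Longrightarrow> has_partial i f x (f' i x)"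
    and supp: "\<And>x. x \<in> topspace (Rd d) \<Longrightarrow> x \<notin> K \<Longrightarrow> f x = 0"
    and supp': "\<And>i x. i < d \<Longrightarrow> x \<in> topspace (Rd d) \<Longrightarrow> x \<notin> K \<Longrightarrow> f' i x = 0"
  shows "(\<integral>\<^sup>+x. ennreal ((f x / bdry_dist d \<Omega> x)\<^sup>2) \<partial>lebm d)
      \<le> ennreal (C0 * (\<integral>x. (\<Sum>i<d. (f' i x)\<^sup>2) \<partial>lebm d))"
proof -
  have \<Omega>t: "\<Omega> \<subseteq> topspace (Rd d)" by (rule openin_subset[OF \<Omega>])
  have Kt: "K \<subseteq> topspace (Rd d)" using K(2) \<Omega>t by blast
  have C0: "0 < C0" using hardy by (simp add: hardy_inequality_def)
  obtain r0 K' where r0: "r0 > 0" and K': "compact K'" "K \<subseteq> K'" "K' \<subseteq> \<Omega>"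
    and nb: "\<And>x y. x \<in> K \<Longrightarrow> y \<in> topspace (Rd d) \<Longrightarrow> (\<forall>j<d. \<bar>x j - y j\<bar> < r0) \<Longrightarrow> y \<in> K'"
    using compact_neighborhood[OF \<Omega> K] by metis
  have K't: "K' \<subseteq> topspace (Rd d)" using K'(3) \<Omega>t by blast
  obtain r B where B: "\<And>n::nat. mollifier_family (r n) (B n)" "r \<longlonglongrightarrow> 0" "\<And>n. r n \<le> r0"
    using mollifier_sequence[OF r0] by metis
  have fi: "integrable (lebm d) f" by (rule integrable_continuous_compact_support[OF f(1) K(1) Kt supp])
  have f'i: "integrable (lebm d) (f' i)" if "i < d" for i
    by (rule integrable_continuous_compact_support[OF f(2)[OF that] K(1) Kt supp'[OF that]])
  have m0: "mollify d (B n) h ks x = 0"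
    if "\<And>x. x \<in> topspace (Rd d) \<Longrightarrow> x \<notin> K \<Longrightarrow> h x = 0" "x \<in> topspace (Rd d)" "x \<notin> K'" for n h ks x
  proof (rule mollify_eq_0[OF B(1)])
    fix y assume y: "y \<in> topspace (Rd d)" "\<forall>j<d. \<bar>x j - y j\<bar> < r n"
    have "\<forall>j<d. \<bar>y j - x j\<bar> < r0" using y(2) B(3)[of n] by (metis abs_minus_commute less_le_trans)
    then have "y \<notin> K" using nb[of y x] that(2,3) by blast
    then show "h y = 0" using that(1) y(1) by blast
  qed
  define F where "F n = mollify d (B n) f (\<lambda>_. 0)" for n
  define F' where "F' n i = mollify d (B n) (f' i) (\<lambda>_. 0)" for n i
  have F_test: "F n \<in> test_functions d \<Omega>" for n
    unfolding F_def by (rule mollify_test_function[OF B(1) fi K'(1,3) \<Omega>t]) (rule m0[OF supp])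
  \<comment> \<open>With the derivative moved off the kernel, the gradient of a mollification is the
    mollification of \<open>f'\<close> and inherits its bounds and pointwise limits.\<close>
  have pF: "partial i (F n) x = F' n i x" if "i < d" for i n x
    unfolding F_def F'_def
    using has_partial_imp_partial[OF has_partial_mollify[OF B(1) fi that]]
      mollify_partial[OF B(1) that f(1) f(2)[OF that] der[OF that] K(1) Kt supp supp'[OF that]]
    by (simp del: fun_upd_apply)
  have F'c: "continuous_on UNIV (F' n i)" if "i < d" for n i
    unfolding F'_def by (rule continuous_mollify[OF B(1) f'i[OF that]])
  have F'0: "F' n i x = 0" if "i < d" "x \<in> topspace (Rd d)" "x \<notin> K'" for n i x
    unfolding F'_def using that by (intro m0 supp') auto
  have F'2i: "integrable (lebm d) (\<lambda>x. \<Sum>i<d. (F' n i x)\<^sup>2)" for n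
    by (rule integrable_continuous_compact_support[OF _ K'(1) K't])
       (auto intro!: continuous_intros F'c simp: F'0)
  have "\<forall>i. \<exists>C. i < d \<longrightarrow> (\<forall>x\<in>topspace (Rd d). \<bar>f' i x\<bar> \<le> C)"
  proof (intro allI)
    fix i
    show "\<exists>C. i < d \<longrightarrow> (\<forall>x\<in>topspace (Rd d). \<bar>f' i x\<bar> \<le> C)"
    proof (cases "i < d")
      case True
      obtain C where C: "C > 0" "\<And>x. x \<in> K \<Longrightarrow> \<bar>f' i x\<bar> \<le> C"
        using compact_bounded_fun[OF f(2)[OF True] K(1)] by blast
      have "\<bar>f' i x\<bar> \<le> C" if "x \<in> topspace (Rd d)" for x
        using C supp'[OF True that] by (cases "x \<in> K") auto
      then show ?thesis by blast
    qed simp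
  qed
  then obtain C where C: "\<And>i x. i < d \<Longrightarrow> x \<in> topspace (Rd d) \<Longrightarrow> \<bar>f' i x\<bar> \<le> C i" by metis
  have lim: "(\<lambda>n. \<integral>x. (\<Sum>i<d. (F' n i x)\<^sup>2) \<partial>lebm d) \<longlonglongrightarrow> (\<integral>x. (\<Sum>i<d. (f' i x)\<^sup>2) \<partial>lebm d)"
  proof (rule integral_dominated_convergence[where w = "\<lambda>x. (\<Sum>i<d. (C i)\<^sup>2) * indicator K' x"])
    show "integrable (lebm d) (\<lambda>x. (\<Sum>i<d. (C i)\<^sup>2) * indicator K' x)"
      using compact_sets_lebm[OF K'(1) K't] emeasure_compact[OF K'(1) K't]
      by (intro integrable_mult_right) (auto simp: integrable_indicator_iff)
    show "AE x in lebm d. (\<lambda>n. \<Sum>i<d. (F' n i x)\<^sup>2) \<longlonglongrightarrow> (\<Sum>i<d. (f' i x)\<^sup>2)"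
      unfolding F'_def
      by (intro AE_I2 tendsto_sum tendsto_power mollify_tendsto[OF B(1,2)] f'i f(2)) (auto simp: space_lebm)
    show "AE x in lebm d. norm (\<Sum>i<d. (F' n i x)\<^sup>2) \<le> (\<Sum>i<d. (C i)\<^sup>2) * indicator K' x" for n
    proof (rule AE_I2)
      fix x assume "x \<in> space (lebm d)"
      then have x: "x \<in> topspace (Rd d)" by (simp add: space_lebm)
      have "\<bar>F' n i x\<bar> \<le> C i" if "i < d" for i
        unfolding F'_def by (rule mollify_bounded[OF B(1) f'i[OF that] C[OF that]])
      then have "(F' n i x)\<^sup>2 \<le> (C i)\<^sup>2" if "i < d" for i using that by (intro power2_le_iff_abs_le[THEN iffD2]) (force intro: order_trans[OF abs_ge_zero])+
      then have "(\<Sum>i<d. (F' n i x)\<^sup>2) \<le> (\<Sum>i<d. (C i)\<^sup>2)" by (intro sum_mono) auto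
      then show "norm (\<Sum>i<d. (F' n i x)\<^sup>2) \<le> (\<Sum>i<d. (C i)\<^sup>2) * indicator K' x"
        using F'0[OF _ x] by (cases "x \<in> K'") (auto simp: sum_nonneg)
    qed
  qed (use F'c f(2) in \<open>auto intro!: borel_measurable_lebm_continuous continuous_intros\<close>)
  have le: "(\<integral>\<^sup>+x. ennreal ((F n x / bdry_dist d \<Omega> x)\<^sup>2) \<partial>lebm d)
      \<le> ennreal (C0 * (\<integral>x. (\<Sum>i<d. (F' n i x)\<^sup>2) \<partial>lebm d))" for n
  proof -
    have "(\<integral>\<^sup>+x. ennreal ((F n x / bdry_dist d \<Omega> x)\<^sup>2) \<partial>lebm d)
        = (\<integral>\<^sup>+x\<in>\<Omega>. ennreal (\<bar>F n x / bdry_dist d \<Omega> x\<bar>\<^sup>2) \<partial>leb d)"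
      unfolding leb_def nn_integral_completion
    proof (rule nn_integral_cong)
      fix x assume "x \<in> space (lebm d)"
      then have "x \<notin> \<Omega> \<Longrightarrow> F n x = 0"
        unfolding F_def using K'(3) by (intro m0[OF supp]) (auto simp: space_lebm)
      then show "ennreal ((F n x / bdry_dist d \<Omega> x)\<^sup>2)
          = ennreal (\<bar>F n x / bdry_dist d \<Omega> x\<bar>\<^sup>2) * indicator \<Omega> x"
        by (cases "x \<in> \<Omega>") (auto simp: power_divide)
    qed
    also have "\<dots> \<le> ennreal C0 * (\<integral>\<^sup>+x\<in>\<Omega>. ennreal ((grad_norm d (F n) x)\<^sup>2) \<partial>leb d)"
      using hardy F_test[of n] by (simp add: hardy_inequality_def)
    also have "\<dots> \<le> ennreal C0 * (\<integral>\<^sup>+x. ennreal (\<Sum>i<d. (F' n i x)\<^sup>2) \<partial>lebm d)"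
      unfolding leb_def nn_integral_completion
      by (intro mult_left_mono nn_integral_mono)
         (auto simp: grad_norm_def L2_set_def pF sum_nonneg indicator_def)
    also have "(\<integral>\<^sup>+x. ennreal (\<Sum>i<d. (F' n i x)\<^sup>2) \<partial>lebm d) = ennreal (\<integral>x. (\<Sum>i<d. (F' n i x)\<^sup>2) \<partial>lebm d)"
      by (intro nn_integral_eq_integral F'2i AE_I2 sum_nonneg) auto
    finally show ?thesis using C0 by (simp add: ennreal_mult' less_imp_le)
  qed
  have [measurable]: "bdry_dist d \<Omega> \<in> borel_measurable (lebm d)" "F n \<in> borel_measurable (lebm d)" for n
    unfolding F_def by (intro borel_measurable_lebm_continuous \<rho> continuous_mollify[OF B(1) fi])+
  have "(\<integral>\<^sup>+x. ennreal ((f x / bdry_dist d \<Omega> x)\<^sup>2) \<partial>lebm d)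
      = (\<integral>\<^sup>+x. liminf (\<lambda>n. ennreal ((F n x / bdry_dist d \<Omega> x)\<^sup>2)) \<partial>lebm d)"
  proof (rule nn_integral_cong)
    fix x assume "x \<in> space (lebm d)"
    then have "(\<lambda>n. F n x) \<longlonglongrightarrow> f x"
      unfolding F_def by (intro mollify_tendsto[OF B(1,2) fi f(1)]) (simp add: space_lebm)
    then have "(\<lambda>n. (F n x / bdry_dist d \<Omega> x)\<^sup>2) \<longlonglongrightarrow> (f x / bdry_dist d \<Omega> x)\<^sup>2"
      unfolding divide_inverse by (intro tendsto_intros)
    then have "(\<lambda>n. ennreal ((F n x / bdry_dist d \<Omega> x)\<^sup>2)) \<longlonglongrightarrow> ennreal ((f x / bdry_dist d \<Omega> x)\<^sup>2)"
      by (rule tendsto_ennrealI)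
    from lim_imp_Liminf[OF _ this] show "ennreal ((f x / bdry_dist d \<Omega> x)\<^sup>2)
        = liminf (\<lambda>n. ennreal ((F n x / bdry_dist d \<Omega> x)\<^sup>2))" by simp
  qed
  also have "\<dots> \<le> liminf (\<lambda>n. \<integral>\<^sup>+x. ennreal ((F n x / bdry_dist d \<Omega> x)\<^sup>2) \<partial>lebm d)"
    by (rule nn_integral_liminf) measurable
  also have "\<dots> \<le> liminf (\<lambda>n. ennreal (C0 * (\<integral>x. (\<Sum>i<d. (F' n i x)\<^sup>2) \<partial>lebm d)))"
    by (intro Liminf_mono always_eventually allI le)
  also have "\<dots> = ennreal (C0 * (\<integral>x. (\<Sum>i<d. (f' i x)\<^sup>2) \<partial>lebm d))"
    by (intro lim_imp_Liminf tendsto_ennrealI tendsto_mult tendsto_const lim) simp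
  finally show ?thesis .
qed

text \<open>As a function of \<open>y\<close>, the kernel centred at \<open>x\<close> is a
  nonnegative test function supported in \<open>K'\<close>. Testing superharmonicity with it yields
  the Laplacian of the mollification at \<open>x\<close>, because second derivatives in
  \<open>x\<close> and in \<open>y\<close> agree.\<close>

lemma mollify_superharmonic:
  assumes sh: "superharmonic d \<Omega> \<phi>" and \<Omega>: "openin (Rd d) \<Omega>"
    and K': "compact K'" "K' \<subseteq> \<Omega>"
    and g: "integrable (lebm d) g" "AE x in lebm d. g x = indicator K' x * \<phi> x"
    and B: "mollifier_family r B"
    and x: "\<And>y. y \<in> topspace (Rd d) \<Longrightarrow> (\<forall>j<d. \<bar>x j - y j\<bar> < r) \<Longrightarrow> y \<in> K'"
  shows "(\<Sum>i<d. mollify d B g ((\<lambda>_. 0)(i := 2)) x) \<le> 0"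
proof -
  have \<Omega>t: "\<Omega> \<subseteq> topspace (Rd d)" by (rule openin_subset[OF \<Omega>])
  have K't: "K' \<subseteq> topspace (Rd d)" using K'(2) \<Omega>t by blast
  \<comment> \<open>The alternating signs make differentiation in \<open>y\<close> a mere index
    shift; at order \<open>2\<close> in one coordinate they have disappeared.\<close>
  define z where "z ks y = (\<Prod>j<d. (-1) ^ ks j * B (ks j) (x j - y j))" for ks and y :: "nat \<Rightarrow> real"
  have dz: "has_partial i (z ks) y (z (ks(i := Suc (ks i))) y)" if "i < d" for i ks y
    unfolding z_def
  proof (rule has_partial_prod[where F = "\<lambda>j k s. (-1) ^ k * B k (x j - s)", OF _ that])
    fix j k s
    have "((\<lambda>s. B k (x j - s)) has_real_derivative B (Suc k) (x j - s) * (-1)) (at s)"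
      by (rule DERIV_chain2[OF mollifier_familyD(1)[OF B]]) (auto intro!: derivative_eq_intros)
    from DERIV_cmult[OF this, of "(-1) ^ k"]
    show "((\<lambda>s. (-1) ^ k * B k (x j - s)) has_real_derivative (-1) ^ Suc k * B (Suc k) (x j - s)) (at s)"
      by simp
  qed
  have cz: "continuous_on UNIV (z ks)" for ks
    unfolding z_def
    by (intro continuous_on_prod_coordinates continuous_intros
        continuous_on_compose2[OF mollifier_familyD(5)[OF B, of UNIV]]) auto
  have z0: "z ks y = 0" if "y \<in> topspace (Rd d)" "y \<notin> K'" for ks y
  proof -
    have "\<exists>j<d. r \<le> \<bar>x j - y j\<bar>" using x[OF that(1)] that(2) by (force simp: not_less)
    then obtain j where "j < d" "r \<le> \<bar>x j - y j\<bar>" by blast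
    then have "(\<Prod>j<d. B (ks j) (x j - y j)) = 0" by (rule kernel_eq_0[OF B])
    then show ?thesis by (simp add: z_def prod.distrib)
  qed
  have "C_on d k \<Omega> (z (\<lambda>_. 0))" for k
    by (rule C_on_family[where P = "range z"]) (use cz dz in \<open>blast+\<close>)
  then have "z (\<lambda>_. 0) \<in> test_functions d \<Omega>"
    using K' K't \<Omega>t z0 unfolding test_functions_def
    by (auto intro!: compactly_supported_inI[of K'])
  moreover have "\<forall>y\<in>\<Omega>. 0 \<le> z (\<lambda>_. 0) y" by (auto simp: z_def intro!: kernel_nonneg[OF B])
  ultimately have le: "(LINT y:\<Omega>|leb d. \<phi> y * laplacian d (z (\<lambda>_. 0)) y) \<le> 0"
    using sh by (simp add: superharmonic_def)
  define w where "w y = (\<Sum>i<d. z ((\<lambda>_. 0)(i := 2)) y)" for y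
  have lap: "laplacian d (z (\<lambda>_. 0)) y = w y" for y
    unfolding laplacian_def w_def
  proof (rule sum.cong[OF refl])
    fix i assume "i \<in> {..<d}"
    then have i: "i < d" by simp
    have "partial i (z ks) = z (ks(i := Suc (ks i)))" for ks
      using has_partial_imp_partial[OF dz[OF i]] by blast
    then show "partial i (partial i (z (\<lambda>_. 0))) y = z ((\<lambda>_. 0)(i := 2)) y"
      by (simp add: numeral_2_eq_2)
  qed
  have w: "continuous_on UNIV w" unfolding w_def by (intro continuous_intros cz)
  have [measurable]: "w \<in> borel_measurable (lebm d)" by (rule borel_measurable_lebm_continuous[OF w])
  have [measurable]: "g \<in> borel_measurable (lebm d)" using g(1) by auto
  have w0: "w y = 0" if "y \<in> topspace (Rd d)" "y \<notin> K'" for y using z0[OF that] by (simp add: w_def)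
  have "compactin (Rd d) K'" using K' K't by (simp add: compactin_Rd_iff)
  then have "set_integrable (leb d) K' \<phi>"
    using sh K'(2) by (simp add: superharmonic_def locally_integrable_def)
  then have m: "(\<lambda>y. indicator K' y * \<phi> y) \<in> borel_measurable (completion (lebm d))"
    by (auto simp: set_integrable_def leb_def dest: borel_measurable_integrable)
  have wm: "w \<in> borel_measurable (completion (lebm d))" "g \<in> borel_measurable (completion (lebm d))"
    by (intro measurable_completion; measurable)+
  \<comment> \<open>Local integrability makes \<phi> measurable for the completed measure. Replacing
    it almost everywhere by \<open>g\<close> allows the return to the product measure.\<close>
  have "(LINT y:\<Omega>|leb d. \<phi> y * laplacian d (z (\<lambda>_. 0)) y) = (\<integral>y. (indicator K' y * \<phi> y) * w y \<partial>leb d)"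
    unfolding set_lebesgue_integral_def
  proof (rule Bochner_Integration.integral_cong[OF refl])
    fix y assume "y \<in> space (leb d)"
    then have "y \<in> topspace (Rd d)" by (simp add: space_leb)
    then show "indicator \<Omega> y *\<^sub>R (\<phi> y * laplacian d (z (\<lambda>_. 0)) y) = (indicator K' y * \<phi> y) * w y"
      using w0[of y] K'(2) by (auto simp: lap indicator_def)
  qed
  also have "\<dots> = (\<integral>y. g y * w y \<partial>leb d)"
    unfolding leb_def
    by (rule integral_cong_AE) (use m wm AE_completion[OF g(2)] in auto)
  also have "\<dots> = (\<integral>y. g y * w y \<partial>lebm d)"
    unfolding leb_def by (rule integral_completion) measurable
  also have "\<dots> = (\<Sum>i<d. mollify d B g ((\<lambda>_. 0)(i := 2)) x)"
  proof -
    have "z ((\<lambda>_. 0)(i := 2)) y = (\<Prod>j<d. B (((\<lambda>_. 0)(i := 2)) j) (x j - y j))" for i y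
      unfolding z_def by (intro prod.cong) auto
    then have "(\<integral>y. g y * w y \<partial>lebm d) = (\<integral>y. (\<Sum>i<d. g y * (\<Prod>j<d. B (((\<lambda>_. 0)(i := 2)) j) (x j - y j))) \<partial>lebm d)"
      by (simp add: w_def sum_distrib_left)
    also have "\<dots> = (\<Sum>i<d. mollify d B g ((\<lambda>_. 0)(i := 2)) x)"
      unfolding mollify_def by (intro Bochner_Integration.integral_sum integrable_kernel[OF B g(1)])
    finally show ?thesis .
  qed
  finally show ?thesis using le by simp
qed

section \<open>Truncated powers\<close>

definition cut_powr :: "real \<Rightarrow> real \<Rightarrow> real \<Rightarrow> real" where
  "cut_powr e a s = max 0 (s - e) powr a"

lemma cut_powr_eq_0: "s \<le> e \<Longrightarrow> cut_powr e a s = 0"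
  by (simp add: cut_powr_def)

lemma has_derivative_cut_powr:
  assumes a: "1 < a"
  shows "(cut_powr e a has_real_derivative a * cut_powr e (a - 1) s) (at s)"
proof -
  consider "s > e" | "s = e" | "s < e" by linarith
  then show ?thesis
  proof cases
    case 1
    have ev: "\<forall>\<^sub>F t in nhds s. t \<in> {e<..}" using 1 by (intro eventually_nhds_in_open) auto
    have "((\<lambda>t. (t - e) powr a) has_real_derivative a * (s - e) powr (a - 1)) (at s)"
      using 1 by (auto intro!: derivative_eq_intros)
    moreover have "\<forall>\<^sub>F t in nhds s. cut_powr e a t = (t - e) powr a"
      using ev by eventually_elim (simp add: cut_powr_def max_def)
    ultimately show ?thesis
      using 1 by (subst DERIV_cong_ev[OF refl _ refl]) (simp_all add: cut_powr_def max_def)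
  next
    case 2
    have "(cut_powr e a has_real_derivative 0) (at s)"
      by (rule has_derivative_zero_if_superlinear[OF a, where C = 1])
         (use 2 a in \<open>auto simp: cut_powr_def max_def intro!: powr_mono2\<close>)
    then show ?thesis using 2 by (simp add: cut_powr_def)
  next
    case 3
    have "\<forall>\<^sub>F t in nhds s. t \<in> {..<e}" using 3 by (intro eventually_nhds_in_open) auto
    then have ev: "\<forall>\<^sub>F t in nhds s. cut_powr e a t = 0" by eventually_elim (simp add: cut_powr_def)
    have "(cut_powr e a has_real_derivative 0) (at s)"
      by (rule DERIV_cong_ev[OF refl ev refl, THEN iffD2]) simp
    then show ?thesis using 3 by (simp add: cut_powr_def)
  qed
qed

text \<open>The factor \<open>k\<close> contains a negative power of \<open>s\<close> in the
  applications and may be singular at \<open>0\<close>. Below \<open>e\<close> the product is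
  identically zero, and the half-lines \<open>s > 0\<close> and \<open>s < e\<close>
  overlap.\<close>

lemma has_derivative_cut_powr_mult:
  assumes a: "1 < a" and e: "0 < e"
    and k: "\<And>s. 0 < s \<Longrightarrow> (k has_real_derivative k' s) (at s)"
  shows "((\<lambda>s. cut_powr e a s * k s) has_real_derivative
      a * cut_powr e (a - 1) s * k s + cut_powr e a s * k' s) (at s)"
proof (cases "0 < s")
  case True
  then show ?thesis
    using DERIV_mult[OF has_derivative_cut_powr[OF a] k] by (simp add: algebra_simps)
next
  case False
  then have s: "s < e" using e by simp
  have "\<forall>\<^sub>F t in nhds s. t \<in> {..<e}" using s by (intro eventually_nhds_in_open) auto
  then have ev: "\<forall>\<^sub>F t in nhds s. cut_powr e a t * k t = 0" by eventually_elim (simp add: cut_powr_def)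
  have "((\<lambda>s. cut_powr e a s * k s) has_real_derivative 0) (at s)"
    by (rule DERIV_cong_ev[OF refl ev refl, THEN iffD2]) simp
  then show ?thesis using s by (simp add: cut_powr_def)
qed

lemma continuous_cut_powr_mult:
  assumes a: "0 < a" and e: "0 < e" and k: "continuous_on {0<..} k"
  shows "continuous_on UNIV (\<lambda>s. cut_powr e a s * k s)"
proof -
  have "continuous_on UNIV (cut_powr e a)"
    unfolding cut_powr_def using a by (intro continuous_on_powr' continuous_intros) auto
  then have 1: "continuous_on {0<..} (\<lambda>s. cut_powr e a s * k s)"
    using k by (auto intro: continuous_on_mult continuous_on_subset)
  have 2: "continuous_on {..<e} (\<lambda>s. cut_powr e a s * k s)"
    by (rule continuous_on_eq[OF continuous_on_const[of _ 0]]) (simp add: cut_powr_def)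
  have "UNIV = {0<..} \<union> {..<e}" using e by auto
  then show ?thesis using continuous_on_open_Un[OF _ _ 1 2] by simp
qed

lemma cut_powr_add: "cut_powr e (a + b) s = cut_powr e a s * cut_powr e b s"
  by (simp add: cut_powr_def powr_add)

lemma cut_powr_1: "s > e \<Longrightarrow> cut_powr e 1 s = s - e"
  by (simp add: cut_powr_def)

text \<open>
  \<open>cut_H\<close> is \<open>W powr p / p\<close> for the convex function \<open>W s = (s - e)\<^sup>2 / s\<close> (cut off at \<open>s = e\<close>)
  and \<open>cut_G\<close> is \<open>W powr (p / 2)\<close>; convexity of \<open>W\<close> is what makes \<open>(p - 1) * h\<^sup>2 \<le> p * H * h'\<close> hold
  with the same constant as for the pure power \<open>H s = s powr p / p\<close>.
\<close>

definition cut_H :: "real \<Rightarrow> real \<Rightarrow> real \<Rightarrow> real" where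
  "cut_H p e s = cut_powr e (2 * p) s * (s powr (- p) / p)"

text \<open>Here \<open>W' = (s - e) * (s + e) / s ^ 2\<close>, and the formula is
  \<open>W powr (p - 1) * W'\<close>.\<close>

definition cut_h :: "real \<Rightarrow> real \<Rightarrow> real \<Rightarrow> real" where
  "cut_h p e s = cut_powr e (2 * p - 1) s * (s powr (- p - 1) * (s + e))"

text \<open>The summands are \<open>(p - 1) * W powr (p - 2) * W' ^ 2\<close> and
  \<open>W powr (p - 1) * W''\<close> with \<open>W'' = 2 * e ^ 2 / s ^ 3\<close>. The double zero
  of \<open>W\<close> leaves the power \<open>2 * p - 2 > 0\<close>, hence continuity at
  \<open>e\<close>; the simple truncation \<open>(s - e) powr p\<close> would have a second
  derivative unbounded near \<open>e\<close> when \<open>p < 2\<close>.\<close>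

definition cut_h' :: "real \<Rightarrow> real \<Rightarrow> real \<Rightarrow> real" where
  "cut_h' p e s = cut_powr e (2 * p - 2) s * (s powr (- p - 2) * ((p - 1) * (s + e)\<^sup>2 + 2 * e\<^sup>2))"

definition cut_G :: "real \<Rightarrow> real \<Rightarrow> real \<Rightarrow> real" where
  "cut_G p e s = cut_powr e p s * s powr (- p / 2)"

definition cut_G' :: "real \<Rightarrow> real \<Rightarrow> real \<Rightarrow> real" where
  "cut_G' p e s = cut_powr e (p - 1) s * (p / 2 * s powr (- p / 2 - 1) * (s + e))"

lemmas cut_defs = cut_H_def cut_h_def cut_h'_def cut_G_def cut_G'_def

lemma cut_eq_0:
  assumes "s \<le> e"
  shows "cut_H p e s = 0" "cut_h p e s = 0" "cut_h' p e s = 0" "cut_G p e s = 0" "cut_G' p e s = 0"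
  using cut_powr_eq_0[OF assms] by (auto simp: cut_defs)

lemma powr_diff_1: "0 < s \<Longrightarrow> s powr b = s powr (b - 1) * (s::real)"
  using powr_add[of s "b - 1" 1] by simp

lemma cut_derivatives:
  assumes p: "1 < p" and e: "0 < e"
  shows "(cut_H p e has_real_derivative cut_h p e s) (at s)"
    "(cut_h p e has_real_derivative cut_h' p e s) (at s)"
    "(cut_G p e has_real_derivative cut_G' p e s) (at s)"
proof -
  have c1: "cut_powr e (a + 1) s = cut_powr e a s * (s - e)" for a
    by (cases "s > e") (simp_all add: cut_powr_add cut_powr_1 cut_powr_eq_0)
  show "(cut_H p e has_real_derivative cut_h p e s) (at s)"
  proof -
    have "(cut_H p e has_real_derivative 2 * p * cut_powr e (2 * p - 1) s * (s powr (- p) / p)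
        + cut_powr e (2 * p) s * (- p * s powr (- p - 1) / p)) (at s)"
      unfolding cut_H_def[abs_def] using p
      by (intro has_derivative_cut_powr_mult e DERIV_cdivide has_real_derivative_powr) auto
    also have "2 * p * cut_powr e (2 * p - 1) s * (s powr (- p) / p)
        + cut_powr e (2 * p) s * (- p * s powr (- p - 1) / p) = cut_h p e s"
    proof (cases "s > e")
      case True
      define A where "A = cut_powr e (2 * p - 1) s"
      define S where "S = s powr (- p - 1)"
      have f1: "cut_powr e (2 * p) s = A * (s - e)" using c1[of "2 * p - 1"] by (simp add: A_def)
      have f2: "s powr (- p) = S * s" using powr_diff_1[of s "- p"] True e by (simp add: S_def)
      have f3: "cut_h p e s = A * (S * (s + e))" by (simp add: cut_h_def A_def S_def)
      show ?thesis
        unfolding f1 f2 f3 unfolding A_def[symmetric] S_def[symmetric] using p by (simp add: field_simps)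
    qed (simp add: cut_h_def cut_powr_eq_0)
    finally show ?thesis .
  qed
  show "(cut_h p e has_real_derivative cut_h' p e s) (at s)"
  proof -
    have "(cut_h p e has_real_derivative (2 * p - 1) * cut_powr e (2 * p - 1 - 1) s * (s powr (- p - 1) * (s + e))
        + cut_powr e (2 * p - 1) s * ((- p - 1) * s powr (- p - 1 - 1) * (s + e) + s powr (- p - 1))) (at s)"
      unfolding cut_h_def[abs_def]
    proof (rule has_derivative_cut_powr_mult[OF _ e])
      show "((\<lambda>s. s powr (- p - 1) * (s + e)) has_real_derivative
          (- p - 1) * s powr (- p - 1 - 1) * (s + e) + s powr (- p - 1)) (at s)" if "0 < s" for s
      proof -
        have "((\<lambda>s. s + e) has_real_derivative 1) (at s)" by (auto intro!: derivative_eq_intros)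
        from DERIV_mult[OF has_real_derivative_powr[OF that, of "- p - 1"] this] show ?thesis by simp
      qed
    qed (use p in simp)
    also have "(2 * p - 1) * cut_powr e (2 * p - 1 - 1) s * (s powr (- p - 1) * (s + e))
        + cut_powr e (2 * p - 1) s * ((- p - 1) * s powr (- p - 1 - 1) * (s + e) + s powr (- p - 1)) = cut_h' p e s"
    proof (cases "s > e")
      case True
      define A where "A = cut_powr e (2 * p - 2) s"
      define S where "S = s powr (- p - 2)"
      have f1: "cut_powr e (2 * p - 1) s = A * (s - e)" using c1[of "2 * p - 2"] by (simp add: A_def)
      have S: "s powr (- p - 1 - 1) = S"
      proof -
        have "- p - 1 - 1 = - p - 2" by simp
        then show ?thesis unfolding S_def by (rule arg_cong)
      qed
      have f2: "s powr (- p - 1) = S * s" using powr_diff_1[of s "- p - 1"] True e unfolding S by simp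
      have f3: "cut_powr e (2 * p - 1 - 1) s = A" by (simp add: A_def)
      have f4: "cut_h' p e s = A * (S * ((p - 1) * (s + e)\<^sup>2 + 2 * e\<^sup>2))" by (simp add: cut_h'_def A_def S_def)
      show ?thesis unfolding f1 f2 f3 f4 S by (simp add: algebra_simps power2_eq_square)
    qed (simp add: cut_h'_def cut_powr_eq_0)
    finally show ?thesis .
  qed
  show "(cut_G p e has_real_derivative cut_G' p e s) (at s)"
  proof -
    have "(cut_G p e has_real_derivative p * cut_powr e (p - 1) s * s powr (- p / 2)
        + cut_powr e p s * (- p / 2 * s powr (- p / 2 - 1))) (at s)"
      unfolding cut_G_def[abs_def]
      by (rule has_derivative_cut_powr_mult[where k = "\<lambda>s. s powr (- p / 2)"
            and k' = "\<lambda>s. - p / 2 * s powr (- p / 2 - 1)", OF p e has_real_derivative_powr])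
    also have "p * cut_powr e (p - 1) s * s powr (- p / 2)
        + cut_powr e p s * (- p / 2 * s powr (- p / 2 - 1)) = cut_G' p e s"
    proof (cases "s > e")
      case True
      define A where "A = cut_powr e (p - 1) s"
      define S where "S = s powr (- p / 2 - 1)"
      have f1: "cut_powr e p s = A * (s - e)" using c1[of "p - 1"] by (simp add: A_def)
      have f2: "s powr (- p / 2) = S * s" using powr_diff_1[of s "- p / 2"] True e by (simp add: S_def)
      have f3: "cut_G' p e s = A * (p / 2 * S * (s + e))" by (simp add: cut_G'_def A_def S_def)
      show ?thesis
        unfolding f1 f2 f3 unfolding A_def[symmetric] S_def[symmetric] by (simp add: field_simps)
    qed (simp add: cut_G'_def cut_powr_eq_0)
    finally show ?thesis .
  qed
qed

lemma cut_continuous: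
  assumes p: "1 < p" and e: "0 < e"
  shows "continuous_on UNIV (cut_H p e)" "continuous_on UNIV (cut_h p e)" "continuous_on UNIV (cut_h' p e)"
    "continuous_on UNIV (cut_G p e)" "continuous_on UNIV (cut_G' p e)"
proof -
  have c: "continuous_on {0<..} (\<lambda>s::real. s powr b)" for b
    by (intro continuous_on_powr continuous_on_id continuous_on_const) auto
  have "continuous_on {0<..} (\<lambda>s. s powr (- p) / p)"
    "continuous_on {0<..} (\<lambda>s. s powr (- p - 1) * (s + e))"
    "continuous_on {0<..} (\<lambda>s. s powr (- p - 2) * ((p - 1) * (s + e)\<^sup>2 + 2 * e\<^sup>2))"
    "continuous_on {0<..} (\<lambda>s. s powr (- p / 2))"
    "continuous_on {0<..} (\<lambda>s. p / 2 * s powr (- p / 2 - 1) * (s + e))"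
    using p by (intro c continuous_on_mult continuous_on_divide continuous_on_add continuous_on_power
        continuous_on_id continuous_on_const; simp)+
  note k = this
  show "continuous_on UNIV (cut_H p e)"
    unfolding cut_H_def[abs_def] by (rule continuous_cut_powr_mult[OF _ e k(1)]) (use p in simp)
  show "continuous_on UNIV (cut_h p e)"
    unfolding cut_h_def[abs_def] by (rule continuous_cut_powr_mult[OF _ e k(2)]) (use p in simp)
  show "continuous_on UNIV (cut_h' p e)"
    unfolding cut_h'_def[abs_def] by (rule continuous_cut_powr_mult[OF _ e k(3)]) (use p in simp)
  show "continuous_on UNIV (cut_G p e)"
    unfolding cut_G_def[abs_def] by (rule continuous_cut_powr_mult[OF _ e k(4)]) (use p in simp)
  show "continuous_on UNIV (cut_G' p e)"
    unfolding cut_G'_def[abs_def] by (rule continuous_cut_powr_mult[OF _ e k(5)]) (use p in simp)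
qed

text \<open>In terms of \<open>W\<close>, the difference \<open>p * H * h' - (p - 1) * h ^ 2\<close>
  is \<open>W powr (2 * p - 1) * W''\<close>, and \<open>G' ^ 2\<close> is
  \<open>p ^ 2 / (4 * (p - 1))\<close> times the first summand of \<open>h'\<close>. The bound on
  \<open>h\<close> reflects \<open>0 \<le> W \<le> s\<close> and \<open>W' \<le> 1\<close> for
  \<open>s > e\<close>.\<close>

lemma cut_inequalities:
  assumes p: "1 < p" and e: "0 < e"
  shows "0 \<le> cut_H p e s" (is ?P1) and "0 \<le> cut_h p e s" (is ?P2) and "0 \<le> cut_h' p e s" (is ?P3)
    and "(cut_G p e s)\<^sup>2 = p * cut_H p e s" (is ?P4)
    and "(cut_G' p e s)\<^sup>2 \<le> p\<^sup>2 / (4 * (p - 1)) * cut_h' p e s" (is ?P5)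
    and "(p - 1) * (cut_h p e s)\<^sup>2 \<le> p * cut_H p e s * cut_h' p e s" (is ?P6)
    and "cut_h p e s \<le> s powr (p - 1)" (is ?P7)
proof -
  have "?P1 \<and> ?P2 \<and> ?P3 \<and> ?P4 \<and> ?P5 \<and> ?P6 \<and> ?P7"
  proof (cases "s \<le> e")
    case True
    then show ?thesis by (simp add: cut_eq_0)
  next
    case 2: False
    then have s: "s > 0" using e by simp
    define t where "t = s - e"
    have t: "t > 0" "t \<le> s" using 2 e by (auto simp: t_def)
    have T: "cut_powr e a s = t powr a" for a using 2 by (simp add: cut_powr_def t_def)
    have sq: "(r powr a)\<^sup>2 = r powr (2 * a)" for r a :: real by (simp add: power2_eq_square flip: powr_add)
    have nn: "0 \<le> cut_H p e s" "0 \<le> cut_h p e s" "0 \<le> cut_h' p e s"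
      using p e s by (auto simp: cut_defs T)
    have GH: "(cut_G p e s)\<^sup>2 = p * cut_H p e s"
      using p by (simp add: cut_defs T power_mult_distrib sq)
    have G': "(cut_G' p e s)\<^sup>2 \<le> p\<^sup>2 / (4 * (p - 1)) * cut_h' p e s"
    proof -
      have "(cut_G' p e s)\<^sup>2 = t powr (2 * p - 2) * ((p / 2)\<^sup>2 * s powr (- p - 2) * (s + e)\<^sup>2)"
      proof -
        have "(s powr (- p / 2 - 1))\<^sup>2 = s powr (- p - 2)" unfolding sq by (simp add: algebra_simps)
        moreover have "(t powr (p - 1))\<^sup>2 = t powr (2 * p - 2)" unfolding sq by (simp add: algebra_simps)
        ultimately show ?thesis unfolding cut_G'_def T power_mult_distrib by simp
      qed
      also have "\<dots> = p\<^sup>2 / (4 * (p - 1)) * (t powr (2 * p - 2) * (s powr (- p - 2) * ((p - 1) * (s + e)\<^sup>2)))"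
        using p by (auto simp: power_divide divide_simps; simp add: algebra_simps)
      also have "\<dots> \<le> p\<^sup>2 / (4 * (p - 1)) * cut_h' p e s"
        unfolding cut_h'_def T using p by (intro mult_left_mono) auto
      finally show ?thesis .
    qed
    have hH: "(p - 1) * (cut_h p e s)\<^sup>2 \<le> p * cut_H p e s * cut_h' p e s"
    proof -
      have "(p - 1) * (cut_h p e s)\<^sup>2 = t powr (2 * (2 * p - 1)) * s powr (2 * (- p - 1)) * ((p - 1) * (s + e)\<^sup>2)"
        by (simp add: cut_defs T power_mult_distrib sq mult_ac)
      also have "\<dots> \<le> t powr (2 * (2 * p - 1)) * s powr (2 * (- p - 1)) * ((p - 1) * (s + e)\<^sup>2 + 2 * e\<^sup>2)"
        by (intro mult_left_mono) auto
      also have "t powr (2 * (2 * p - 1)) = t powr (2 * p) * t powr (2 * p - 2)"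
        by (simp flip: powr_add)
      also have "s powr (2 * (- p - 1)) = s powr (- p) * s powr (- p - 2)"
        by (simp flip: powr_add)
      also have "t powr (2 * p) * t powr (2 * p - 2) * (s powr (- p) * s powr (- p - 2)) * ((p - 1) * (s + e)\<^sup>2 + 2 * e\<^sup>2)
          = p * cut_H p e s * cut_h' p e s"
        using p by (simp add: cut_defs T)
      finally show ?thesis .
    qed
    have h: "cut_h p e s \<le> s powr (p - 1)"
    proof -
      have "t * (s + e) \<le> s\<^sup>2" using e by (simp add: t_def algebra_simps power2_eq_square)
      moreover have "t powr (2 * p - 2) \<le> s powr (2 * p - 2)" using t p by (intro powr_mono2) auto
      ultimately have "t powr (2 * p - 2) * (t * (s + e)) \<le> s powr (2 * p - 2) * s\<^sup>2"
        using t s e by (intro mult_mono) auto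
      also have "t powr (2 * p - 2) * (t * (s + e)) = t powr (2 * p - 1) * (s + e)"
        using powr_diff_1[OF t(1), of "2 * p - 1"] by simp
      also have "s powr (2 * p - 2) * s\<^sup>2 = s powr (2 * p)"
        using powr_add[of s "2 * p - 2" 2] s by simp
      finally have "t powr (2 * p - 1) * (s + e) * s powr (- p - 1) \<le> s powr (2 * p) * s powr (- p - 1)"
        by (intro mult_right_mono) auto
      also have "s powr (2 * p) * s powr (- p - 1) = s powr (p - 1)" by (simp flip: powr_add)
      finally show ?thesis by (simp add: cut_defs T mult_ac)
    qed
    show ?thesis using nn GH G' hH h by blast
  qed
  then show ?P1 ?P2 ?P3 ?P4 ?P5 ?P6 ?P7 by blast+
qed

lemma cut_G_tendsto:
  assumes p: "1 < p" and s: "0 \<le> s" and e: "e \<longlonglongrightarrow> 0" "\<And>n. 0 < e n"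
  shows "(\<lambda>n. (cut_G p (e n) s)\<^sup>2) \<longlonglongrightarrow> s powr p"
proof (cases "s = 0")
  case True
  then show ?thesis using e(2) by (simp add: cut_eq_0 less_imp_le)
next
  case False
  then have s: "s > 0" using s by simp
  have "(\<lambda>n. (max 0 (s - e n) powr p * s powr (- p / 2))\<^sup>2) \<longlonglongrightarrow> (max 0 (s - 0) powr p * s powr (- p / 2))\<^sup>2"
    using s by (intro tendsto_intros e) auto
  also have "(max 0 (s - 0) powr p * s powr (- p / 2))\<^sup>2 = s powr p"
    using s by (simp add: power2_eq_square max_def flip: powr_add)
  finally show ?thesis by (simp add: cut_G_def cut_powr_def)
qed

section \<open>Scalar Young inequalities\<close>

text \<open>A binary quadratic form with nonnegative diagonal and nonpositive discriminant is
  nonnegative.\<close>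

lemma amgm_quadratic:
  fixes X Y h :: real
  assumes "0 \<le> X" "0 \<le> Y" "h\<^sup>2 \<le> 4 * X * Y"
  shows "h * \<alpha> * \<beta> \<le> X * \<alpha>\<^sup>2 + Y * \<beta>\<^sup>2"
proof (cases "X = 0")
  case True
  then show ?thesis using assms by simp
next
  case False
  then have X: "X > 0" using assms(1) by simp
  have "0 \<le> (2 * X * \<alpha> - h * \<beta>)\<^sup>2" by simp
  also have "\<dots> = 4 * X * (X * \<alpha>\<^sup>2 - h * \<alpha> * \<beta>) + h\<^sup>2 * \<beta>\<^sup>2"
    by (simp add: power2_eq_square algebra_simps)
  also have "\<dots> \<le> 4 * X * (X * \<alpha>\<^sup>2 - h * \<alpha> * \<beta>) + (4 * X * Y) * \<beta>\<^sup>2"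
    using assms(3) by (intro add_left_mono mult_right_mono) auto
  also have "\<dots> = 4 * X * (X * \<alpha>\<^sup>2 + Y * \<beta>\<^sup>2 - h * \<alpha> * \<beta>)" by (simp add: algebra_simps)
  finally show ?thesis using X by (simp add: zero_le_mult_iff)
qed

text \<open>One summand alone suffices: the first if \<open>b \<le> \<epsilon> * a\<close>, the
  second otherwise. This crude form of Young's inequality has a constant with a simple closed
  form.\<close>

lemma young_powr:
  fixes a b \<epsilon> p :: real
  assumes p: "1 < p" and \<epsilon>: "0 < \<epsilon>" and ab: "0 \<le> a" "0 \<le> b"
  shows "a powr (p - 1) * b \<le> \<epsilon> * a powr p + (1 / \<epsilon>) powr (p - 1) * b powr p"
proof (cases "b \<le> \<epsilon> * a")
  case True
  have "a powr (p - 1) * b \<le> a powr (p - 1) * (\<epsilon> * a)" using True by (intro mult_left_mono) auto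
  also have "\<dots> = \<epsilon> * a powr p" using powr_diff_1[of a p] ab(1) by (cases "a = 0") auto
  finally show ?thesis by (smt (verit) mult_nonneg_nonneg powr_ge_zero)
next
  case False
  then have b: "0 < b" using \<epsilon> ab by (smt (verit) mult_nonneg_nonneg)
  have "a \<le> 1 / \<epsilon> * b" using False \<epsilon> by (simp add: field_simps)
  then have "a powr (p - 1) \<le> (1 / \<epsilon> * b) powr (p - 1)" using p ab by (intro powr_mono2) auto
  then have "a powr (p - 1) * b \<le> (1 / \<epsilon> * b) powr (p - 1) * b" using b by (intro mult_right_mono) auto
  also have "\<dots> = (1 / \<epsilon>) powr (p - 1) * b powr p"
    using powr_diff_1[OF b, of p] \<epsilon> b powr_mult[of "1 / \<epsilon>" b "p - 1"] by simp
  finally show ?thesis using \<epsilon> by (smt (verit) mult_nonneg_nonneg powr_ge_zero)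
qed

section \<open>The energy estimate for a smooth weight\<close>

text \<open>The share of \<open>A\<close> that survives in \<open>A + c * D\<close>: for
  \<open>c \<ge> 0\<close> the second term helps, for \<open>c < 0\<close> it costs at most
  \<open>- c * p / ((p - 1) * (1 - c))\<close> times \<open>A\<close>.\<close>

definition ellipticity :: "real \<Rightarrow> real \<Rightarrow> real" where
  "ellipticity p c = (if 0 \<le> c then 1 else 1 + c * (p / (p - 1)) / (1 - c))"

text \<open>\<open>C0\<close> comes from Hardy's inequality. The bracket bounds the squared gradient
  of the function inserted there: a factor \<open>2\<close> from \<open>(\<alpha> + \<beta>) ^ 2
  \<le> 2 * \<alpha> ^ 2 + 2 * \<beta> ^ 2\<close>, then \<open>p ^ 2 / (4 * (p - 1))\<close> from
  \<open>cut_G'\<close>, and \<open>(c / 2) ^ 2 * p\<close> together with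
  \<open>B \<le> p / (p - 1) / (1 - c) ^ 2 * A\<close> from the weight. Dividing by
  \<open>ellipticity\<close> passes from \<open>A\<close> to the source term.\<close>

definition energy_const :: "real \<Rightarrow> real \<Rightarrow> real \<Rightarrow> real" where
  "energy_const p c C0 =
     C0 * (p\<^sup>2 / (2 * (p - 1)) + c\<^sup>2 * p / 2 * (p / (p - 1) / (1 - c)\<^sup>2)) / ellipticity p c"

text \<open>For \<open>c < 0\<close> the numerator collapses:
  \<open>(p - 1) * (1 - c) + c * p = p - 1 + c\<close>. The lower bound on \<open>c\<close> enters
  here.\<close>

lemma ellipticity_pos:
  assumes "1 < p" "- p + 1 < c" "c < 1"
  shows "0 < ellipticity p c"
proof (cases "0 \<le> c")
  case False
  have "0 < (p - 1) * (1 - c) + c * p" using assms by (simp add: algebra_simps)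
  then have "0 < ((p - 1) * (1 - c) + c * p) / ((p - 1) * (1 - c))" using assms by simp
  also have "\<dots> = ellipticity p c" using False assms by (simp add: ellipticity_def add_divide_distrib)
  finally show ?thesis .
qed (simp add: ellipticity_def)

lemma energy_const_pos:
  assumes "1 < p" "- p + 1 < c" "c < 1" "0 < C0"
  shows "0 < energy_const p c C0"
proof -
  have "0 < p\<^sup>2 / (2 * (p - 1)) + c\<^sup>2 * p / 2 * (p / (p - 1) / (1 - c)\<^sup>2)"
    using assms by (intro add_pos_nonneg divide_pos_pos mult_nonneg_nonneg divide_nonneg_nonneg) auto
  then show ?thesis
    unfolding energy_const_def using assms ellipticity_pos[OF assms(1-3)] by simp
qed

text \<open>
  \<open>v\<close> stands for \<open>\<bar>u\<bar>\<close> extended by \<open>0\<close>; \<open>du\<close> and \<open>ddu\<close> are its first and pure second partial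
  derivatives, which are meaningful only where \<open>v\<close> is positive.
\<close>

locale smooth_weight =
  fixes d :: nat and p c C0 :: real and \<Omega> K :: "(nat \<Rightarrow> real) set"
    and v :: "(nat \<Rightarrow> real) \<Rightarrow> real" and du ddu :: "nat \<Rightarrow> (nat \<Rightarrow> real) \<Rightarrow> real"
    and \<psi> :: "(nat \<Rightarrow> real) \<Rightarrow> real" and d\<psi> dd\<psi> :: "nat \<Rightarrow> (nat \<Rightarrow> real) \<Rightarrow> real"
  assumes p: "1 < p" and c: "- p + 1 < c" "c < 1"
    and hardy: "hardy_inequality d \<Omega> C0" and \<Omega>: "openin (Rd d) \<Omega>"
    and \<rho>: "continuous_on UNIV (bdry_dist d \<Omega>)" "\<And>x. 0 \<le> bdry_dist d \<Omega> x"
    and K: "compact K" "K \<subseteq> \<Omega>" and \<rho>K: "\<And>x. x \<in> K \<Longrightarrow> 0 < bdry_dist d \<Omega> x"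
    and v: "continuous_on UNIV v" "\<And>x. 0 \<le> v x" "\<And>x. x \<in> topspace (Rd d) \<Longrightarrow> x \<notin> K \<Longrightarrow> v x = 0"
    and du: "\<And>i x. i < d \<Longrightarrow> x \<in> topspace (Rd d) \<Longrightarrow> 0 < v x \<Longrightarrow> has_partial i v x (du i x)"
      "\<And>i. i < d \<Longrightarrow> continuous_on {x. 0 < v x} (du i)"
    and ddu: "\<And>i x. i < d \<Longrightarrow> x \<in> topspace (Rd d) \<Longrightarrow> 0 < v x \<Longrightarrow> has_partial i (du i) x (ddu i x)"
      "\<And>i. i < d \<Longrightarrow> continuous_on {x. 0 < v x} (ddu i)"
    and \<psi>: "continuous_on UNIV \<psi>" "\<And>x. 0 < \<psi> x"
    and d\<psi>: "\<And>i x. i < d \<Longrightarrow> has_partial i \<psi> x (d\<psi> i x)" "\<And>i. i < d \<Longrightarrow> continuous_on UNIV (d\<psi> i)"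
    and dd\<psi>: "\<And>i x. i < d \<Longrightarrow> has_partial i (d\<psi> i) x (dd\<psi> i x)"
      "\<And>i. i < d \<Longrightarrow> continuous_on UNIV (dd\<psi> i)"
    and superharmonic: "\<And>x. x \<in> K \<Longrightarrow> (\<Sum>i<d. dd\<psi> i x) \<le> 0"
begin

lemma Kt: "K \<subseteq> topspace (Rd d)" using K(2) openin_subset[OF \<Omega>] by blast

lemma C0: "0 < C0" using hardy by (simp add: hardy_inequality_def)

lemma open_pos: "open {x. 0 < v x}"
  by (intro open_Collect_less continuous_on_const v(1))

lemma continuous_powr_weight: "continuous_on A (\<lambda>x. \<psi> x powr b)"
proof -
  have "\<psi> x \<noteq> 0" for x using \<psi>(2)[of x] by simp
  then show ?thesis by (intro continuous_on_powr continuous_on_const continuous_on_subset[OF \<psi>(1)]) auto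
qed

lemma has_partial_powr_weight:
  assumes "i < d"
  shows "has_partial i (\<lambda>x. \<psi> x powr b) x (b * \<psi> x powr (b - 1) * d\<psi> i x)"
proof -
  have "((\<lambda>t. \<psi> (x(i := t))) has_real_derivative d\<psi> i x) (at (x i))"
    using d\<psi>(1)[OF assms, of x] by (simp add: has_partial_def)
  moreover have "0 < \<psi> (x(i := x i))" by (rule \<psi>(2))
  ultimately have "((\<lambda>t. \<psi> (x(i := t)) powr b) has_real_derivative b * \<psi> (x(i := x i)) powr (b - 1) * d\<psi> i x) (at (x i))"
    by (intro DERIV_chain2[OF has_real_derivative_powr])
  then show ?thesis by (simp add: has_partial_def)
qed

text \<open>The factor \<open>g\<close> is meaningful only where \<open>v\<close> is positive. The
  open sets \<open>v > 0\<close> and \<open>v < e\<close> cover everything, and the product is zero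
  on the second.\<close>

lemma continuous_cut_mult:
  assumes k: "continuous_on UNIV k" "0 < e" "\<And>s. s \<le> e \<Longrightarrow> k s = 0"
    and g: "continuous_on {x. 0 < v x} g"
  shows "continuous_on UNIV (\<lambda>x. k (v x) * g x :: real)"
proof -
  have 1: "continuous_on {x. 0 < v x} (\<lambda>x. k (v x) * g x)"
    by (intro continuous_on_mult g continuous_on_compose2[OF k(1) continuous_on_subset[OF v(1)]]) auto
  have 2: "continuous_on {x. v x < e} (\<lambda>x. k (v x) * g x)"
    by (rule continuous_on_eq[OF continuous_on_const[of _ 0]]) (simp add: k(3))
  have "open {x. v x < e}" by (intro open_Collect_less continuous_on_const v(1))
  moreover have "{x. 0 < v x} \<union> {x. v x < e} = UNIV" using k(2) by auto
  ultimately show ?thesis using continuous_on_open_Un[OF open_pos _ 1 2] by simp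
qed

lemma has_partial_cut_mult:
  assumes k: "\<And>s. (k has_real_derivative k' s) (at s)" "0 < e" "\<And>s. s \<le> e \<Longrightarrow> k s = 0" "\<And>s. s \<le> e \<Longrightarrow> k' s = 0"
    and i: "i < d" and x: "x \<in> topspace (Rd d)"
    and g: "0 < v x \<Longrightarrow> has_partial i g x gd"
  shows "has_partial i (\<lambda>x. k (v x) * g x) x (k' (v x) * du i x * g x + k (v x) * gd)"
proof (cases "0 < v x")
  case True
  have "((\<lambda>t. v (x(i := t))) has_real_derivative du i x) (at (x i))"
    using du(1)[OF i x True] by (simp add: has_partial_def)
  from DERIV_chain2[OF k(1) this]
  have 1: "((\<lambda>t. k (v (x(i := t)))) has_real_derivative k' (v x) * du i x) (at (x i))" by simp
  have 2: "((\<lambda>t. g (x(i := t))) has_real_derivative gd) (at (x i))"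
    using g[OF True] by (simp add: has_partial_def)
  from DERIV_mult[OF 1 2] show ?thesis by (simp add: has_partial_def mult.commute)
next
  case False
  then have vx: "v x = 0" using v(2)[of x] by simp
  have o: "open {x. v x < e}" by (intro open_Collect_less continuous_on_const v(1))
  have "has_partial i (\<lambda>x. 0) x 0" by (simp add: has_partial_def)
  then have "has_partial i (\<lambda>x. k (v x) * g x) x 0"
    using vx k by (subst has_partial_cong[OF o, where g = "\<lambda>_. 0"]) auto
  then show ?thesis using vx k(2,3,4) by simp
qed

lemma integrable_cut:
  assumes k: "continuous_on UNIV k" "0 < e" "\<And>s. s \<le> e \<Longrightarrow> k s = 0"
    and g: "continuous_on {x. 0 < v x} g"
  shows "integrable (lebm d) (\<lambda>x. k (v x) * g x :: real)"
  by (rule integrable_continuous_compact_support[OF continuous_cut_mult[OF assms] K(1) Kt])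
     (use v(3) k in auto)

end

context smooth_weight begin

lemma energy_estimate:
  assumes e: "0 < e"
  shows "(\<integral>\<^sup>+x. ennreal ((cut_G p e (v x) * \<psi> x powr (c / 2) / bdry_dist d \<Omega> x)\<^sup>2) \<partial>lebm d)
    \<le> ennreal (energy_const p c C0 *
        (\<integral>x. - (cut_h p e (v x) * ((\<Sum>i<d. ddu i x) * \<psi> x powr c)) \<partial>lebm d))"
proof -
  let ?h = "cut_h p e" and ?h' = "cut_h' p e" and ?H = "cut_H p e" and ?G = "cut_G p e" and ?G' = "cut_G' p e"
  note z = cut_eq_0[where e = e and p = p]
  note cc = cut_continuous[OF p e] and cd = cut_derivatives[OF p e] and ci = cut_inequalities[OF p e]
  define q where "q b x = \<psi> x powr b" for b x
  have qc: "continuous_on S (q b)" for S b unfolding q_def by (rule continuous_powr_weight)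
  have q0: "0 < q b x" for b x using \<psi>(2)[of x] by (simp add: q_def)
  have qm: "q a x * q b x = q (a + b) x" for a b x by (simp add: q_def powr_add)
  have qsq: "(q b x)\<^sup>2 = q (2 * b) x" for b x using qm[of b x b] by (simp only: power2_eq_square mult_2)
  have dq: "has_partial i (q b) x (b * q (b - 1) x * d\<psi> i x)" if "i < d" for i b x
    unfolding q_def by (rule has_partial_powr_weight[OF that])
  note sub = continuous_on_subset[OF _ subset_UNIV]
  note cs = du(2) ddu(2) sub[OF d\<psi>(2)] sub[OF dd\<psi>(2)] qc
  \<comment> \<open>Densities for a single coordinate; \<open>L\<close> carries the Laplacian of
    \<open>v\<close> and \<open>Q\<close> that of \<psi>. Each contains a truncated factor, hence is
    continuous and vanishes off \<open>K\<close>.\<close>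
  define A where "A i x = ?h' (v x) * ((du i x)\<^sup>2 * q c x)" for i x
  define L where "L i x = ?h (v x) * (ddu i x * q c x)" for i x
  define D where "D i x = ?h (v x) * (du i x * d\<psi> i x * q (c - 1) x)" for i x
  define B where "B i x = ?H (v x) * ((d\<psi> i x)\<^sup>2 * q (c - 2) x)" for i x
  define Q where "Q i x = ?H (v x) * (dd\<psi> i x * q (c - 1) x)" for i x
  have A: "integrable (lebm d) (A i)" "continuous_on UNIV (A i)" if "i < d" for i
    unfolding A_def using that
    by (intro integrable_cut[OF cc(3) e z(3)] continuous_cut_mult[OF cc(3) e z(3)] continuous_on_mult continuous_on_power cs; simp)+
  have L: "integrable (lebm d) (L i)" "continuous_on UNIV (L i)" if "i < d" for i
    unfolding L_def using that
    by (intro integrable_cut[OF cc(2) e z(2)] continuous_cut_mult[OF cc(2) e z(2)] continuous_on_mult continuous_on_power cs; simp)+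
  have D: "integrable (lebm d) (D i)" "continuous_on UNIV (D i)" if "i < d" for i
    unfolding D_def using that
    by (intro integrable_cut[OF cc(2) e z(2)] continuous_cut_mult[OF cc(2) e z(2)] continuous_on_mult continuous_on_power cs; simp)+
  have B: "integrable (lebm d) (B i)" "continuous_on UNIV (B i)" if "i < d" for i
    unfolding B_def using that
    by (intro integrable_cut[OF cc(1) e z(1)] continuous_cut_mult[OF cc(1) e z(1)] continuous_on_mult continuous_on_power cs; simp)+
  have Q: "integrable (lebm d) (Q i)" "continuous_on UNIV (Q i)" if "i < d" for i
    unfolding Q_def using that
    by (intro integrable_cut[OF cc(1) e z(1)] continuous_cut_mult[OF cc(1) e z(1)] continuous_on_mult continuous_on_power cs; simp)+
  define IA where "IA = (\<Sum>i<d. integral\<^sup>L (lebm d) (A i))"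
  define IL where "IL = (\<Sum>i<d. integral\<^sup>L (lebm d) (L i))"
  define ID where "ID = (\<Sum>i<d. integral\<^sup>L (lebm d) (D i))"
  define IB where "IB = (\<Sum>i<d. integral\<^sup>L (lebm d) (B i))"
  define IQ where "IQ = (\<Sum>i<d. integral\<^sup>L (lebm d) (Q i))"
  \<comment> \<open>Integrate the \<open>i\<close>-th derivative of
    \<open>h(v) * du i * \<psi> powr c\<close>; the product rule yields exactly \<open>A\<close>,
    \<open>L\<close> and \<open>c * D\<close>.\<close>
  have E1: "IA + IL + c * ID = 0"
  proof -
    have "integral\<^sup>L (lebm d) (A i) + integral\<^sup>L (lebm d) (L i) + c * integral\<^sup>L (lebm d) (D i) = 0" if i: "i < d" for i
    proof -
      have "integral\<^sup>L (lebm d) (\<lambda>x. A i x + L i x + c * D i x) = 0"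
      proof (rule integral_partial_eq_0[THEN conjunct2, OF i _ _ K(1) Kt])
        show "continuous_on UNIV (\<lambda>x. A i x + L i x + c * D i x)"
          by (intro continuous_on_add continuous_on_mult continuous_on_const A(2)[OF i] L(2)[OF i] D(2)[OF i])
        fix x assume x: "x \<in> topspace (Rd d)"
        have g: "has_partial i (\<lambda>x. du i x * q c x) x (ddu i x * q c x + du i x * (c * q (c - 1) x * d\<psi> i x))"
          if "0 < v x"
          using DERIV_mult[OF ddu(1)[OF i x that, unfolded has_partial_def] dq[OF i, of c x, unfolded has_partial_def]]
          by (simp add: has_partial_def algebra_simps)
        have "has_partial i (\<lambda>x. ?h (v x) * (du i x * q c x)) x
          (?h' (v x) * du i x * (du i x * q c x) + ?h (v x) * (ddu i x * q c x + du i x * (c * q (c - 1) x * d\<psi> i x)))"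
          by (rule has_partial_cut_mult[OF cd(2) e z(2,3) i x g])
        also have "?h' (v x) * du i x * (du i x * q c x) + ?h (v x) * (ddu i x * q c x + du i x * (c * q (c - 1) x * d\<psi> i x))
          = A i x + L i x + c * D i x"
          by (simp add: A_def L_def D_def algebra_simps power2_eq_square)
        finally show "has_partial i (\<lambda>x. ?h (v x) * (du i x * q c x)) x (A i x + L i x + c * D i x)" .
      qed (use v(3) z(2) e in auto)
      then show ?thesis using A(1)[OF i] L(1)[OF i] D(1)[OF i] by simp
    qed
    then have "(\<Sum>i<d. integral\<^sup>L (lebm d) (A i) + integral\<^sup>L (lebm d) (L i) + c * integral\<^sup>L (lebm d) (D i)) = 0"
      by (intro sum.neutral) auto
    then show ?thesis by (simp add: IA_def IL_def ID_def sum.distrib sum_distrib_left)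
  qed
  \<comment> \<open>The field is now \<open>H(v) * \<psi> powr (c - 1) * d\<psi> i\<close>. Its
    power of \<psi> makes the same mixed term \<open>D\<close> reappear, next to \<open>Q\<close>,
    which has a sign.\<close>
  have E2: "ID + (c - 1) * IB + IQ = 0"
  proof -
    have "integral\<^sup>L (lebm d) (D i) + (c - 1) * integral\<^sup>L (lebm d) (B i) + integral\<^sup>L (lebm d) (Q i) = 0" if i: "i < d" for i
    proof -
      have "integral\<^sup>L (lebm d) (\<lambda>x. D i x + (c - 1) * B i x + Q i x) = 0"
      proof (rule integral_partial_eq_0[THEN conjunct2, OF i _ _ K(1) Kt])
        show "continuous_on UNIV (\<lambda>x. D i x + (c - 1) * B i x + Q i x)"
          by (intro continuous_on_add continuous_on_mult continuous_on_const B(2)[OF i] Q(2)[OF i] D(2)[OF i])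
        fix x assume x: "x \<in> topspace (Rd d)"
        have g: "has_partial i (\<lambda>x. q (c - 1) x * d\<psi> i x) x ((c - 1) * q (c - 2) x * d\<psi> i x * d\<psi> i x + q (c - 1) x * dd\<psi> i x)" for x
          using DERIV_mult[OF dq[OF i, of "c - 1" x, unfolded has_partial_def] dd\<psi>(1)[OF i, of x, unfolded has_partial_def]]
          by (simp add: has_partial_def algebra_simps)
        have "has_partial i (\<lambda>x. ?H (v x) * (q (c - 1) x * d\<psi> i x)) x
          (?h (v x) * du i x * (q (c - 1) x * d\<psi> i x)
            + ?H (v x) * ((c - 1) * q (c - 2) x * d\<psi> i x * d\<psi> i x + q (c - 1) x * dd\<psi> i x))"
          by (rule has_partial_cut_mult[OF cd(1) e z(1,2) i x g])
        also have "?h (v x) * du i x * (q (c - 1) x * d\<psi> i x)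
            + ?H (v x) * ((c - 1) * q (c - 2) x * d\<psi> i x * d\<psi> i x + q (c - 1) x * dd\<psi> i x)
          = D i x + (c - 1) * B i x + Q i x"
          by (simp add: B_def Q_def D_def algebra_simps power2_eq_square)
        finally show "has_partial i (\<lambda>x. ?H (v x) * (q (c - 1) x * d\<psi> i x)) x (D i x + (c - 1) * B i x + Q i x)" .
      qed (use v(3) z(1) e in auto)
      then show ?thesis using B(1)[OF i] Q(1)[OF i] D(1)[OF i] by simp
    qed
    then have "(\<Sum>i<d. integral\<^sup>L (lebm d) (D i) + (c - 1) * integral\<^sup>L (lebm d) (B i) + integral\<^sup>L (lebm d) (Q i)) = 0"
      by (intro sum.neutral) auto
    then show ?thesis by (simp add: IB_def IQ_def ID_def sum.distrib sum_distrib_left)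
  qed
  have IQ: "IQ \<le> 0"
  proof -
    have "IQ = (\<integral>x. (\<Sum>i<d. Q i x) \<partial>lebm d)"
      unfolding IQ_def using Q(1) by (intro Bochner_Integration.integral_sum[symmetric]) auto
    also have "\<dots> \<le> 0"
    proof -
      have "0 \<le> (\<integral>x. - (\<Sum>i<d. Q i x) \<partial>lebm d)"
      proof (rule Bochner_Integration.integral_nonneg)
        fix x assume "x \<in> space (lebm d)"
        then have x: "x \<in> topspace (Rd d)" by (simp add: space_lebm)
        have "(\<Sum>i<d. Q i x) \<le> 0"
        proof (cases "x \<in> K")
          case True
          have "(\<Sum>i<d. Q i x) = ?H (v x) * q (c - 1) x * (\<Sum>i<d. dd\<psi> i x)"
            by (simp add: Q_def sum_distrib_left mult_ac)
          then show ?thesis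
            using superharmonic[OF True] ci(1) q0[of "c - 1" x]
            by (simp add: mult_nonneg_nonpos less_imp_le)
        next
          case False
          then show ?thesis using v(3)[OF x False] z(1)[of 0] e by (simp add: Q_def)
        qed
        then show "0 \<le> - (\<Sum>i<d. Q i x)" by simp
      qed
      then show ?thesis by simp
    qed
    finally show ?thesis .
  qed
  define \<kappa> where "\<kappa> = p / (p - 1)"
  have \<kappa>: "0 < \<kappa>" using p by (simp add: \<kappa>_def)
  have c1: "0 < 1 - c" using c by simp
  \<comment> \<open>The weights are tuned so that \<open>B\<close> gets the coefficient
    \<open>(1 - c) / 2\<close>: by \<open>F1\<close> below, that term is at most
    \<open>D / 2\<close> and can be absorbed. The discriminant condition is the inequality between
    \<open>h\<close>, \<open>H\<close> and \<open>h'\<close>.\<close>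
  have E3: "ID \<le> \<kappa> / (2 * (1 - c)) * IA + (1 - c) / 2 * IB"
  proof -
    have pt: "D i x \<le> \<kappa> / (2 * (1 - c)) * A i x + (1 - c) / 2 * B i x" for i x
    proof -
      have q1: "q (c - 1) x = q (c / 2) x * q (c / 2 - 1) x" by (simp add: qm)
      have q2: "q c x = (q (c / 2) x)\<^sup>2" "q (c - 2) x = (q (c / 2 - 1) x)\<^sup>2"
        by (simp_all add: qsq algebra_simps)
      have "?h (v x) * (du i x * q (c / 2) x) * (d\<psi> i x * q (c / 2 - 1) x)
        \<le> (\<kappa> / (2 * (1 - c)) * ?h' (v x)) * (du i x * q (c / 2) x)\<^sup>2
          + ((1 - c) / 2 * ?H (v x)) * (d\<psi> i x * q (c / 2 - 1) x)\<^sup>2"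
      proof (rule amgm_quadratic)
        show "0 \<le> \<kappa> / (2 * (1 - c)) * ?h' (v x)" "0 \<le> (1 - c) / 2 * ?H (v x)"
          using \<kappa> c1 ci(1,3) by auto
        have "4 * (\<kappa> / (2 * w) * a) * (w / 2 * b) = \<kappa> * b * a" if "w \<noteq> 0" for w a b :: real
          using that by (simp add: field_simps)
        then have eq: "4 * (\<kappa> / (2 * (1 - c)) * ?h' (v x)) * ((1 - c) / 2 * ?H (v x)) = \<kappa> * ?H (v x) * ?h' (v x)"
          using c1 by (metis less_irrefl)
        show "(?h (v x))\<^sup>2 \<le> 4 * (\<kappa> / (2 * (1 - c)) * ?h' (v x)) * ((1 - c) / 2 * ?H (v x))"
          unfolding eq using ci(6)[of "v x"] p by (simp add: \<kappa>_def field_simps)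
      qed
      then show ?thesis
        by (simp add: D_def A_def B_def q1 q2 power_mult_distrib mult_ac)
    qed
    have "integral\<^sup>L (lebm d) (D i) \<le> \<kappa> / (2 * (1 - c)) * integral\<^sup>L (lebm d) (A i) + (1 - c) / 2 * integral\<^sup>L (lebm d) (B i)"
      if i: "i < d" for i
    proof -
      have "integral\<^sup>L (lebm d) (D i) \<le> (\<integral>x. \<kappa> / (2 * (1 - c)) * A i x + (1 - c) / 2 * B i x \<partial>lebm d)"
        using A(1)[OF i] B(1)[OF i] D(1)[OF i] by (intro integral_mono pt) auto
      then show ?thesis using A(1)[OF i] B(1)[OF i] by simp
    qed
    then have "ID \<le> (\<Sum>i<d. \<kappa> / (2 * (1 - c)) * integral\<^sup>L (lebm d) (A i) + (1 - c) / 2 * integral\<^sup>L (lebm d) (B i))"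
      unfolding ID_def by (intro sum_mono) auto
    then show ?thesis unfolding IA_def IB_def by (simp add: sum.distrib sum_distrib_left)
  qed
  have IA0: "0 \<le> IA" "0 \<le> IB"
    unfolding IA_def IB_def A_def B_def using ci(1,3) q0
    by (auto intro!: sum_nonneg Bochner_Integration.integral_nonneg mult_nonneg_nonneg simp: less_imp_le)
  have F1: "(1 - c) * IB \<le> ID" using E2 IQ by (simp add: algebra_simps)
  have F2: "ID \<le> \<kappa> / (1 - c) * IA"
  proof -
    have "ID \<le> \<kappa> / (2 * (1 - c)) * IA + ID / 2" using E3 F1 by simp
    then have "ID \<le> 2 * (\<kappa> / (2 * (1 - c)) * IA)" by linarith
    moreover have "2 * (\<kappa> / (2 * w) * IA) = \<kappa> / w * IA" for w :: real by simp
    ultimately show ?thesis by (simp only:)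
  qed
  have F3: "IB \<le> \<kappa> / (1 - c)\<^sup>2 * IA"
  proof -
    have "(1 - c) * IB \<le> \<kappa> / (1 - c) * IA" using F1 F2 by simp
    then have "IB \<le> \<kappa> / (1 - c) * IA / (1 - c)"
      using pos_le_divide_eq[OF c1] by (simp only: mult.commute)
    moreover have "\<kappa> / w * IA / w = \<kappa> / w\<^sup>2 * IA" for w :: real by (simp add: power2_eq_square)
    ultimately show ?thesis by (simp only:)
  qed
  \<comment> \<open>For \<open>c \<ge> 0\<close> the term \<open>c * D\<close> is nonnegative by
    \<open>F1\<close> and is dropped; for negative \<open>c\<close> the upper bound
    \<open>F2\<close> on \<open>D\<close> is the useful direction.\<close>
  have F4: "ellipticity p c * IA \<le> - IL"
  proof (cases "0 \<le> c")
    case True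
    have "0 \<le> ID" using F1 IA0(2) c1 by (smt (verit) mult_nonneg_nonneg)
    then have "0 \<le> c * ID" using True by simp
    then show ?thesis using E1 True by (simp add: ellipticity_def)
  next
    case False
    have "c * (\<kappa> / (1 - c) * IA) \<le> c * ID" using F2 False by (intro mult_left_mono_neg) auto
    moreover have "(1 + c * \<kappa> / w) * IA = IA + c * (\<kappa> / w * IA)" for w :: real
      by (simp add: distrib_right)
    then have "ellipticity p c * IA = IA + c * (\<kappa> / (1 - c) * IA)"
      using False by (simp only: ellipticity_def \<kappa>_def[symmetric] if_False)
    ultimately show ?thesis using E1 by linarith
  qed
  \<comment> \<open>The gradient of \<open>?G (v x) * q (c / 2) x\<close>, to which Hardy's
    inequality is applied; the square of that function is
    \<open>p * H(v) * \<psi> powr c\<close>.\<close>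
  define f' where "f' i x = ?G' (v x) * du i x * q (c / 2) x + ?G (v x) * (c / 2 * q (c / 2 - 1) x * d\<psi> i x)" for i x
  have f'c: "continuous_on UNIV (f' i)" if i: "i < d" for i
  proof -
    have "continuous_on UNIV (\<lambda>x. ?G' (v x) * (du i x * q (c / 2) x))"
      "continuous_on UNIV (\<lambda>x. ?G (v x) * (c / 2 * q (c / 2 - 1) x * d\<psi> i x))"
      using i by (intro continuous_cut_mult[OF cc(5) e z(5)] continuous_cut_mult[OF cc(4) e z(4)]
          continuous_on_mult continuous_on_const cs; simp)+
    from continuous_on_add[OF this] show ?thesis by (simp add: f'_def[abs_def] mult.assoc)
  qed
  have f'0: "f' i x = 0" if "x \<in> topspace (Rd d)" "x \<notin> K" for i x
    using v(3)[OF that] z(4,5)[of 0] e by (simp add: f'_def)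
  have "(\<integral>\<^sup>+x. ennreal ((?G (v x) * q (c / 2) x / bdry_dist d \<Omega> x)\<^sup>2) \<partial>lebm d)
      \<le> ennreal (C0 * (\<integral>x. (\<Sum>i<d. (f' i x)\<^sup>2) \<partial>lebm d))"
  proof (rule hardy_inequality_C1[OF hardy \<Omega> \<rho>(1) K])
    show "continuous_on UNIV (\<lambda>x. ?G (v x) * q (c / 2) x)"
      by (intro continuous_cut_mult[OF cc(4) e z(4)] qc)
    show "has_partial i (\<lambda>x. ?G (v x) * q (c / 2) x) x (f' i x)" if "i < d" "x \<in> topspace (Rd d)" for i x
      unfolding f'_def by (rule has_partial_cut_mult[OF cd(3) e z(4,5) that dq[OF that(1)]])
    show "?G (v x) * q (c / 2) x = 0" if "x \<in> topspace (Rd d)" "x \<notin> K" for x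
      using v(3)[OF that] z(4)[of 0] e by simp
  qed (use f'c f'0 in auto)
  also have "\<dots> \<le> ennreal (energy_const p c C0 * (- IL))"
  proof (rule ennreal_leI)
    have pt: "(\<Sum>i<d. (f' i x)\<^sup>2) \<le> (\<Sum>i<d. p\<^sup>2 / (2 * (p - 1)) * A i x + c\<^sup>2 * p / 2 * B i x)" for x
    proof (rule sum_mono)
      fix i
      define \<alpha> where "\<alpha> = ?G' (v x) * du i x * q (c / 2) x"
      define \<beta> where "\<beta> = ?G (v x) * (c / 2 * q (c / 2 - 1) x * d\<psi> i x)"
      have "(f' i x)\<^sup>2 \<le> 2 * \<alpha>\<^sup>2 + 2 * \<beta>\<^sup>2"
        unfolding f'_def \<alpha>_def[symmetric] \<beta>_def[symmetric] using sum_squares_bound[of \<alpha> \<beta>] by (simp add: power2_sum)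
      also have "2 * \<alpha>\<^sup>2 = 2 * (?G' (v x))\<^sup>2 * ((du i x)\<^sup>2 * q c x)"
        by (simp add: \<alpha>_def power_mult_distrib qsq mult_ac)
      also have "2 * \<beta>\<^sup>2 = c\<^sup>2 / 2 * (?G (v x))\<^sup>2 * ((d\<psi> i x)\<^sup>2 * q (c - 2) x)"
        by (simp add: \<beta>_def power_mult_distrib power_divide qsq algebra_simps)
      also have "2 * (?G' (v x))\<^sup>2 * ((du i x)\<^sup>2 * q c x) + c\<^sup>2 / 2 * (?G (v x))\<^sup>2 * ((d\<psi> i x)\<^sup>2 * q (c - 2) x)
        \<le> 2 * (p\<^sup>2 / (4 * (p - 1)) * ?h' (v x)) * ((du i x)\<^sup>2 * q c x)
          + c\<^sup>2 / 2 * (p * ?H (v x)) * ((d\<psi> i x)\<^sup>2 * q (c - 2) x)"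
        unfolding ci(4) using q0[of c x]
        by (intro add_mono mult_right_mono mult_left_mono ci(5) mult_nonneg_nonneg order_refl) auto
      also have "\<dots> = p\<^sup>2 / (2 * (p - 1)) * A i x + c\<^sup>2 * p / 2 * B i x"
      proof -
        have "2 * (p\<^sup>2 / (4 * w) * a) * b = p\<^sup>2 / (2 * w) * (a * b)" "c\<^sup>2 / 2 * (p * a) * b = c\<^sup>2 * p / 2 * (a * b)"
          for a b w by simp_all
        then show ?thesis unfolding A_def B_def by (simp only:)
      qed
      finally show "(f' i x)\<^sup>2 \<le> p\<^sup>2 / (2 * (p - 1)) * A i x + c\<^sup>2 * p / 2 * B i x" .
    qed
    have "(\<integral>x. (\<Sum>i<d. (f' i x)\<^sup>2) \<partial>lebm d) \<le> (\<integral>x. (\<Sum>i<d. p\<^sup>2 / (2 * (p - 1)) * A i x + c\<^sup>2 * p / 2 * B i x) \<partial>lebm d)"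
    proof (rule integral_mono[OF _ _ pt])
      show "integrable (lebm d) (\<lambda>x. \<Sum>i<d. (f' i x)\<^sup>2)"
        by (rule integrable_continuous_compact_support[OF _ K(1) Kt])
           (auto intro!: continuous_on_sum continuous_on_power f'c simp: f'0)
      show "integrable (lebm d) (\<lambda>x. \<Sum>i<d. p\<^sup>2 / (2 * (p - 1)) * A i x + c\<^sup>2 * p / 2 * B i x)"
        using A(1) B(1) by (intro Bochner_Integration.integrable_sum Bochner_Integration.integrable_add integrable_mult_right) auto
    qed
    also have "\<dots> = p\<^sup>2 / (2 * (p - 1)) * IA + c\<^sup>2 * p / 2 * IB"
    proof -
      have "(\<integral>x. (\<Sum>i<d. p\<^sup>2 / (2 * (p - 1)) * A i x + c\<^sup>2 * p / 2 * B i x) \<partial>lebm d)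
        = (\<Sum>i<d. (\<integral>x. p\<^sup>2 / (2 * (p - 1)) * A i x + c\<^sup>2 * p / 2 * B i x \<partial>lebm d))"
        using A(1) B(1)
        by (intro Bochner_Integration.integral_sum Bochner_Integration.integrable_add integrable_mult_right) auto
      also have "\<dots> = (\<Sum>i<d. p\<^sup>2 / (2 * (p - 1)) * integral\<^sup>L (lebm d) (A i) + c\<^sup>2 * p / 2 * integral\<^sup>L (lebm d) (B i))"
      proof (rule sum.cong[OF refl])
        fix i assume "i \<in> {..<d}"
        then have "integrable (lebm d) (\<lambda>x. p\<^sup>2 / (2 * (p - 1)) * A i x)" "integrable (lebm d) (\<lambda>x. c\<^sup>2 * p / 2 * B i x)"
          using A(1) B(1) by (intro integrable_mult_right; simp)+
        from Bochner_Integration.integral_add[OF this]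
        show "(\<integral>x. p\<^sup>2 / (2 * (p - 1)) * A i x + c\<^sup>2 * p / 2 * B i x \<partial>lebm d)
          = p\<^sup>2 / (2 * (p - 1)) * integral\<^sup>L (lebm d) (A i) + c\<^sup>2 * p / 2 * integral\<^sup>L (lebm d) (B i)"
          unfolding integral_mult_right_zero .
      qed
      also have "\<dots> = p\<^sup>2 / (2 * (p - 1)) * IA + c\<^sup>2 * p / 2 * IB"
        unfolding IA_def IB_def by (simp only: sum.distrib sum_distrib_left)
      finally show ?thesis .
    qed
    also have "\<dots> \<le> p\<^sup>2 / (2 * (p - 1)) * IA + c\<^sup>2 * p / 2 * (\<kappa> / (1 - c)\<^sup>2 * IA)"
      using p by (intro add_left_mono mult_left_mono F3) auto
    also have "\<dots> = (p\<^sup>2 / (2 * (p - 1)) + c\<^sup>2 * p / 2 * (\<kappa> / (1 - c)\<^sup>2)) * IA"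
      by (simp only: distrib_right mult.assoc)
    finally have 1: "(\<integral>x. (\<Sum>i<d. (f' i x)\<^sup>2) \<partial>lebm d) \<le> (p\<^sup>2 / (2 * (p - 1)) + c\<^sup>2 * p / 2 * (\<kappa> / (1 - c)\<^sup>2)) * IA" .
    have el: "0 < ellipticity p c" by (rule ellipticity_pos[OF p c])
    have "IA \<le> - IL / ellipticity p c" using F4 el by (simp add: field_simps)
    moreover have "0 \<le> p\<^sup>2 / (2 * (p - 1)) + c\<^sup>2 * p / 2 * (\<kappa> / (1 - c)\<^sup>2)"
      using p \<kappa> by (intro add_nonneg_nonneg mult_nonneg_nonneg divide_nonneg_nonneg) auto
    ultimately have "(p\<^sup>2 / (2 * (p - 1)) + c\<^sup>2 * p / 2 * (\<kappa> / (1 - c)\<^sup>2)) * IA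
      \<le> (p\<^sup>2 / (2 * (p - 1)) + c\<^sup>2 * p / 2 * (\<kappa> / (1 - c)\<^sup>2)) * (- IL / ellipticity p c)"
      by (rule mult_left_mono)
    with 1 have "(\<integral>x. (\<Sum>i<d. (f' i x)\<^sup>2) \<partial>lebm d)
        \<le> (p\<^sup>2 / (2 * (p - 1)) + c\<^sup>2 * p / 2 * (\<kappa> / (1 - c)\<^sup>2)) * (- IL / ellipticity p c)" by (rule order_trans)
    then have "C0 * (\<integral>x. (\<Sum>i<d. (f' i x)\<^sup>2) \<partial>lebm d)
        \<le> C0 * ((p\<^sup>2 / (2 * (p - 1)) + c\<^sup>2 * p / 2 * (\<kappa> / (1 - c)\<^sup>2)) * (- IL / ellipticity p c))"
      using C0 by (intro mult_left_mono) auto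
    also have "\<dots> = energy_const p c C0 * (- IL)"
    proof -
      have "C0 * (X * (I / l)) = C0 * X / l * I" for X I l by simp
      then show ?thesis unfolding energy_const_def \<kappa>_def by (simp only:)
    qed
    finally show "C0 * (\<integral>x. (\<Sum>i<d. (f' i x)\<^sup>2) \<partial>lebm d) \<le> energy_const p c C0 * (- IL)" .
  qed
  also have "- IL = (\<integral>x. - (?h (v x) * ((\<Sum>i<d. ddu i x) * q c x)) \<partial>lebm d)"
  proof -
    have "(\<integral>x. - (?h (v x) * ((\<Sum>i<d. ddu i x) * q c x)) \<partial>lebm d) = (\<integral>x. - (\<Sum>i<d. L i x) \<partial>lebm d)"
      by (simp add: L_def sum_distrib_left sum_distrib_right)
    also have "\<dots> = - IL"
      unfolding IL_def using L(1) by (subst Bochner_Integration.integral_sum[symmetric]) auto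
    finally show ?thesis ..
  qed
  finally show ?thesis by (simp add: q_def)
qed

end

section \<open>Removing the truncation and absorbing the left-hand side\<close>

lemma ennreal_integral_le_nn_integral:
  assumes "integrable M (g :: 'a \<Rightarrow> real)"
  shows "ennreal (integral\<^sup>L M g) \<le> (\<integral>\<^sup>+x. ennreal (g x) \<partial>M)"
proof -
  have i: "integrable M (\<lambda>x. max 0 (g x))" using assms by (intro integrable_max) auto
  have "integral\<^sup>L M g \<le> (\<integral>x. max 0 (g x) \<partial>M)" by (intro integral_mono assms i) auto
  then have "ennreal (integral\<^sup>L M g) \<le> ennreal (\<integral>x. max 0 (g x) \<partial>M)" by (rule ennreal_leI)
  also have "\<dots> = (\<integral>\<^sup>+x. ennreal (max 0 (g x)) \<partial>M)"
    by (rule nn_integral_eq_integral[symmetric, OF i]) auto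
  also have "\<dots> = (\<integral>\<^sup>+x. ennreal (g x) \<partial>M)"
    by (intro nn_integral_cong) (auto simp: max_def ennreal_neg)
  finally show ?thesis .
qed

lemma powr_minus_2: "0 \<le> r \<Longrightarrow> r powr (-2) = 1 / r\<^sup>2" for r :: real
  by (cases "r = 0") (auto simp: powr_minus_divide)

context smooth_weight begin

text \<open>Between the two sides \<open>X\<close> and \<open>Y\<close> stands the mixed integral
  \<open>R\<close> of \<open>v powr (p - 1) * \<bar>f\<bar>\<close> with the weight. The energy
  estimate gives \<open>X \<le> C2 * R\<close>, and Young's inequality bounds \<open>R\<close> by a
  small multiple of \<open>X\<close> plus a multiple of \<open>Y\<close>.\<close>

lemma weighted_estimate:
  assumes lam: "0 \<le> lam" and Bd: "\<And>x. x \<in> K \<Longrightarrow> 0 < v x \<Longrightarrow> \<bar>\<Sum>i<d. ddu i x\<bar> \<le> Bd"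
  shows "(\<integral>\<^sup>+x. ennreal (v x powr p * \<psi> x powr c * bdry_dist d \<Omega> x powr (-2)) \<partial>lebm d)
    \<le> ennreal ((2 * energy_const p c C0) powr p) *
      (\<integral>\<^sup>+x. ennreal (\<bar>(\<Sum>i<d. ddu i x) - lam * v x\<bar> powr p * \<psi> x powr c * bdry_dist d \<Omega> x powr (2 * p - 2))
        * indicator {x. 0 < v x} x \<partial>lebm d)"
proof -
  define C2 where "C2 = energy_const p c C0"
  have C2: "0 < C2" unfolding C2_def by (rule energy_const_pos[OF p c C0])
  define U where "U = {x. 0 < v x}"
  define \<rho> where "\<rho> = bdry_dist d \<Omega>"
  have \<rho>: "continuous_on UNIV \<rho>" "0 \<le> \<rho> x" "x \<in> K \<Longrightarrow> 0 < \<rho> x" for x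
    unfolding \<rho>_def using smooth_weight.\<rho>[OF smooth_weight_axioms] \<rho>K by auto
  define f where "f x = (\<Sum>i<d. ddu i x) - lam * v x" for x
  have vK: "x \<in> K" if "x \<in> topspace (Rd d)" "0 < v x" for x using v(3)[OF that(1)] that(2) by fastforce
  define X where "X = (\<integral>\<^sup>+x. ennreal (v x powr p * \<psi> x powr c * \<rho> x powr (-2)) \<partial>lebm d)"
  define Y where "Y = (\<integral>\<^sup>+x. ennreal (\<bar>f x\<bar> powr p * \<psi> x powr c * \<rho> x powr (2 * p - 2)) * indicator U x \<partial>lebm d)"
  define R where "R = (\<integral>\<^sup>+x. ennreal (v x powr (p - 1) * \<bar>f x\<bar> * \<psi> x powr c) * indicator U x \<partial>lebm d)"
  have \<psi>c: "continuous_on UNIV (\<lambda>x. \<psi> x powr b)" for b by (rule continuous_powr_weight)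
  have [measurable]: "\<rho> \<in> borel_measurable (lebm d)" "v \<in> borel_measurable (lebm d)"
    "(\<lambda>x. \<psi> x powr b) \<in> borel_measurable (lebm d)" for b
    by (intro borel_measurable_lebm_continuous \<rho>(1) v(1) \<psi>c)+
  have Ub: "U \<in> sets borel" unfolding U_def using open_pos by simp
  have fU: "(\<lambda>x. indicator U x * f x) \<in> borel_measurable (lebm d)"
  proof -
    have "continuous_on U f" unfolding f_def U_def
      by (intro continuous_on_diff continuous_on_sum continuous_on_mult continuous_on_const
          continuous_on_subset[OF v(1) subset_UNIV] ddu(2)) auto
    from borel_measurable_continuous_on_indicator[OF Ub this]
    show ?thesis by (intro borel_measurable_lebm) simp
  qed
  have S1: "(\<integral>\<^sup>+x. ennreal ((cut_G p e (v x) * \<psi> x powr (c / 2) / \<rho> x)\<^sup>2) \<partial>lebm d) \<le> ennreal C2 * R"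
    if e: "0 < e" for e
  proof -
    define g where "g x = - (cut_h p e (v x) * ((\<Sum>i<d. ddu i x) * \<psi> x powr c))" for x
    have g: "integrable (lebm d) g"
      unfolding g_def
      by (intro Bochner_Integration.integrable_minus integrable_cut[OF cut_continuous(2)[OF p e] e cut_eq_0(2)]
          continuous_on_mult continuous_on_sum ddu(2) continuous_powr_weight) auto
    have "(\<integral>\<^sup>+x. ennreal ((cut_G p e (v x) * \<psi> x powr (c / 2) / \<rho> x)\<^sup>2) \<partial>lebm d)
        \<le> ennreal C2 * ennreal (integral\<^sup>L (lebm d) g)"
      using energy_estimate[OF e] C2
      unfolding g_def[symmetric] C2_def[symmetric] \<rho>_def[symmetric] by (simp add: ennreal_mult')
    also have "\<dots> \<le> ennreal C2 * (\<integral>\<^sup>+x. ennreal (g x) \<partial>lebm d)"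
      by (intro mult_left_mono ennreal_integral_le_nn_integral g) simp
    also have "\<dots> \<le> ennreal C2 * R"
      unfolding R_def
    proof (intro mult_left_mono nn_integral_mono)
      fix x
      show "ennreal (g x) \<le> ennreal (v x powr (p - 1) * \<bar>f x\<bar> * \<psi> x powr c) * indicator U x"
      proof (cases "0 < v x")
        case True
        \<comment> \<open>The zero-order term helps: as \<open>lam * v x \<ge> 0\<close>,
          subtracting it from the Laplacian only increases the negated expression.\<close>
        have "- (\<Sum>i<d. ddu i x) \<le> \<bar>f x\<bar>"
          using lam True by (simp add: f_def) (smt (verit) mult_nonneg_nonneg)
        then have "cut_h p e (v x) * (- (\<Sum>i<d. ddu i x) * \<psi> x powr c) \<le> cut_h p e (v x) * (\<bar>f x\<bar> * \<psi> x powr c)"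
          by (intro mult_left_mono mult_right_mono cut_inequalities(2)[OF p e]) auto
        also have "\<dots> \<le> v x powr (p - 1) * (\<bar>f x\<bar> * \<psi> x powr c)"
          by (intro mult_right_mono cut_inequalities(7)[OF p e]) auto
        finally show ?thesis using True by (simp add: g_def U_def mult.assoc ennreal_leI)
      next
        case False
        then have "v x = 0" using v(2)[of x] by simp
        then show ?thesis using e cut_eq_0(2)[of 0 e p] by (simp add: g_def)
      qed
    qed simp
    finally show ?thesis .
  qed
  have S2: "X \<le> ennreal C2 * R"
  proof -
    define e where "e n = inverse (real (Suc n))" for n
    have e: "0 < e n" "e \<longlonglongrightarrow> 0" for n
      using LIMSEQ_inverse_real_of_nat by (auto simp: e_def[abs_def])
    define F where "F n x = (cut_G p (e n) (v x) * \<psi> x powr (c / 2) / \<rho> x)\<^sup>2" for n x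
    have Feq: "F n x = (cut_G p (e n) (v x))\<^sup>2 * \<psi> x powr c * \<rho> x powr (-2)" for n x
      using powr_minus_2[OF \<rho>(2)[of x]]
      by (simp add: F_def power_divide power_mult_distrib power2_eq_square flip: powr_add)
    have [measurable]: "(\<lambda>x. cut_G p (e n) (v x)) \<in> borel_measurable (lebm d)" for n
      by (intro borel_measurable_lebm_continuous continuous_on_compose2[OF cut_continuous(4)[OF p e(1)] v(1)]) auto
    have "X = (\<integral>\<^sup>+x. liminf (\<lambda>n. ennreal (F n x)) \<partial>lebm d)"
      unfolding X_def
    proof (rule nn_integral_cong)
      fix x
      have "(\<lambda>n. F n x) \<longlonglongrightarrow> v x powr p * \<psi> x powr c * \<rho> x powr (-2)"
        unfolding Feq by (intro tendsto_mult tendsto_const cut_G_tendsto[OF p v(2) e(2,1)])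
      from lim_imp_Liminf[OF _ tendsto_ennrealI[OF this]]
      show "ennreal (v x powr p * \<psi> x powr c * \<rho> x powr (-2)) = liminf (\<lambda>n. ennreal (F n x))" by simp
    qed
    also have "\<dots> \<le> liminf (\<lambda>n. \<integral>\<^sup>+x. ennreal (F n x) \<partial>lebm d)"
      unfolding F_def by (rule nn_integral_liminf) measurable
    also have "\<dots> \<le> liminf (\<lambda>n. ennreal C2 * R)"
      unfolding F_def by (intro Liminf_mono always_eventually allI S1 e(1))
    also have "\<dots> = ennreal C2 * R" by (simp add: Liminf_const)
    finally show ?thesis .
  qed
  \<comment> \<open>Finiteness permits subtracting \<open>X / 2\<close> later. On \<open>K\<close>
    the Laplacian is bounded by \<open>Bd\<close>, while \<open>v\<close> and the weight are
    continuous, so \<open>R\<close> is finite and \<open>S2\<close> passes this on to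
    \<open>X\<close>.\<close>
  have fin: "X < \<infinity>"
  proof -
    obtain B1 where B1: "\<And>x. x \<in> K \<Longrightarrow> \<bar>v x\<bar> \<le> B1" using compact_bounded_fun[OF v(1) K(1)] by blast
    obtain B2 where B2: "\<And>x. x \<in> K \<Longrightarrow> \<bar>\<psi> x powr c\<bar> \<le> B2" using compact_bounded_fun[OF \<psi>c K(1)] by blast
    define B where "B = \<bar>B1\<bar> powr (p - 1) * (\<bar>Bd\<bar> + lam * \<bar>B1\<bar>) * \<bar>B2\<bar>"
    have "R \<le> (\<integral>\<^sup>+x. ennreal B * indicator K x \<partial>lebm d)"
      unfolding R_def
    proof (rule nn_integral_mono)
      fix x assume "x \<in> space (lebm d)"
      then have x: "x \<in> topspace (Rd d)" by (simp add: space_lebm)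
      show "ennreal (v x powr (p - 1) * \<bar>f x\<bar> * \<psi> x powr c) * indicator U x \<le> ennreal B * indicator K x"
      proof (cases "0 < v x")
        case True
        have xK: "x \<in> K" by (rule vK[OF x True])
        have "\<bar>f x\<bar> \<le> \<bar>\<Sum>i<d. ddu i x\<bar> + \<bar>lam * v x\<bar>" unfolding f_def by (rule abs_triangle_ineq4)
        also have "\<dots> \<le> \<bar>Bd\<bar> + lam * \<bar>B1\<bar>"
          using Bd[OF xK True] B1[OF xK] lam True by (intro add_mono) (auto simp: abs_mult intro!: mult_left_mono)
        finally have "v x powr (p - 1) * \<bar>f x\<bar> * \<psi> x powr c \<le> B"
          unfolding B_def using B1[OF xK] B2[OF xK] True p lam
          by (intro mult_mono powr_mono2) auto
        then show ?thesis using xK by (auto simp: indicator_def intro!: ennreal_leI)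
      qed (simp add: U_def)
    qed
    also have "\<dots> = ennreal B * emeasure (lebm d) K"
      using compact_sets_lebm[OF K(1) Kt] by (rule nn_integral_cmult_indicator)
    also have "\<dots> < \<infinity>" using emeasure_compact[OF K(1) Kt] by (simp add: ennreal_mult_less_top)
    finally have "R < \<infinity>" .
    then show ?thesis using S2 by (simp add: ennreal_mult_less_top le_less_trans)
  qed
  \<comment> \<open>Chosen so that \<open>C2 * \<epsilon> = 1 / 2\<close>. After absorption the
    constant is \<open>2 * C2 * M = (2 * C2) powr p\<close>.\<close>
  define \<epsilon> where "\<epsilon> = 1 / (2 * C2)"
  have \<epsilon>: "0 < \<epsilon>" using C2 by (simp add: \<epsilon>_def)
  define M where "M = (1 / \<epsilon>) powr (p - 1)"
  have M: "0 < M" using \<epsilon> by (simp add: M_def)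
  have S3: "R \<le> ennreal \<epsilon> * X + ennreal M * Y"
  proof -
    define y where "y x = \<bar>indicator U x * f x\<bar> powr p * \<psi> x powr c * \<rho> x powr (2 * p - 2)" for x
    have [measurable]: "y \<in> borel_measurable (lebm d)" unfolding y_def using fU by measurable
    have Yy: "Y = (\<integral>\<^sup>+x. ennreal (y x) \<partial>lebm d)"
      unfolding Y_def y_def by (intro nn_integral_cong) (auto simp: indicator_def)
    have "R \<le> (\<integral>\<^sup>+x. ennreal \<epsilon> * ennreal (v x powr p * \<psi> x powr c * \<rho> x powr (-2)) + ennreal M * ennreal (y x) \<partial>lebm d)"
      unfolding R_def
    proof (rule nn_integral_mono)
      fix x assume "x \<in> space (lebm d)"
      then have x: "x \<in> topspace (Rd d)" by (simp add: space_lebm)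
      show "ennreal (v x powr (p - 1) * \<bar>f x\<bar> * \<psi> x powr c) * indicator U x
        \<le> ennreal \<epsilon> * ennreal (v x powr p * \<psi> x powr c * \<rho> x powr (-2)) + ennreal M * ennreal (y x)"
      proof (cases "0 < v x")
        case True
        have r: "0 < \<rho> x" by (rule \<rho>(3)[OF vK[OF x True]])
        \<comment> \<open>The powers of \<rho> are distributed so that they cancel in
          \<open>a powr (p - 1) * b\<close>, while the \<open>p\<close>-th powers produce the
          weights \<open>\<rho> x powr (-2)\<close> and \<open>\<rho> x powr (2 * p - 2)\<close> of
          the theorem.\<close>
        define a where "a = v x * \<rho> x powr (- 2 / p)"
        define b where "b = \<bar>f x\<bar> * \<rho> x powr ((2 * p - 2) / p)"
        have a1: "a powr (p - 1) = v x powr (p - 1) * \<rho> x powr (- 2 / p * (p - 1))"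
          unfolding a_def using True r by (simp add: powr_mult powr_powr)
        have a2: "a powr p = v x powr p * \<rho> x powr (-2)"
          unfolding a_def using True r p by (simp add: powr_mult powr_powr)
        have b2: "b powr p = \<bar>f x\<bar> powr p * \<rho> x powr (2 * p - 2)"
          unfolding b_def using r p by (simp add: powr_mult powr_powr)
        have z: "- 2 / p * (p - 1) + (2 * p - 2) / p = 0" using p by (simp add: field_simps)
        have "\<rho> x powr (- 2 / p * (p - 1)) * \<rho> x powr ((2 * p - 2) / p) = 1"
          using r by (simp only: powr_add[symmetric] z) simp
        then have ab: "a powr (p - 1) * b = v x powr (p - 1) * \<bar>f x\<bar>"
          unfolding a1 b_def by (simp add: mult_ac)
        have "a powr (p - 1) * b \<le> \<epsilon> * a powr p + M * b powr p"
          unfolding M_def using True by (intro young_powr[OF p \<epsilon>]) (auto simp: a_def b_def)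
        then have "v x powr (p - 1) * \<bar>f x\<bar> * \<psi> x powr c
          \<le> (\<epsilon> * (v x powr p * \<rho> x powr (-2)) + M * (\<bar>f x\<bar> powr p * \<rho> x powr (2 * p - 2))) * \<psi> x powr c"
          unfolding ab a2 b2 by (rule mult_right_mono) simp
        also have "\<dots> = \<epsilon> * (v x powr p * \<psi> x powr c * \<rho> x powr (-2)) + M * y x"
          using True by (simp add: y_def U_def algebra_simps)
        finally have "ennreal (v x powr (p - 1) * \<bar>f x\<bar> * \<psi> x powr c)
          \<le> ennreal (\<epsilon> * (v x powr p * \<psi> x powr c * \<rho> x powr (-2)) + M * y x)" by (rule ennreal_leI)
        also have "\<dots> = ennreal \<epsilon> * ennreal (v x powr p * \<psi> x powr c * \<rho> x powr (-2)) + ennreal M * ennreal (y x)"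
          using \<epsilon> M by (simp add: ennreal_plus ennreal_mult y_def)
        finally show ?thesis using True by (simp add: U_def)
      qed (simp add: U_def)
    qed
    also have "\<dots> = ennreal \<epsilon> * X + ennreal M * Y"
      unfolding X_def Yy by (subst nn_integral_add; (subst nn_integral_cmult)?; (subst nn_integral_cmult)?) measurable
    finally show ?thesis .
  qed
  have "X \<le> ennreal ((2 * C2) powr p) * Y"
  proof (cases "Y = \<infinity>")
    case True
    then show ?thesis using C2 by (simp add: ennreal_mult_top)
  next
    case False
    obtain x where x: "X = ennreal x" "0 \<le> x" using fin by (cases X) auto
    obtain y where y: "Y = ennreal y" "0 \<le> y" using False by (cases Y) auto
    have "X \<le> ennreal C2 * (ennreal \<epsilon> * X + ennreal M * Y)"
      using S2 S3 by (meson mult_left_mono order_trans zero_le)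
    also have "\<dots> = ennreal (C2 * (\<epsilon> * x + M * y))"
      using x y C2 \<epsilon> M by (simp add: ennreal_mult ennreal_plus)
    finally have "x \<le> C2 * (\<epsilon> * x + M * y)"
      using x y C2 \<epsilon> M by (simp add: ennreal_le_iff)
    also have "\<dots> = x / 2 + C2 * M * y" using C2 by (simp add: \<epsilon>_def field_simps)
    finally have "x \<le> 2 * C2 * M * y" by simp
    also have "2 * C2 * M = (2 * C2) powr p"
      using powr_diff_1[of "2 * C2" p] C2 by (simp add: M_def \<epsilon>_def mult.commute)
    finally have "ennreal x \<le> ennreal ((2 * C2) powr p * y)" by (rule ennreal_leI)
    then show ?thesis using x y by (simp add: ennreal_mult)
  qed
  then show ?thesis unfolding X_def Y_def C2_def \<rho>_def U_def f_def .
qed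

end

section \<open>Removing the smoothness of the weight\<close>

text \<open>As \<open>c < 1\<close>, the slope \<open>\<bar>c\<bar> * t powr (c - 1)\<close> is
  largest at the left end \<delta>.\<close>

lemma powr_lipschitz_above:
  fixes a b c \<delta> :: real
  assumes \<delta>: "0 < \<delta>" and c: "c < 1" and ab: "\<delta> \<le> a" "\<delta> \<le> b"
  shows "\<bar>a powr c - b powr c\<bar> \<le> \<bar>c\<bar> * \<delta> powr (c - 1) * \<bar>a - b\<bar>"
proof -
  have "norm (a powr c - b powr c) \<le> (\<bar>c\<bar> * \<delta> powr (c - 1)) * norm (a - b)"
  proof (rule field_differentiable_bound[where S = "{\<delta>..}" and f' = "\<lambda>t. c * t powr (c - 1)"])
    fix t assume t: "t \<in> {\<delta>..}"
    then have "t > 0" using \<delta> by simp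
    then show "((\<lambda>t. t powr c) has_field_derivative c * t powr (c - 1)) (at t within {\<delta>..})"
      by (rule has_field_derivative_at_within[OF has_real_derivative_powr])
    have "t powr (c - 1) \<le> \<delta> powr (c - 1)" using t \<delta> c by (intro powr_mono2') auto
    then show "norm (c * t powr (c - 1)) \<le> \<bar>c\<bar> * \<delta> powr (c - 1)"
      by (simp add: abs_mult mult_left_mono)
  qed (use ab in auto)
  then show ?thesis by simp
qed

text \<open>By homogeneity it suffices to look at the fractions \<open>a / s\<close> and
  \<open>b / s\<close>, which sum to \<open>1\<close> and do not decrease when raised to a power
  \<open>c \<le> 1\<close>.\<close>

lemma powr_add_le:
  fixes a b c :: real
  assumes "0 \<le> a" "0 \<le> b" "0 < c" "c \<le> 1"
  shows "(a + b) powr c \<le> a powr c + b powr c"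
proof (cases "a + b = 0")
  case False
  define s where "s = a + b"
  have s: "s > 0" using False assms by (simp add: s_def)
  have le: "t \<le> t powr c" if "0 \<le> t" "t \<le> 1" for t :: real
    using powr_mono'[of c 1 t] that assms by simp
  have "1 = a / s + b / s" using s by (simp add: s_def flip: add_divide_distrib)
  also have "\<dots> \<le> (a / s) powr c + (b / s) powr c"
    using assms s by (intro add_mono le) (auto simp: s_def)
  finally have "s powr c * 1 \<le> s powr c * ((a / s) powr c + (b / s) powr c)"
    by (intro mult_left_mono) auto
  also have "\<dots> = a powr c + b powr c"
    using assms s by (simp add: distrib_left powr_divide)
  finally show ?thesis by (simp add: s_def)
qed (use assms in simp)

text \<open>Since \<open>w1\<close> and \<open>w2\<close> are bounded, the Lipschitz bound turns
  \<open>L1\<close> distance of the weights into an additive error. That error is finite even if the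
  weighted integrals are not, so infinite values cause no case distinction.\<close>

lemma weight_limit_L1:
  fixes w1 w2 :: "'a \<Rightarrow> real" and g :: "nat \<Rightarrow> 'a \<Rightarrow> real"
  assumes c: "c < 1" and \<delta>: "0 < \<delta>" and N: "0 \<le> N"
    and w: "w1 \<in> borel_measurable M" "w2 \<in> borel_measurable M"
    and w1: "\<And>x. x \<in> space M \<Longrightarrow> 0 \<le> w1 x" "\<And>x. x \<in> space M \<Longrightarrow> w1 x \<le> W"
    and w2: "\<And>x. x \<in> space M \<Longrightarrow> 0 \<le> w2 x" "\<And>x. x \<in> space M \<Longrightarrow> w2 x \<le> W"
    and g: "\<And>n. integrable M (g n)" "integrable M h" "\<And>n x. 0 \<le> g n x" "\<And>x. 0 \<le> h x"
    and lim: "(\<lambda>n. \<integral>x. \<bar>g n x - h x\<bar> \<partial>M) \<longlonglongrightarrow> 0"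
    and le: "\<And>n. (\<integral>\<^sup>+x. ennreal (w1 x * (g n x + \<delta>) powr c) \<partial>M)
      \<le> ennreal N * (\<integral>\<^sup>+x. ennreal (w2 x * (g n x + \<delta>) powr c) \<partial>M)"
  shows "(\<integral>\<^sup>+x. ennreal (w1 x * (h x + \<delta>) powr c) \<partial>M)
      \<le> ennreal N * (\<integral>\<^sup>+x. ennreal (w2 x * (h x + \<delta>) powr c) \<partial>M)"
proof -
  define Lc where "Lc = \<bar>W\<bar> * (\<bar>c\<bar> * \<delta> powr (c - 1))"
  have Lc: "0 \<le> Lc" by (simp add: Lc_def)
  note [measurable] = w borel_measurable_integrable[OF g(1)] borel_measurable_integrable[OF g(2)]
  have close: "(\<integral>\<^sup>+x. ennreal (w x * (a x + \<delta>) powr c) \<partial>M)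
      \<le> (\<integral>\<^sup>+x. ennreal (w x * (b x + \<delta>) powr c) \<partial>M) + ennreal (Lc * (\<integral>x. \<bar>a x - b x\<bar> \<partial>M))"
    if [measurable]: "w \<in> borel_measurable M" and w: "\<And>x. x \<in> space M \<Longrightarrow> 0 \<le> w x" "\<And>x. x \<in> space M \<Longrightarrow> w x \<le> W"
      and ab: "integrable M a" "integrable M b" "\<And>x. 0 \<le> a x" "\<And>x. 0 \<le> b x" for w a b :: "'a \<Rightarrow> real"
  proof -
    note [measurable] = borel_measurable_integrable[OF ab(1)] borel_measurable_integrable[OF ab(2)]
    have "(\<integral>\<^sup>+x. ennreal (w x * (a x + \<delta>) powr c) \<partial>M)
        \<le> (\<integral>\<^sup>+x. ennreal (w x * (b x + \<delta>) powr c) + ennreal (Lc * \<bar>a x - b x\<bar>) \<partial>M)"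
    proof (rule nn_integral_mono)
      fix x assume x: "x \<in> space M"
      have "\<bar>(a x + \<delta>) powr c - (b x + \<delta>) powr c\<bar> \<le> \<bar>c\<bar> * \<delta> powr (c - 1) * \<bar>(a x + \<delta>) - (b x + \<delta>)\<bar>"
        using ab(3,4)[of x] by (intro powr_lipschitz_above[OF \<delta> c]) auto
      then have "(a x + \<delta>) powr c - (b x + \<delta>) powr c \<le> \<bar>c\<bar> * \<delta> powr (c - 1) * \<bar>a x - b x\<bar>" by simp
      then have "w x * ((a x + \<delta>) powr c - (b x + \<delta>) powr c) \<le> w x * (\<bar>c\<bar> * \<delta> powr (c - 1) * \<bar>a x - b x\<bar>)"
        by (intro mult_left_mono w(1)[OF x])
      also have "\<dots> \<le> \<bar>W\<bar> * (\<bar>c\<bar> * \<delta> powr (c - 1) * \<bar>a x - b x\<bar>)"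
        using w(2)[OF x] by (intro mult_right_mono) auto
      also have "\<dots> = Lc * \<bar>a x - b x\<bar>" by (simp add: Lc_def)
      finally have "w x * (a x + \<delta>) powr c \<le> w x * (b x + \<delta>) powr c + Lc * \<bar>a x - b x\<bar>"
        by (simp add: right_diff_distrib)
      then have "ennreal (w x * (a x + \<delta>) powr c) \<le> ennreal (w x * (b x + \<delta>) powr c + Lc * \<bar>a x - b x\<bar>)"
        by (rule ennreal_leI)
      also have "\<dots> = ennreal (w x * (b x + \<delta>) powr c) + ennreal (Lc * \<bar>a x - b x\<bar>)"
        using w(1)[OF x] Lc by (intro ennreal_plus) auto
      finally show "ennreal (w x * (a x + \<delta>) powr c) \<le> ennreal (w x * (b x + \<delta>) powr c) + ennreal (Lc * \<bar>a x - b x\<bar>)" .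
    qed
    also have "\<dots> = (\<integral>\<^sup>+x. ennreal (w x * (b x + \<delta>) powr c) \<partial>M) + (\<integral>\<^sup>+x. ennreal (Lc * \<bar>a x - b x\<bar>) \<partial>M)"
      by (rule nn_integral_add) measurable
    also have "(\<integral>\<^sup>+x. ennreal (Lc * \<bar>a x - b x\<bar>) \<partial>M) = ennreal (\<integral>x. Lc * \<bar>a x - b x\<bar> \<partial>M)"
      using ab(1,2) Lc by (intro nn_integral_eq_integral) auto
    finally show ?thesis by simp
  qed
  show ?thesis
  proof (rule ennreal_le_epsilon)
    fix e :: real assume e: "0 < e"
    \<comment> \<open>Replacing \<open>g n\<close> by \<open>h\<close> costs \<open>E\<close> on the
      left and \<open>N * E\<close> on the right.\<close>
    have "(\<lambda>n. (N + 1) * Lc * (\<integral>x. \<bar>g n x - h x\<bar> \<partial>M)) \<longlonglongrightarrow> 0"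
      using tendsto_mult_right_zero[OF lim] by simp
    from order_tendstoD(2)[OF this e] obtain n where n: "(N + 1) * Lc * (\<integral>x. \<bar>g n x - h x\<bar> \<partial>M) < e"
      by (auto simp: eventually_sequentially)
    define E where "E = Lc * (\<integral>x. \<bar>g n x - h x\<bar> \<partial>M)"
    have E: "0 \<le> E" unfolding E_def using Lc by simp
    have sym: "Lc * (\<integral>x. \<bar>h x - g n x\<bar> \<partial>M) = E" by (simp add: E_def abs_minus_commute)
    have "(\<integral>\<^sup>+x. ennreal (w1 x * (h x + \<delta>) powr c) \<partial>M)
        \<le> (\<integral>\<^sup>+x. ennreal (w1 x * (g n x + \<delta>) powr c) \<partial>M) + ennreal E"
      using close[OF w(1) w1 g(2) g(1) g(4) g(3), of n] unfolding sym by simp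
    also have "\<dots> \<le> ennreal N * (\<integral>\<^sup>+x. ennreal (w2 x * (g n x + \<delta>) powr c) \<partial>M) + ennreal E"
      by (intro add_right_mono le)
    also have "\<dots> \<le> ennreal N * ((\<integral>\<^sup>+x. ennreal (w2 x * (h x + \<delta>) powr c) \<partial>M) + ennreal E) + ennreal E"
      using close[OF w(2) w2 g(1) g(2) g(3) g(4), of n] unfolding E_def
      by (intro add_right_mono mult_left_mono) auto
    also have "\<dots> = ennreal N * (\<integral>\<^sup>+x. ennreal (w2 x * (h x + \<delta>) powr c) \<partial>M) + ennreal ((N + 1) * E)"
      using N E by (simp add: distrib_left distrib_right ennreal_mult ennreal_plus add.assoc)
    also have "\<dots> \<le> ennreal N * (\<integral>\<^sup>+x. ennreal (w2 x * (h x + \<delta>) powr c) \<partial>M) + ennreal e"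
      using n by (intro add_left_mono ennreal_leI) (simp add: E_def mult.assoc)
    finally show "(\<integral>\<^sup>+x. ennreal (w1 x * (h x + \<delta>) powr c) \<partial>M)
        \<le> ennreal N * (\<integral>\<^sup>+x. ennreal (w2 x * (h x + \<delta>) powr c) \<partial>M) + ennreal e" .
  qed
qed

text \<open>Positivity of \<open>h\<close> where \<open>w1\<close> or \<open>w2\<close> is nonzero
  matters: \<open>0 powr c\<close> is \<open>0\<close> even for \<open>c \<le> 0\<close>, which is
  not the limit of \<open>\<delta> powr c\<close>.\<close>

lemma weight_limit_shift:
  fixes w1 w2 h :: "'a \<Rightarrow> real"
  assumes c: "c < 1" and N: "0 \<le> N"
    and meas: "w1 \<in> borel_measurable M" "w2 \<in> borel_measurable M" "h \<in> borel_measurable M"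
    and w1: "\<And>x. x \<in> space M \<Longrightarrow> 0 \<le> w1 x" and w2: "\<And>x. x \<in> space M \<Longrightarrow> 0 \<le> w2 x" "integrable M w2"
    and h: "\<And>x. 0 \<le> h x" "AE x in M. w1 x \<noteq> 0 \<longrightarrow> 0 < h x" "AE x in M. w2 x \<noteq> 0 \<longrightarrow> 0 < h x"
    and le: "\<And>\<delta>. 0 < \<delta> \<Longrightarrow> (\<integral>\<^sup>+x. ennreal (w1 x * (h x + \<delta>) powr c) \<partial>M)
      \<le> ennreal N * (\<integral>\<^sup>+x. ennreal (w2 x * (h x + \<delta>) powr c) \<partial>M)"
  shows "(\<integral>\<^sup>+x. ennreal (w1 x * h x powr c) \<partial>M) \<le> ennreal N * (\<integral>\<^sup>+x. ennreal (w2 x * h x powr c) \<partial>M)"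
proof (rule ennreal_le_epsilon)
  fix e :: real assume e: "0 < e"
  note [measurable] = meas
  define Y where "Y = (\<integral>\<^sup>+x. ennreal (w2 x * h x powr c) \<partial>M)"
  define \<delta> where "\<delta> k = inverse (real (Suc k))" for k
  have \<delta>: "0 < \<delta> k" "\<delta> \<longlonglongrightarrow> 0" for k using LIMSEQ_inverse_real_of_nat by (auto simp: \<delta>_def[abs_def])
  \<comment> \<open>For \<open>c \<le> 0\<close> the right side can only grow when the shift
    disappears, so there is no error; for \<open>0 < c\<close> subadditivity leaves
    \<open>\<delta> k powr c\<close> times the integral of \<open>w2\<close>.\<close>
  define E where "E k = (if 0 < c then \<delta> k powr c * integral\<^sup>L M w2 else 0)" for k
  have I: "0 \<le> integral\<^sup>L M w2" using w2(1) by (intro Bochner_Integration.integral_nonneg)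
  have E0: "0 \<le> E k" for k using I by (simp add: E_def)
  have E: "E \<longlonglongrightarrow> 0"
  proof (cases "0 < c")
    case True
    have "(\<lambda>k. \<delta> k powr c * integral\<^sup>L M w2) \<longlonglongrightarrow> 0 powr c * integral\<^sup>L M w2"
      using True \<delta>(1) by (intro tendsto_mult tendsto_const tendsto_powr2 \<delta>(2)) (auto simp: less_imp_le)
    then show ?thesis using True by (simp add: E_def[abs_def])
  qed (simp add: E_def[abs_def])
  have upper: "(\<integral>\<^sup>+x. ennreal (w2 x * (h x + \<delta> k) powr c) \<partial>M) \<le> Y + ennreal (E k)" for k
  proof (cases "0 < c")
    case True
    have "(\<integral>\<^sup>+x. ennreal (w2 x * (h x + \<delta> k) powr c) \<partial>M)
        \<le> (\<integral>\<^sup>+x. ennreal (w2 x * h x powr c) + ennreal (\<delta> k powr c * w2 x) \<partial>M)"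
    proof (rule nn_integral_mono)
      fix x assume x: "x \<in> space M"
      have "w2 x * (h x + \<delta> k) powr c \<le> w2 x * (h x powr c + \<delta> k powr c)"
        using True c h(1) \<delta>(1)[of k] by (intro mult_left_mono powr_add_le w2(1)[OF x]) auto
      then have "ennreal (w2 x * (h x + \<delta> k) powr c) \<le> ennreal (w2 x * h x powr c + \<delta> k powr c * w2 x)"
        by (intro ennreal_leI) (simp add: distrib_left mult.commute)
      then show "ennreal (w2 x * (h x + \<delta> k) powr c) \<le> ennreal (w2 x * h x powr c) + ennreal (\<delta> k powr c * w2 x)"
        using w2(1)[OF x] by simp
    qed
    also have "\<dots> = Y + (\<integral>\<^sup>+x. ennreal (\<delta> k powr c * w2 x) \<partial>M)"
      unfolding Y_def by (rule nn_integral_add) measurable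
    also have "(\<integral>\<^sup>+x. ennreal (\<delta> k powr c * w2 x) \<partial>M) = ennreal (\<integral>x. \<delta> k powr c * w2 x \<partial>M)"
      using w2 by (intro nn_integral_eq_integral integrable_mult_right AE_I2) auto
    finally show ?thesis using True by (simp add: E_def)
  next
    case False
    have "(\<integral>\<^sup>+x. ennreal (w2 x * (h x + \<delta> k) powr c) \<partial>M) \<le> Y"
      unfolding Y_def
    proof (rule nn_integral_mono_AE)
      show "AE x in M. ennreal (w2 x * (h x + \<delta> k) powr c) \<le> ennreal (w2 x * h x powr c)"
        using h(3) AE_space
      proof eventually_elim
        case (elim x)
        show ?case
        proof (cases "w2 x = 0")
          case F: False
          then have "(h x + \<delta> k) powr c \<le> h x powr c"
            using elim(1) False \<delta>(1)[of k] by (intro powr_mono2') auto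
          then show ?thesis using w2(1)[OF elim(2)] by (intro ennreal_leI mult_left_mono) auto
        qed simp
      qed
    qed
    also have "Y \<le> Y + ennreal (E k)" by simp
    finally show ?thesis .
  qed
  have "(\<lambda>k. N * E k) \<longlonglongrightarrow> 0" using tendsto_mult_right_zero[OF E] by simp
  from order_tendstoD(2)[OF this e] have ev: "\<forall>\<^sub>F k in sequentially. N * E k < e" .
  have "(\<integral>\<^sup>+x. ennreal (w1 x * h x powr c) \<partial>M) \<le> (\<integral>\<^sup>+x. liminf (\<lambda>k. ennreal (w1 x * (h x + \<delta> k) powr c)) \<partial>M)"
  proof (rule nn_integral_mono_AE)
    show "AE x in M. ennreal (w1 x * h x powr c) \<le> liminf (\<lambda>k. ennreal (w1 x * (h x + \<delta> k) powr c))"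
      using h(2)
    proof eventually_elim
      case (elim x)
      show ?case
      proof (cases "w1 x = 0")
        case False
        have "(\<lambda>k. w1 x * (h x + \<delta> k) powr c) \<longlonglongrightarrow> w1 x * (h x + 0) powr c"
          using elim False by (intro tendsto_mult tendsto_const tendsto_powr tendsto_add \<delta>(2)) auto
        from lim_imp_Liminf[OF _ tendsto_ennrealI[OF this]] show ?thesis by simp
      qed simp
    qed
  qed
  also have "\<dots> \<le> liminf (\<lambda>k. \<integral>\<^sup>+x. ennreal (w1 x * (h x + \<delta> k) powr c) \<partial>M)"
    by (rule nn_integral_liminf) measurable
  also have "\<dots> \<le> liminf (\<lambda>k::nat. ennreal N * Y + ennreal e)"
  proof (rule Liminf_mono, use ev in eventually_elim)
    case (elim k)
    have "(\<integral>\<^sup>+x. ennreal (w1 x * (h x + \<delta> k) powr c) \<partial>M) \<le> ennreal N * (Y + ennreal (E k))"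
      using le[OF \<delta>(1)[of k]] mult_left_mono[OF upper[of k], of "ennreal N"] by (meson order_trans zero_le)
    also have "\<dots> = ennreal N * Y + ennreal (N * E k)"
      using N E0 by (simp add: distrib_left ennreal_mult)
    also have "\<dots> \<le> ennreal N * Y + ennreal e" using elim by (intro add_left_mono ennreal_leI) simp
    finally show ?case .
  qed
  also have "\<dots> = ennreal N * Y + ennreal e" by (simp add: Liminf_const)
  finally show "(\<integral>\<^sup>+x. ennreal (w1 x * h x powr c) \<partial>M) \<le> ennreal N * (\<integral>\<^sup>+x. ennreal (w2 x * h x powr c) \<partial>M) + ennreal e"
    unfolding Y_def .
qed

section \<open>From \<open>u\<close> and \<phi> to the data of the smooth-weight estimate\<close>

lemma continuous_on_restrict:
  assumes "continuous_map (subtopology (Rd d) S) euclideanreal g"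
  shows "continuous_on {x. restrict x {..<d} \<in> S} (\<lambda>x. g (restrict x {..<d}))"
proof -
  have "continuous_map (subtopology euclidean {x. restrict x {..<d} \<in> S}) (subtopology (Rd d) S) (\<lambda>x. restrict x {..<d})"
    by (rule continuous_map_into_subtopology[OF continuous_map_from_subtopology[OF continuous_map_euclidean_Rd]]) auto
  from continuous_map_compose[OF this assms] show ?thesis by (simp add: comp_def)
qed

lemma open_restrict_preimage:
  assumes "openin (Rd d) S" shows "open {x. restrict x {..<d} \<in> S}"
  using openin_continuous_map_preimage[OF continuous_map_euclidean_Rd assms] by simp

text \<open>Changing a coordinate below \<open>d\<close> keeps a point extensional, so
  \<open>restrict\<close> is invisible to these partial derivatives. The scalar \<open>s\<close>
  will be the locally constant sign of \<open>u\<close>.\<close>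

lemma has_partial_restrict:
  assumes "(\<lambda>t. g (x(i := t))) differentiable (at (x i))" "x \<in> topspace (Rd d)" "i < d"
  shows "has_partial i (\<lambda>y. s * g (restrict y {..<d})) x (s * partial i g x)"
proof -
  have "restrict (x(i := t)) {..<d} = x(i := t)" for t
    using assms(2,3) by (auto simp: PiE_iff extensional_def restrict_def fun_eq_iff)
  moreover have "((\<lambda>t. g (x(i := t))) has_real_derivative partial i g x) (at (x i))"
    using assms(1) unfolding partial_def by (simp add: DERIV_deriv_iff_real_differentiable)
  ultimately show ?thesis unfolding has_partial_def by (auto intro: DERIV_cmult)
qed

lemma mollify_nonneg:
  assumes "mollifier_family r B" "\<And>x. 0 \<le> f x"
  shows "0 \<le> mollify d B f (\<lambda>_. 0) x"
  unfolding mollify_def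
  by (intro Bochner_Integration.integral_nonneg mult_nonneg_nonneg assms(2) kernel_nonneg[OF assms(1)])

text \<open>Mollification asks for a function that is integrable for the product measure and
  nonnegative at every point. Clipping a measurable representative at \<open>0\<close> changes it on
  a null set only.\<close>

lemma superharmonic_cutoff:
  assumes sh: "superharmonic d \<Omega> \<phi>" and pos: "AE x in leb d. x \<in> \<Omega> \<longrightarrow> 0 < \<phi> x"
    and K': "compact K'" "K' \<subseteq> \<Omega>" "K' \<subseteq> topspace (Rd d)"
  obtains g where "integrable (lebm d) g" "\<And>x. 0 \<le> g x"
    "AE x in lebm d. g x = indicator K' x * \<phi> x" "AE x in lebm d. x \<in> K' \<longrightarrow> 0 < g x"
proof -
  have "compactin (Rd d) K'" using K' by (simp add: compactin_Rd_iff)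
  then have "set_integrable (leb d) K' \<phi>"
    using sh K'(2) by (simp add: superharmonic_def locally_integrable_def)
  then have i: "integrable (completion (lebm d)) (\<lambda>x. indicator K' x * \<phi> x)"
    by (simp add: set_integrable_def leb_def)
  from completion_ex_borel_measurable_real[OF borel_measurable_integrable[OF i]]
  obtain g1 where g1: "g1 \<in> borel_measurable (lebm d)" "AE x in lebm d. indicator K' x * \<phi> x = g1 x"
    by auto
  have pos': "AE x in lebm d. x \<in> \<Omega> \<longrightarrow> 0 < \<phi> x"
    using pos unfolding leb_def AE_completion_iff .
  define g where "g x = max 0 (g1 x)" for x
  have gm: "g \<in> borel_measurable (lebm d)" unfolding g_def using g1(1) by measurable
  have eq: "AE x in lebm d. g x = indicator K' x * \<phi> x"
    using g1(2) pos'
  proof eventually_elim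
    case (elim x)
    then show ?case using K'(2) by (cases "x \<in> K'") (auto simp: g_def max_def)
  qed
  have "integrable (completion (lebm d)) g"
    using i
    by (rule integrable_cong_AE_imp)
       (use measurable_completion[OF gm] AE_completion[OF eq] in \<open>auto elim: eventually_mono\<close>)
  then have "integrable (lebm d) g" using integrable_completion[OF gm] by simp
  moreover have "AE x in lebm d. x \<in> K' \<longrightarrow> 0 < g x"
    using eq pos' by eventually_elim (use K'(2) in auto)
  ultimately show ?thesis using that[of g] eq by (simp add: g_def)
qed

lemma weighted_estimate_superharmonic:
  assumes p: "1 < p" and c: "- p + 1 < c" "c < 1"
    and \<Omega>: "openin (Rd d) \<Omega>" "\<Omega> \<noteq> topspace (Rd d)" "\<Omega> \<noteq> {}" and hardy: "hardy_inequality d \<Omega> C0"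
    and sh: "superharmonic d \<Omega> \<phi>" and pos: "AE x in leb d. x \<in> \<Omega> \<longrightarrow> 0 < \<phi> x"
    and u: "continuous_map (subtopology (Rd d) \<Omega>) euclideanreal u" "compactly_supported_in d \<Omega> u"
      "C_on d 2 {x \<in> \<Omega>. u x \<noteq> 0} u"
    and lap: "\<forall>x\<in>\<Omega>. u x \<noteq> 0 \<longrightarrow> \<bar>laplacian d u x\<bar> \<le> Bd" and lam: "0 \<le> lam"
  shows "(\<integral>\<^sup>+x\<in>\<Omega>. ennreal (\<bar>u x\<bar> powr p * \<phi> x powr c * bdry_dist d \<Omega> x powr (- 2)) \<partial>leb d)
    \<le> ennreal ((2 * energy_const p c C0) powr p) *
      (\<integral>\<^sup>+x\<in>{x \<in> \<Omega>. u x \<noteq> 0}. ennreal (\<bar>laplacian d u x - lam * u x\<bar> powr p * \<phi> x powr c *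
         bdry_dist d \<Omega> x powr (2 * p - 2)) \<partial>leb d)"
proof -
  define T where "T = topspace (Rd d)"
  have \<Omega>t: "\<Omega> \<subseteq> T" unfolding T_def by (rule openin_subset[OF \<Omega>(1)])
  define r where "r x = restrict x {..<d}" for x :: "nat \<Rightarrow> real"
  have rx: "r x = x" if "x \<in> T" for x using that by (simp add: r_def T_def PiE_iff extensional_restrict)
  have fr: "Rd d frontier_of \<Omega> \<noteq> {}" using frontier_nonempty[OF \<Omega>(1,3,2)] .
  define \<rho> where "\<rho> = bdry_dist d \<Omega>"
  have \<rho>: "continuous_on UNIV \<rho>" "0 \<le> \<rho> x" "x \<in> \<Omega> \<Longrightarrow> 0 < \<rho> x" for x
    unfolding \<rho>_def using continuous_bdry_dist[OF fr] bdry_dist_nonneg[OF fr] bdry_dist_pos[OF fr \<Omega>(1)] by auto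
  define Uu where "Uu = {x \<in> \<Omega>. u x \<noteq> 0}"
  define K where "K = Rd d closure_of Uu"
  have Kc: "compactin (Rd d) K" and K\<Omega>: "K \<subseteq> \<Omega>"
    using u(2) by (auto simp: compactly_supported_in_def K_def Uu_def)
  have K: "compact K" "K \<subseteq> T" using Kc by (auto simp: compactin_Rd_iff T_def)
  have UK: "Uu \<subseteq> K" unfolding K_def using \<Omega>t by (intro closure_of_subset) (auto simp: Uu_def T_def)
  define V where "V = {x. r x \<in> \<Omega>}"
  have V: "open V" unfolding V_def r_def by (rule open_restrict_preimage[OF \<Omega>(1)])
  have uV: "continuous_on V (\<lambda>x. u (r x))" unfolding V_def r_def by (rule continuous_on_restrict[OF u(1)])
  \<comment> \<open>Composition with \<open>r\<close> gives a function on the whole type; extension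
    by zero stays continuous because the support of \<open>u\<close> is a compact subset of
    \<Omega>.\<close>
  define v where "v x = (if r x \<in> \<Omega> then \<bar>u (r x)\<bar> else 0)" for x
  have v0: "0 \<le> v x" for x by (simp add: v_def)
  have vpos: "0 < v x \<longleftrightarrow> r x \<in> Uu" for x by (auto simp: v_def Uu_def)
  \<comment> \<open>Glue along two open sets: on \<open>V\<close> the function is the absolute value
    of \<open>u\<close>, and off the closed preimage of \<open>K\<close> it is zero.\<close>
  have vc: "continuous_on UNIV v"
  proof -
    have "open (- {x. r x \<in> K})"
    proof -
      have "openin (Rd d) (topspace (Rd d) - K)" unfolding K_def by (rule openin_diff[OF openin_topspace closedin_closure_of])
      from open_restrict_preimage[OF this] have "open {x. r x \<in> topspace (Rd d) - K}" by (simp add: r_def)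
      moreover have "{x. r x \<in> topspace (Rd d) - K} = - {x. r x \<in> K}" by (auto simp: r_def)
      ultimately show ?thesis by simp
    qed
    moreover have "continuous_on V v"
      by (rule continuous_on_eq[OF continuous_on_rabs[OF uV]]) (simp add: v_def V_def)
    moreover have "continuous_on (- {x. r x \<in> K}) v"
      by (rule continuous_on_eq[OF continuous_on_const[of _ 0]]) (use UK in \<open>auto simp: v_def Uu_def\<close>)
    moreover have "V \<union> - {x. r x \<in> K} = UNIV" using K\<Omega> by (auto simp: V_def)
    ultimately show ?thesis using continuous_on_open_Un[OF V, of "- {x. r x \<in> K}" v] by simp
  qed
  define du where "du i x = sgn (u (r x)) * partial i u (r x)" for i x
  define ddu where "ddu i x = sgn (u (r x)) * partial i (partial i u) (r x)" for i x
  have C2: "(\<lambda>t. u (x(i := t))) differentiable (at (x i))" "(\<lambda>t. partial i u (x(i := t))) differentiable (at (x i))"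
    if "i < d" "x \<in> Uu" for i x
    using u(3) that unfolding Uu_def[symmetric] numeral_2_eq_2 by auto
  have C2c: "continuous_map (subtopology (Rd d) Uu) euclideanreal (partial i u)"
    "continuous_map (subtopology (Rd d) Uu) euclideanreal (partial i (partial i u))" if "i < d" for i
    using u(3) that unfolding Uu_def[symmetric] numeral_2_eq_2 by auto
  have Uset: "{x. 0 < v x} = {x. r x \<in> Uu}" by (auto simp: vpos)
  have sgnc: "continuous_on {x. 0 < v x} (\<lambda>x. sgn (u (r x)))"
    by (intro continuous_on_sgn continuous_on_subset[OF uV]) (auto simp: Uset Uu_def V_def)
  have duc: "continuous_on {x. 0 < v x} (du i)" "continuous_on {x. 0 < v x} (ddu i)" if "i < d" for i
    unfolding du_def ddu_def
    by (intro continuous_on_mult sgnc; unfold Uset r_def; rule continuous_on_restrict; rule C2c[OF that])+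
  \<comment> \<open>The sign of \<open>u\<close> is locally constant where \<open>u\<close> is
    nonzero, so derivatives of the absolute value are those of \<open>u\<close> times a fixed
    sign.\<close>
  have near: "\<exists>O'. open O' \<and> x \<in> O' \<and> (\<forall>y\<in>O'. r y \<in> Uu \<and> sgn (u (r y)) = sgn (u x))"
    if x: "x \<in> T" "0 < v x" for x
  proof -
    have xU: "x \<in> Uu" using x rx vpos by auto
    let ?O = "V \<inter> (\<lambda>y. sgn (u x) * u (r y)) -` {0<..}"
    have "open ?O" by (intro continuous_open_preimage continuous_on_mult continuous_on_const uV V) auto
    moreover have "x \<in> ?O" using xU rx[OF x(1)] by (auto simp: V_def Uu_def sgn_if)
    moreover have "r y \<in> Uu \<and> sgn (u (r y)) = sgn (u x)" if "y \<in> ?O" for y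
      using that by (auto simp: V_def Uu_def sgn_if zero_less_mult_iff split: if_splits)
    ultimately show ?thesis by blast
  qed
  have pv: "has_partial i v x (du i x)" "has_partial i (du i) x (ddu i x)"
    if i: "i < d" and x: "x \<in> topspace (Rd d)" "0 < v x" for i x
  proof -
    have xT: "x \<in> T" using x by (simp add: T_def)
    have xU: "x \<in> Uu" using x(2) vpos rx[OF xT] by simp
    obtain O' where O': "open O'" "x \<in> O'" "\<And>y. y \<in> O' \<Longrightarrow> r y \<in> Uu \<and> sgn (u (r y)) = sgn (u x)"
      using near[OF xT x(2)] by blast
    have eq1: "v y = sgn (u x) * u (restrict y {..<d})" if "y \<in> O'" for y
      using O'(3)[OF that] unfolding r_def[symmetric] by (auto simp: v_def Uu_def sgn_if split: if_splits)
    show "has_partial i v x (du i x)"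
      unfolding du_def rx[OF xT]
      by (rule has_partial_cong[OF O'(1,2) eq1, THEN iffD2, OF _ has_partial_restrict[OF C2(1)[OF i xU] x(1) i]])
    have eq2: "du i y = sgn (u x) * partial i u (restrict y {..<d})" if "y \<in> O'" for y
      using O'(3)[OF that] unfolding r_def[symmetric] by (simp add: du_def)
    show "has_partial i (du i) x (ddu i x)"
      unfolding ddu_def rx[OF xT]
      by (rule has_partial_cong[OF O'(1,2) eq2, THEN iffD2, OF _ has_partial_restrict[OF C2(2)[OF i xU] x(1) i]])
  qed
  have ddu_lap: "(\<Sum>i<d. ddu i x) = sgn (u x) * laplacian d u x" if "x \<in> T" for x
    using rx[OF that] by (simp add: ddu_def laplacian_def sum_distrib_left)
  obtain r0 K' where r0: "r0 > 0" and K': "compact K'" "K \<subseteq> K'" "K' \<subseteq> \<Omega>"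
    and nb: "\<And>x y. x \<in> K \<Longrightarrow> y \<in> topspace (Rd d) \<Longrightarrow> (\<forall>j<d. \<bar>x j - y j\<bar> < r0) \<Longrightarrow> y \<in> K'"
    using compact_neighborhood[OF \<Omega>(1) K(1) K\<Omega>] by metis
  have K't: "K' \<subseteq> topspace (Rd d)" using K'(3) \<Omega>t by (simp add: T_def)
  obtain g where g: "integrable (lebm d) g" "\<And>x. 0 \<le> g x"
    "AE x in lebm d. g x = indicator K' x * \<phi> x" "AE x in lebm d. x \<in> K' \<longrightarrow> 0 < g x"
    using superharmonic_cutoff[OF sh pos K'(1,3) K't] by blast
  obtain rr B where B: "\<And>n::nat. mollifier_family (rr n) (B n)" "rr \<longlonglongrightarrow> 0" "\<And>n. rr n \<le> 1" "\<And>n. rr n \<le> r0"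
    using mollifier_sequence[OF r0] by metis
  define N where "N = (2 * energy_const p c C0) powr p"
  define m where "m n = mollify d (B n) g (\<lambda>_. 0)" for n
  have mi: "integrable (lebm d) (m n)" for n unfolding m_def by (rule mollify_L1_contraction(1)[OF B(1) g(1)])
  have m0: "0 \<le> m n x" for n x unfolding m_def by (rule mollify_nonneg[OF B(1) g(2)])
  define f where "f x = (\<Sum>i<d. ddu i x) - lam * v x" for x
  define w1 where "w1 x = v x powr p * \<rho> x powr (-2)" for x
  define w2 where "w2 x = indicator {x. 0 < v x} x * (\<bar>f x\<bar> powr p * \<rho> x powr (2 * p - 2))" for x
  have vK: "v x = 0" if "x \<in> topspace (Rd d)" "x \<notin> K" for x
    using that UK rx v0[of x] vpos[of x] by (force simp: T_def)
  \<comment> \<open>The shifted mollification is positive everywhere, but its superharmonicity is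
    established only at points of \<open>K\<close>, whose mollification boxes stay inside
    \<open>K'\<close>.\<close>
  have smooth: "smooth_weight d p c C0 \<Omega> K v du ddu (\<lambda>x. m n x + \<delta>)
      (\<lambda>i. mollify d (B n) g ((\<lambda>_. 0)(i := 1))) (\<lambda>i. mollify d (B n) g ((\<lambda>_. 0)(i := 2)))"
    if \<delta>: "0 < \<delta>" for n \<delta>
  proof
    show "1 < p" "- p + 1 < c" "c < 1" by (rule p c)+
    show "hardy_inequality d \<Omega> C0" "openin (Rd d) \<Omega>" by (rule hardy \<Omega>(1))+
    show "continuous_on UNIV (bdry_dist d \<Omega>)" "0 \<le> bdry_dist d \<Omega> x" for x using \<rho> by (auto simp: \<rho>_def)
    show "compact K" "K \<subseteq> \<Omega>" by (rule K K\<Omega>)+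
    show "0 < bdry_dist d \<Omega> x" if "x \<in> K" for x using that \<rho>(3)[of x] K\<Omega> by (auto simp: \<rho>_def)
    show "continuous_on UNIV v" "0 \<le> v x" for x by (rule vc v0)+
    show "v x = 0" if "x \<in> topspace (Rd d)" "x \<notin> K" for x by (rule vK[OF that])
    show "has_partial i v x (du i x)" "has_partial i (du i) x (ddu i x)"
      if "i < d" "x \<in> topspace (Rd d)" "0 < v x" for i x by (rule pv[OF that])+
    show "continuous_on {x. 0 < v x} (du i)" "continuous_on {x. 0 < v x} (ddu i)" if "i < d" for i
      by (rule duc[OF that])+
    show "continuous_on UNIV (\<lambda>x. m n x + \<delta>)"
      unfolding m_def by (intro continuous_on_add continuous_on_const continuous_mollify[OF B(1) g(1)])
    show "0 < m n x + \<delta>" for x using m0[of n x] \<delta> by simp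
    show "has_partial i (\<lambda>x. m n x + \<delta>) x (mollify d (B n) g ((\<lambda>_. 0)(i := 1)) x)" if "i < d" for i x
      using has_partial_mollify[OF B(1) g(1) that, of n "\<lambda>_. 0" x] DERIV_add[OF _ DERIV_const]
      unfolding has_partial_def m_def by fastforce
    show "has_partial i (mollify d (B n) g ((\<lambda>_. 0)(i := 1))) x (mollify d (B n) g ((\<lambda>_. 0)(i := 2)) x)"
      if "i < d" for i x
    proof -
      have "((\<lambda>_. 0)(i := 1))(i := Suc (((\<lambda>_. 0)(i := 1)) i)) = (\<lambda>_. 0 :: nat)(i := 2)" by auto
      then show ?thesis
        using has_partial_mollify[OF B(1) g(1) that, of n "(\<lambda>_. 0)(i := 1)" x] by (simp only:)
    qed
    show "continuous_on UNIV (mollify d (B n) g ((\<lambda>_. 0)(i := 1)))"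
      "continuous_on UNIV (mollify d (B n) g ((\<lambda>_. 0)(i := 2)))" for i
      by (rule continuous_mollify[OF B(1) g(1)])+
    show "(\<Sum>i<d. mollify d (B n) g ((\<lambda>_. 0)(i := 2)) x) \<le> 0" if x: "x \<in> K" for x
    proof (rule mollify_superharmonic[OF sh \<Omega>(1) K'(1,3) g(1,3) B(1)])
      fix y assume y: "y \<in> topspace (Rd d)" "\<forall>j<d. \<bar>x j - y j\<bar> < rr n"
      have "\<forall>j<d. \<bar>x j - y j\<bar> < r0" using y(2) B(4)[of n] by (metis less_le_trans)
      then show "y \<in> K'" by (rule nb[OF x y(1)])
    qed
  qed
  have sgn_f: "\<bar>f x\<bar> = \<bar>laplacian d u x - lam * u x\<bar>" if x: "x \<in> Uu" for x
  proof -
    have xT: "x \<in> T" using x \<Omega>t by (auto simp: Uu_def)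
    have "v x = sgn (u x) * u x" using x rx[OF xT] by (auto simp: v_def Uu_def sgn_if)
    then have "f x = sgn (u x) * (laplacian d u x - lam * u x)"
      unfolding f_def ddu_lap[OF xT] by (simp add: algebra_simps)
    then show ?thesis using x by (simp add: abs_mult Uu_def)
  qed
  have Bdd: "\<bar>\<Sum>i<d. ddu i x\<bar> \<le> Bd" if "x \<in> K" "0 < v x" for x
  proof -
    have xT: "x \<in> T" using that K(2) by auto
    then have xU: "x \<in> Uu" using that(2) vpos rx by auto
    show ?thesis unfolding ddu_lap[OF xT] using lap xU by (auto simp: abs_mult Uu_def)
  qed
  have step: "(\<integral>\<^sup>+x. ennreal (w1 x * (m n x + \<delta>) powr c) \<partial>lebm d)
      \<le> ennreal N * (\<integral>\<^sup>+x. ennreal (w2 x * (m n x + \<delta>) powr c) \<partial>lebm d)" if "0 < \<delta>" for n \<delta>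
  proof -
    have "(\<integral>\<^sup>+x. ennreal (w1 x * (m n x + \<delta>) powr c) \<partial>lebm d)
      = (\<integral>\<^sup>+x. ennreal (v x powr p * (m n x + \<delta>) powr c * bdry_dist d \<Omega> x powr (-2)) \<partial>lebm d)"
      by (simp add: w1_def \<rho>_def mult_ac)
    also have "\<dots> \<le> ennreal N * (\<integral>\<^sup>+x. ennreal (\<bar>(\<Sum>i<d. ddu i x) - lam * v x\<bar> powr p * (m n x + \<delta>) powr c * bdry_dist d \<Omega> x powr (2 * p - 2))
        * indicator {x. 0 < v x} x \<partial>lebm d)"
      unfolding N_def by (rule smooth_weight.weighted_estimate[OF smooth[OF that] lam Bdd])
    also have "(\<integral>\<^sup>+x. ennreal (\<bar>(\<Sum>i<d. ddu i x) - lam * v x\<bar> powr p * (m n x + \<delta>) powr c * bdry_dist d \<Omega> x powr (2 * p - 2))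
        * indicator {x. 0 < v x} x \<partial>lebm d) = (\<integral>\<^sup>+x. ennreal (w2 x * (m n x + \<delta>) powr c) \<partial>lebm d)"
      by (intro nn_integral_cong) (auto simp: w2_def f_def \<rho>_def indicator_def mult_ac)
    finally show ?thesis .
  qed
  obtain b1 where b1: "\<And>x. x \<in> K \<Longrightarrow> \<bar>v x\<bar> \<le> b1" using compact_bounded_fun[OF vc K(1)] by blast
  obtain b2 where b2: "\<And>x. x \<in> K \<Longrightarrow> \<bar>\<rho> x\<bar> \<le> b2" using compact_bounded_fun[OF \<rho>(1) K(1)] by blast
  \<comment> \<open>The power \<open>-2\<close> calls for a positive lower bound of the distance on
    \<open>K\<close>; the value \<open>1\<close> serves when \<open>K\<close> is empty.\<close>
  obtain b3 where b3: "0 < b3" "\<And>x. x \<in> K \<Longrightarrow> b3 \<le> \<rho> x"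
  proof (cases "K = {}")
    case False
    from continuous_attains_inf[OF K(1) False continuous_on_subset[OF \<rho>(1) subset_UNIV]]
    obtain x0 where "x0 \<in> K" "\<forall>y\<in>K. \<rho> x0 \<le> \<rho> y" by blast
    then show ?thesis using that[of "\<rho> x0"] \<rho>(3)[of x0] K\<Omega> by blast
  qed (use that[of 1] in auto)
  define W where "W = max (\<bar>b1\<bar> powr p * b3 powr (-2)) ((\<bar>Bd\<bar> + lam * \<bar>b1\<bar>) powr p * \<bar>b2\<bar> powr (2 * p - 2))"
  have W0: "0 \<le> W" by (simp add: W_def le_max_iff_disj)
  have w10: "0 \<le> w1 x" "0 \<le> w2 x" for x by (auto simp: w1_def w2_def)
  have w1W: "w1 x \<le> W" if "x \<in> space (lebm d)" for x
  proof (cases "x \<in> K")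
    case True
    have "w1 x \<le> \<bar>b1\<bar> powr p * b3 powr (-2)"
      unfolding w1_def using b1[OF True] b3(1) b3(2)[OF True] v0[of x] p
      by (intro mult_mono powr_mono2 powr_mono2') auto
    then show ?thesis by (simp add: W_def)
  next
    case False
    then show ?thesis using that vK[of x] W0 by (simp add: w1_def space_lebm)
  qed
  have w20: "w2 x = 0" if "x \<in> topspace (Rd d)" "x \<notin> K" for x
    using vK[OF that] by (simp add: w2_def)
  have w2W: "w2 x \<le> W" if "x \<in> space (lebm d)" for x
  proof (cases "x \<in> K \<and> 0 < v x")
    case True
    have "\<bar>f x\<bar> \<le> \<bar>\<Sum>i<d. ddu i x\<bar> + \<bar>lam * v x\<bar>" unfolding f_def by (rule abs_triangle_ineq4)
    also have "\<dots> \<le> \<bar>Bd\<bar> + lam * \<bar>b1\<bar>"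
      using Bdd[of x] b1[of x] lam True by (intro add_mono) (auto simp: abs_mult intro!: mult_left_mono)
    finally have "w2 x \<le> (\<bar>Bd\<bar> + lam * \<bar>b1\<bar>) powr p * \<bar>b2\<bar> powr (2 * p - 2)"
      unfolding w2_def using True b2[of x] \<rho>(2)[of x] p
      by (simp, intro mult_mono powr_mono2) auto
    then show ?thesis by (simp add: W_def)
  next
    case False
    have "w2 x = 0"
    proof (cases "x \<in> K")
      case True
      then show ?thesis using False by (simp add: w2_def)
    next
      case F: False
      show ?thesis by (rule w20[OF that[unfolded space_lebm] F])
    qed
    then show ?thesis using W0 by simp
  qed
  have Ub: "{x. 0 < v x} \<in> sets borel" using vc by (intro borel_open open_Collect_less continuous_on_const)
  have fU: "(\<lambda>x. indicator {x. 0 < v x} x * f x) \<in> borel_measurable (lebm d)"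
  proof -
    have "continuous_on {x. 0 < v x} f" unfolding f_def
      by (intro continuous_on_diff continuous_on_sum continuous_on_mult continuous_on_const
          continuous_on_subset[OF vc subset_UNIV] duc(2)) auto
    from borel_measurable_continuous_on_indicator[OF Ub this]
    show ?thesis by (intro borel_measurable_lebm) simp
  qed
  have [measurable]: "\<rho> \<in> borel_measurable (lebm d)" "v \<in> borel_measurable (lebm d)"
    by (intro borel_measurable_lebm_continuous \<rho>(1) vc)+
  have w1m: "w1 \<in> borel_measurable (lebm d)" unfolding w1_def by measurable
  have w2m: "w2 \<in> borel_measurable (lebm d)"
  proof -
    have "w2 = (\<lambda>x. \<bar>indicator {x. 0 < v x} x * f x\<bar> powr p * \<rho> x powr (2 * p - 2))"
      by (auto simp: w2_def indicator_def fun_eq_iff)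
    moreover have "\<dots> \<in> borel_measurable (lebm d)" using fU by measurable
    ultimately show ?thesis by simp
  qed
  have w2i: "integrable (lebm d) w2"
  proof (rule integrable_bounded_support[OF w2m compact_sets_lebm emeasure_compact])
    show "\<bar>w2 x\<bar> \<le> W" if "x \<in> K" for x
    proof -
      have "x \<in> space (lebm d)" unfolding space_lebm using that K(2) by (auto simp only: T_def)
      then show ?thesis using w2W[of x] w10(2)[of x] by simp
    qed
  qed (use K w20 in \<open>auto simp: T_def\<close>)
  have N: "0 \<le> N" by (simp add: N_def)
  have mlim: "(\<lambda>n. \<integral>x. \<bar>m n x - g x\<bar> \<partial>lebm d) \<longlonglongrightarrow> 0"
    unfolding m_def by (rule mollify_L1_tendsto[OF B(1-3) g(1)])
  have "(\<integral>\<^sup>+x. ennreal (w1 x * (g x + \<delta>) powr c) \<partial>lebm d)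
      \<le> ennreal N * (\<integral>\<^sup>+x. ennreal (w2 x * (g x + \<delta>) powr c) \<partial>lebm d)" if "0 < \<delta>" for \<delta>
    by (rule weight_limit_L1[OF c(2) that N w1m w2m w10(1) w1W w10(2) w2W mi g(1) m0 g(2) mlim step[OF that]])
  moreover have wK: "AE x in lebm d. w1 x \<noteq> 0 \<longrightarrow> 0 < g x" "AE x in lebm d. w2 x \<noteq> 0 \<longrightarrow> 0 < g x"
  proof -
    have wz: "w1 x = 0" "w2 x = 0" if "x \<in> space (lebm d)" "x \<notin> K'" for x
    proof -
      have "x \<notin> K" using that(2) K'(2) by blast
      then show "w1 x = 0" "w2 x = 0"
        using vK[OF that(1)[unfolded space_lebm]] w20[OF that(1)[unfolded space_lebm]] by (simp_all add: w1_def)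
    qed
    show "AE x in lebm d. w1 x \<noteq> 0 \<longrightarrow> 0 < g x"
      using g(4) AE_space by eventually_elim (use wz(1) in blast)
    show "AE x in lebm d. w2 x \<noteq> 0 \<longrightarrow> 0 < g x"
      using g(4) AE_space by eventually_elim (use wz(2) in blast)
  qed
  ultimately have main: "(\<integral>\<^sup>+x. ennreal (w1 x * g x powr c) \<partial>lebm d)
      \<le> ennreal N * (\<integral>\<^sup>+x. ennreal (w2 x * g x powr c) \<partial>lebm d)"
    by (intro weight_limit_shift[OF c(2) N w1m w2m borel_measurable_integrable[OF g(1)] w10 w2i g(2)])
  \<comment> \<open>On \<open>Uu\<close> the representative \<open>g\<close> equals \<phi> almost
    everywhere; elsewhere both integrands are zero, so the values of \<open>g\<close> there are
    irrelevant.\<close>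
  have "(\<integral>\<^sup>+x\<in>\<Omega>. ennreal (\<bar>u x\<bar> powr p * \<phi> x powr c * bdry_dist d \<Omega> x powr (- 2)) \<partial>leb d)
      = (\<integral>\<^sup>+x. ennreal (w1 x * g x powr c) \<partial>lebm d)"
    unfolding leb_def nn_integral_completion
  proof (rule nn_integral_cong_AE)
    show "AE x in lebm d. ennreal (\<bar>u x\<bar> powr p * \<phi> x powr c * bdry_dist d \<Omega> x powr (- 2)) * indicator \<Omega> x
        = ennreal (w1 x * g x powr c)"
      using g(3) AE_space
    proof eventually_elim
      case (elim x)
      then have xT: "x \<in> T" by (simp add: space_lebm T_def)
      show ?case
      proof (cases "x \<in> Uu")
        case True
        then have "g x = \<phi> x" using elim(1) UK K'(2) by (auto simp: indicator_def)
        then show ?thesis using True rx[OF xT] by (simp add: w1_def v_def Uu_def \<rho>_def mult_ac)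
      next
        case False
        then show ?thesis using rx[OF xT] by (auto simp: w1_def v_def Uu_def indicator_def)
      qed
    qed
  qed
  also note main
  also have "(\<integral>\<^sup>+x. ennreal (w2 x * g x powr c) \<partial>lebm d)
      = (\<integral>\<^sup>+x\<in>{x \<in> \<Omega>. u x \<noteq> 0}. ennreal (\<bar>laplacian d u x - lam * u x\<bar> powr p * \<phi> x powr c *
         bdry_dist d \<Omega> x powr (2 * p - 2)) \<partial>leb d)"
    unfolding leb_def nn_integral_completion Uu_def[symmetric]
  proof (rule nn_integral_cong_AE)
    show "AE x in lebm d. ennreal (w2 x * g x powr c) = ennreal (\<bar>laplacian d u x - lam * u x\<bar> powr p * \<phi> x powr c *
         bdry_dist d \<Omega> x powr (2 * p - 2)) * indicator Uu x"
      using g(3) AE_space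
    proof eventually_elim
      case (elim x)
      then have xT: "x \<in> T" by (simp add: space_lebm T_def)
      show ?case
      proof (cases "x \<in> Uu")
        case True
        then have "g x = \<phi> x" using elim(1) UK K'(2) by (auto simp: indicator_def)
        moreover have "0 < v x" using True vpos rx[OF xT] by simp
        ultimately show ?thesis using True sgn_f[OF True] by (simp add: w2_def \<rho>_def mult_ac)
      next
        case False
        then have "\<not> 0 < v x" using vpos rx[OF xT] by simp
        then show ?thesis using False by (simp add: w2_def)
      qed
    qed
  qed
  finally show ?thesis unfolding N_def .
qed

theorem theorem2p11:
  fixes p c C0 :: real
  assumes "1 < p" and "- p + 1 < c" and "c < 1" and "0 < C0"
  shows "\<exists>N>0. \<forall>(d::nat)\<ge>1. \<forall>(\<Omega> :: (nat \<Rightarrow> real) set)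
           (\<phi> :: (nat \<Rightarrow> real) \<Rightarrow> real) (u :: (nat \<Rightarrow> real) \<Rightarrow> real).
      openin (Rd d) \<Omega> \<and> \<Omega> \<noteq> topspace (Rd d) \<and>
      hardy_inequality d \<Omega> C0 \<and>
      superharmonic d \<Omega> \<phi> \<and> (AE x in leb d. x \<in> \<Omega> \<longrightarrow> 0 < \<phi> x) \<and>
      continuous_map (subtopology (Rd d) \<Omega>) euclideanreal u \<and>
      compactly_supported_in d \<Omega> u \<and>
      C_on d 2 {x \<in> \<Omega>. u x \<noteq> 0} u \<and>
      (\<integral>\<^sup>+x\<in>{x \<in> \<Omega>. u x \<noteq> 0}. ennreal (\<bar>u x\<bar> powr (p - 1) * hessian_norm d u x) \<partial>leb d) < \<infinity> \<and>
      (\<exists>B. \<forall>x\<in>\<Omega>. u x \<noteq> 0 \<longrightarrow> \<bar>laplacian d u x\<bar> \<le> B)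
      \<longrightarrow> (\<forall>lam\<ge>0.
            (\<integral>\<^sup>+x\<in>\<Omega>. ennreal (\<bar>u x\<bar> powr p * \<phi> x powr c * bdry_dist d \<Omega> x powr (- 2)) \<partial>leb d)
            \<le> ennreal N *
              (\<integral>\<^sup>+x\<in>{x \<in> \<Omega>. u x \<noteq> 0}.
                 ennreal (\<bar>laplacian d u x - lam * u x\<bar> powr p * \<phi> x powr c *
                          bdry_dist d \<Omega> x powr (2 * p - 2)) \<partial>leb d))"
proof (intro exI[of _ "(2 * energy_const p c C0) powr p"] conjI allI impI)
  show "0 < (2 * energy_const p c C0) powr p" using energy_const_pos[OF assms] by simp
next
  fix d :: nat and \<Omega> :: "(nat \<Rightarrow> real) set" and \<phi> u :: "(nat \<Rightarrow> real) \<Rightarrow> real" and lam :: real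
  assume h: "openin (Rd d) \<Omega> \<and> \<Omega> \<noteq> topspace (Rd d) \<and>
      hardy_inequality d \<Omega> C0 \<and>
      superharmonic d \<Omega> \<phi> \<and> (AE x in leb d. x \<in> \<Omega> \<longrightarrow> 0 < \<phi> x) \<and>
      continuous_map (subtopology (Rd d) \<Omega>) euclideanreal u \<and>
      compactly_supported_in d \<Omega> u \<and>
      C_on d 2 {x \<in> \<Omega>. u x \<noteq> 0} u \<and>
      (\<integral>\<^sup>+x\<in>{x \<in> \<Omega>. u x \<noteq> 0}. ennreal (\<bar>u x\<bar> powr (p - 1) * hessian_norm d u x) \<partial>leb d) < \<infinity> \<and>
      (\<exists>B. \<forall>x\<in>\<Omega>. u x \<noteq> 0 \<longrightarrow> \<bar>laplacian d u x\<bar> \<le> B)" and lam: "0 \<le> lam"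
  then obtain Bd where Bd: "\<forall>x\<in>\<Omega>. u x \<noteq> 0 \<longrightarrow> \<bar>laplacian d u x\<bar> \<le> Bd" by blast
  show "(\<integral>\<^sup>+x\<in>\<Omega>. ennreal (\<bar>u x\<bar> powr p * \<phi> x powr c * bdry_dist d \<Omega> x powr (- 2)) \<partial>leb d)
      \<le> ennreal ((2 * energy_const p c C0) powr p) *
        (\<integral>\<^sup>+x\<in>{x \<in> \<Omega>. u x \<noteq> 0}. ennreal (\<bar>laplacian d u x - lam * u x\<bar> powr p * \<phi> x powr c *
           bdry_dist d \<Omega> x powr (2 * p - 2)) \<partial>leb d)"
  \<comment> \<open>An empty domain has no frontier point and is treated apart; its left integral is
    zero.\<close>
  proof (cases "\<Omega> = {}")
    case False
    then show ?thesis
      using h by (intro weighted_estimate_superharmonic[OF assms(1-3) _ _ _ _ _ _ _ _ _ Bd lam]) auto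
  qed simp
qed

end
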